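(* Let $n\le 3$ be a positive integer. Suppose that $\varphi:[0,\infty)\to\mathbb{R}$ is a continuous function with $\varphi(0)=1$, $\lim_{t\to\infty}\varphi(t)=0$ and a derivative $\varphi^{(n)}$ of order $n$ on $(0,\infty)$ such that $(-1)^n\varphi^{(n)}(t)$ is convex for $t>0$. Then the restriction $\psi=\varphi|_{[0,\pi]}$ of $\varphi$ to the interval $[0,\pi]$ belongs to the class $\Psi_{2n+1}^+$.
   Context: Let $\mathbb{S}^d=\{x\in\mathbb{R}^{d+1}:\|x\|=1\}$ and let $\theta(x,y)=\arccos(\langle x,y\rangle)\in[0,\pi]$ be the great circle distance on $\mathbb{S}^d$. A function $h:\mathbb{S}^d\times\mathbb{S}^d\to\mathbb{R}$ is strictly positive definite if $\sum_{i=1}^m\sum_{j=1}^m c_i c_j h(x_i,x_j)\ge 0$ for all finite systems of pairwise distinct points $x_1,\ldots,x_m\in\mathbb{S}^d$ and all $c_1,\ldots,c_m\in\mathbb{R}$, with strict inequality unless $c_1=\cdots=c_m=0$. For an integer $d\ge 1$, the class $\Psi_d^+$ consists of the continuous functions $\psi:[0,\pi]\to\mathbb{R}$ with $\psi(0)=1$ such that $h(x,y)=\psi(\theta(x,y))$ is strictly positive definite on $\mathbb{S}^d$. *)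

theory Defs
  imports "HOL-Analysis.Analysis"
begin

text \<open>
  The sphere of dimension \<open>d\<close> is \<open>topspace (nsphere d)\<close>: points are sequences \<open>x\<close> supported on the
  coordinates \<open>0, \<dots>, d\<close> with \<open>(\<Sum>i\<le>d. x i ^ 2) = 1\<close>. On these sequences the inner product of the
  ambient space of dimension \<open>d + 1\<close> is the sum over \<open>i \<le> d\<close>.
\<close>

definition great_circle_dist :: "nat \<Rightarrow> (nat \<Rightarrow> real) \<Rightarrow> (nat \<Rightarrow> real) \<Rightarrow> real" where
  "great_circle_dist d x y = arccos (\<Sum>i\<le>d. x i * y i)"

definition strictly_positive_definite_on :: "'a set \<Rightarrow> ('a \<Rightarrow> 'a \<Rightarrow> real) \<Rightarrow> bool" where
  "strictly_positive_definite_on S h \<longleftrightarrow>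
    (\<forall>(m::nat) (x :: nat \<Rightarrow> 'a) (c :: nat \<Rightarrow> real).
       x ` {1..m} \<subseteq> S \<and> inj_on x {1..m} \<longrightarrow>
         (\<Sum>i=1..m. \<Sum>j=1..m. c i * c j * h (x i) (x j)) \<ge> 0 \<and>
         (\<not> (\<forall>i\<in>{1..m}. c i = 0) \<longrightarrow>
            (\<Sum>i=1..m. \<Sum>j=1..m. c i * c j * h (x i) (x j)) > 0))"

text \<open>
  Functions with domain \<open>[0, pi]\<close> are represented by the total functions that are \<open>undefined\<close> outside
  of it (\<open>extensional\<close>). The class is only of interest for \<open>d \<ge> 1\<close>.
\<close>

definition Psi_plus :: "nat \<Rightarrow> (real \<Rightarrow> real) set" where
  "Psi_plus d = {\<psi> \<in> extensional {0..pi}.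
     continuous_on {0..pi} \<psi> \<and> \<psi> 0 = 1 \<and>
     strictly_positive_definite_on (topspace (nsphere d)) (\<lambda>x y. \<psi> (great_circle_dist d x y))}"

end

theory Submission
  imports Defs
begin

text \<open>
  The measure of the intersection of two spherical caps of the same radius around \<open>x\<close> and \<open>y\<close> is a
  positive definite kernel, because it is an integral of products of indicator functions. On the sphere of
  dimension \<open>2 n + 1\<close> its derivative with respect to the distance \<open>\<theta>\<close> of \<open>x\<close> and \<open>y\<close> is, up to a
  negative factor, \<open>(max 0 (cos \<theta> - u) / (1 + cos \<theta>)) ^ n\<close>, where \<open>u\<close> encodes the radius. Hence the
  truncated power \<open>max 0 (c - \<theta>) ^ (n + 1)\<close> is, up to a nonnegative constant, a nonnegative mixture of such
  kernels as soon as \<open>x \<mapsto> ((1 + x) (c - arccos x)) ^ n\<close> has a nonnegative derivative of order \<open>n + 1\<close>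
  (Taylor's formula with integral remainder), which holds for \<open>n \<le> 3\<close>. The mixture contains caps of
  arbitrarily small radius; these are disjoint for distinct centres, so that the quadratic form becomes
  diagonal, and strictness follows. Finally \<open>\<phi>\<close> is a mixture of truncated powers: \<open>(-1)\<^sup>n \<phi>\<^sup>(\<^sup>n\<^sup>)\<close> is convex and
  decreases to \<open>0\<close>, so the layer cake formula for its slope represents it by functions \<open>max 0 (\<tau> - t)\<close>, and
  \<open>n\<close> integrations raise the exponent to \<open>n + 1\<close>.
\<close>

section \<open>Intersections of spherical caps\<close>

text \<open>The odd dimension makes the caps computable: besides the plane of \<open>x\<close> and
  \<open>y\<close> there are \<open>2 n\<close> ambient coordinates, so the slice of a ball over a
  point \<open>(u, y)\<close> of that plane has volume proportional to
  \<open>max 0 (K - u^2 - y^2) ^ n\<close>, and the planar integral is elementary. Lebesgue measure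
  of balls and shells cut by half-spaces replaces a surface measure on the sphere.

  The factor \<open>(1 + x) ^ n\<close> comes from comparing derivatives in \<theta>: with
  \<open>x = cos \<theta>\<close> the kernel contributes \<open>((x - u) / (1 + x)) ^ n\<close> and
  the truncated power \<open>(c - \<theta>) ^ n\<close>.

  The main obstacle is the third derivative of \<open>(1 + x) (c - arccos x)\<close>, which may be
  negative and, like the second one, is singular at -1. In the derivatives of the
  \<open>n\<close>-th power it always occurs next to a factor \<open>(1 + x) (c - arccos x)\<close>,
  which tames the singularity, and the remaining terms outweigh it. The expansion point is -1 as
  soon as \<open>c \<ge> pi\<close>, hence the one-sided limits there.

  Mixtures are kept as nonnegative integrals, so that the order of integration can be exchanged
  freely; the signed coefficients enter only after finiteness is known.\<close>

lemma nn_integral_FTC_einterval: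
  fixes f F :: "real \<Rightarrow> real" and a b :: ereal
  assumes "a < b"
    and F: "\<And>x. a < ereal x \<Longrightarrow> ereal x < b \<Longrightarrow> DERIV F x :> f x"
    and f: "\<And>x. a < ereal x \<Longrightarrow> ereal x < b \<Longrightarrow> isCont f x"
    and nonneg: "\<And>x. a < ereal x \<Longrightarrow> ereal x < b \<Longrightarrow> 0 \<le> f x"
    and A: "((F \<circ> real_of_ereal) \<longlongrightarrow> A) (at_right a)"
    and B: "((F \<circ> real_of_ereal) \<longlongrightarrow> B) (at_left b)"
  shows "(\<integral>\<^sup>+x. ennreal (f x) * indicator (einterval a b) x \<partial>lborel) = ennreal (B - A)"
proof -
  have nn: "AE x in lborel. a < ereal x \<longrightarrow> ereal x < b \<longrightarrow> 0 \<le> f x"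
    using nonneg by simp
  note FTC = interval_integral_FTC_nonneg[OF \<open>a < b\<close> F f nn A B]
  have int: "integrable lborel (\<lambda>x. indicator (einterval a b) x * f x)"
    using FTC(1) by (simp add: set_integrable_def)
  have "(\<integral>\<^sup>+x. ennreal (f x) * indicator (einterval a b) x \<partial>lborel)
      = (\<integral>\<^sup>+x. ennreal (indicator (einterval a b) x * f x) \<partial>lborel)"
    by (intro nn_integral_cong) (auto simp: indicator_def)
  also have "\<dots> = ennreal (\<integral>x. indicator (einterval a b) x * f x \<partial>lborel)"
    by (rule nn_integral_eq_integral[OF int]) (auto simp: indicator_def einterval_iff nonneg)
  also have "(\<integral>x. indicator (einterval a b) x * f x \<partial>lborel) = B - A"
    using FTC(2) \<open>a < b\<close> by (simp add: interval_lebesgue_integral_def set_lebesgue_integral_def less_imp_le)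
  finally show ?thesis .
qed

text \<open>The truncation is harmless because the exponent is at least 2: at 0 the difference
  quotient of \<open>max 0 y ^ Suc n\<close> is bounded by \<open>\<bar>y\<bar> ^ n\<close>, which
  tends to 0 as \<open>n \<ge> 1\<close>.\<close>

lemma DERIV_max_power_Suc:
  fixes f :: "real \<Rightarrow> real"
  assumes f: "DERIV f x :> D" and n: "n \<ge> 1"
  shows "DERIV (\<lambda>x. max 0 (f x) ^ Suc n) x :> real (Suc n) * max 0 (f x) ^ n * D"
proof -
  have "DERIV (\<lambda>y. max 0 y ^ Suc n) z :> real (Suc n) * max 0 z ^ n" for z :: real
  proof (cases "z = 0")
    case False
    then consider "z > 0" | "z < 0" by linarith
    then show ?thesis
    proof cases
      case 1
      have "DERIV (\<lambda>y. y ^ Suc n) z :> real (Suc n) * max 0 z ^ n"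
        using 1 DERIV_pow[of "Suc n" z] by (simp add: max_def)
      then show ?thesis
        by (rule has_field_derivative_transform_within_open[of _ _ _ "{0<..}"]) (use 1 in auto)
    next
      case 2
      have "DERIV (\<lambda>y. 0) z :> real (Suc n) * max 0 z ^ n"
        using 2 n by (simp add: max_def power_0_left)
      then show ?thesis
        by (rule has_field_derivative_transform_within_open[of _ _ _ "{..<0}"])
           (use 2 in \<open>auto simp: max_def\<close>)
    qed
  next
    case True
    have "((\<lambda>y. max 0 y ^ Suc n / y) \<longlongrightarrow> 0) (at (0::real))"
    proof (rule Lim_null_comparison)
      show "\<forall>\<^sub>F y in at 0. norm (max 0 y ^ Suc n / y :: real) \<le> \<bar>y\<bar> ^ n"
        by (intro always_eventually) (auto simp: max_def)
      show "((\<lambda>y::real. \<bar>y\<bar> ^ n) \<longlongrightarrow> 0) (at 0)"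
        using n by (auto intro!: tendsto_eq_intros)
    qed
    then show ?thesis
      using True n by (simp add: has_field_derivative_iff power_0_left)
  qed
  from DERIV_chain2[OF this f] show ?thesis .
qed

text \<open>
  The substitution \<open>y = v s\<close> rotates one side of the wedge: \<open>(u, v s)\<close> is the point with first
  coordinate \<open>u\<close> on the line at distance \<open>a\<close> from the origin with unit normal \<open>(cos s, sin s)\<close>.
\<close>
lemma wedge_section_substitution:
  fixes a u \<theta> K :: real and n :: nat
  assumes a: "a > 0" and u: "u > a" and th: "0 \<le> \<theta>" "\<theta> < pi" and n: "n \<ge> 1"
  defines "v \<equiv> \<lambda>s. (a - u * cos s) / sin s"
  shows "(\<integral>\<^sup>+y. ennreal (max 0 (K - u\<^sup>2 - y\<^sup>2) ^ n) * indicator {y. u * cos \<theta> + y * sin \<theta> > a} y \<partial>lborel)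
       = (\<integral>\<^sup>+s. ennreal (max 0 (K - u\<^sup>2 - (v s)\<^sup>2) ^ n * ((u - a * cos s) / (sin s)\<^sup>2))
             * indicator {\<theta><..<pi} s \<partial>lborel)"
proof -
  define f where "f = (\<lambda>y::real. max 0 (K - u\<^sup>2 - y\<^sup>2) ^ n)"
  have contf: "isCont f y" for y
    unfolding f_def by (intro continuous_intros)
  \<comment> \<open>One global antiderivative serves both sides: each integral turns out to be
    \<open>F M - FA\<close>, by the fundamental theorem applied to \<open>F\<close> and to
    \<open>F\<close> composed with \<open>v\<close>.\<close>
  obtain F where F: "\<And>y. DERIV F y :> f y"
    using einterval_antiderivative[of "-\<infinity>" "\<infinity>" f] contf
    by (auto simp: has_real_derivative_iff_has_vector_derivative)
  \<comment> \<open>Outside \<open>[-M, M]\<close> the truncated power vanishes, since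
    \<open>M^2 \<ge> 1 + 2 \<bar>K\<bar> > K\<close>. Hence \<open>F\<close> is constant there and
    has limits at both infinities.\<close>
  define M where "M = 1 + \<bar>K\<bar>"
  have f0: "f y = 0" if "\<bar>y\<bar> \<ge> M" for y
  proof -
    have "y\<^sup>2 \<ge> M\<^sup>2" using that by (simp add: M_def abs_le_square_iff[symmetric])
    moreover have "M\<^sup>2 \<ge> 1 + 2 * \<bar>K\<bar>" by (simp add: M_def power2_eq_square algebra_simps)
    ultimately have "K - u\<^sup>2 - y\<^sup>2 \<le> 0" using zero_le_power2[of u] by linarith
    then show ?thesis using n by (simp add: f_def)
  qed
  have Fconst: "F y = F z" if "y < z" and "\<And>x. y \<le> x \<Longrightarrow> x \<le> z \<Longrightarrow> \<bar>x\<bar> \<ge> M" for y z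
  proof (rule DERIV_isconst_end[of y z F, symmetric])
    show "continuous_on {y..z} F"
      using F by (blast intro: DERIV_continuous_on has_field_derivative_at_within)
    show "DERIV F x :> 0" if "y < x" "x < z" for x
      using F[of x] f0[of x] \<open>\<And>x. y \<le> x \<Longrightarrow> x \<le> z \<Longrightarrow> \<bar>x\<bar> \<ge> M\<close>[of x] that by simp
  qed fact
  have Ftop: "F y = F M" if "y \<ge> M" for y
    using that Fconst[of M y] by (cases "y = M") auto
  have Fbot: "F y = F (-M)" if "y \<le> -M" for y
    using that Fconst[of y "-M"] by (cases "y = -M") (auto simp: M_def)
  have limtop: "(F \<longlongrightarrow> F M) at_top"
    by (rule tendsto_eventually, rule eventually_mono[OF eventually_ge_at_top[of M]], rule Ftop)
  have limbot: "(F \<longlongrightarrow> F (-M)) at_bot"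
    by (rule tendsto_eventually, rule eventually_mono[OF eventually_le_at_bot[of "-M"]], rule Fbot)
  \<comment> \<open>For \<open>\<theta> = 0\<close> the two half-planes coincide and the section is
    the whole line; correspondingly \<open>v\<close> tends to minus infinity at 0, because
    \<open>a - u < 0\<close>.\<close>
  define A where "A = (if \<theta> = 0 then -\<infinity> else ereal (v \<theta>))"
  define FA where "FA = (if \<theta> = 0 then F (-M) else F (v \<theta>))"
  have sinpos: "sin s > 0" if "\<theta> < s" "s < pi" for s
    using that th by (intro sin_gt_zero) auto
  have set_eq: "{y. u * cos \<theta> + y * sin \<theta> > a} = einterval A \<infinity>"
  proof (cases "\<theta> = 0")
    case True
    then show ?thesis using u by (auto simp: A_def einterval_def)
  next
    case False
    have "sin \<theta> > 0" using False th by (intro sin_gt_zero) auto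
    then show ?thesis using False by (auto simp: A_def einterval_def v_def field_simps)
  qed
  have "(\<integral>\<^sup>+y. ennreal (f y) * indicator (einterval A \<infinity>) y \<partial>lborel) = ennreal (F M - FA)"
  proof (rule nn_integral_FTC_einterval)
    show "A < \<infinity>" by (simp add: A_def)
    show "((F \<circ> real_of_ereal) \<longlongrightarrow> FA) (at_right A)"
    proof (cases "\<theta> = 0")
      case True
      then show ?thesis using limbot by (simp add: A_def FA_def ereal_tendsto_simps)
    next
      case False
      have "(F \<longlongrightarrow> F (v \<theta>)) (at_right (v \<theta>))"
        using F DERIV_isCont continuous_at_imp_continuous_at_within continuous_within by blast
      then show ?thesis using False by (simp add: A_def FA_def ereal_tendsto_simps)
    qed
    show "((F \<circ> real_of_ereal) \<longlongrightarrow> F M) (at_left \<infinity>)"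
      using limtop by (simp add: ereal_tendsto_simps)
  qed (use F contf in \<open>auto simp: f_def\<close>)
  moreover have "(\<integral>\<^sup>+s. ennreal (f (v s) * ((u - a * cos s) / (sin s)\<^sup>2)) * indicator (einterval \<theta> pi) s \<partial>lborel)
      = ennreal (F M - FA)"
  proof (rule nn_integral_FTC_einterval[where F = "\<lambda>s. F (v s)"])
    show "ereal \<theta> < ereal pi" using th by simp
    fix s assume s: "ereal \<theta> < ereal s" "ereal s < ereal pi"
    have sp: "sin s > 0" using s sinpos by simp
    have "DERIV v s :> (u * sin s * sin s - (a - u * cos s) * cos s) / (sin s * sin s)"
      unfolding v_def using sp by (auto intro!: derivative_eq_intros)
    moreover have "u * sin s * sin s - (a - u * cos s) * cos s = u - a * cos s"
      using sin_cos_squared_add[of s] by algebra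
    ultimately have "DERIV v s :> (u - a * cos s) / (sin s)\<^sup>2"
      by (simp add: power2_eq_square)
    from DERIV_chain2[OF F this]
    show "DERIV (\<lambda>s. F (v s)) s :> f (v s) * ((u - a * cos s) / (sin s)\<^sup>2)" .
    show "isCont (\<lambda>s. f (v s) * ((u - a * cos s) / (sin s)\<^sup>2)) s"
      unfolding f_def v_def using sp by (intro continuous_intros) auto
    have "a * cos s \<le> u" using a u cos_le_one[of s] by (smt (verit) mult_left_le)
    then show "0 \<le> f (v s) * ((u - a * cos s) / (sin s)\<^sup>2)"
      by (auto simp: f_def)
  next
    show "(((\<lambda>s. F (v s)) \<circ> real_of_ereal) \<longlongrightarrow> FA) (at_right (ereal \<theta>))"
    proof (cases "\<theta> = 0")
      case True
      have "((\<lambda>s. F (v s)) \<longlongrightarrow> F (-M)) (at_right 0)"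
      proof (rule filterlim_compose[OF limbot])
        have "filterlim (\<lambda>s. inverse (sin s)) at_top (at_right (0::real))"
        proof (rule filterlim_inverse_at_top)
          show "(sin \<longlongrightarrow> (0::real)) (at_right 0)"
            by (auto intro!: tendsto_eq_intros)
          show "\<forall>\<^sub>F s in at_right (0::real). sin s > 0"
            by (auto simp: eventually_at_right_field intro!: exI[of _ pi] sin_gt_zero)
        qed
        moreover have "((\<lambda>s. a - u * cos s) \<longlongrightarrow> a - u) (at_right 0)"
          by (auto intro!: tendsto_eq_intros)
        ultimately show "filterlim v at_bot (at_right 0)"
          unfolding v_def divide_inverse using u
          by (intro filterlim_tendsto_neg_mult_at_bot[where c = "a - u"]) auto
      qed
      then show ?thesis using True by (simp add: FA_def ereal_tendsto_simps)
    next
      case False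
      have "sin \<theta> > 0" using False th by (intro sin_gt_zero) auto
      then have "isCont v \<theta>" unfolding v_def by (intro continuous_intros) auto
      then have "isCont (\<lambda>s. F (v s)) \<theta>"
        using F DERIV_isCont isCont_o2 by blast
      then have "((\<lambda>s. F (v s)) \<longlongrightarrow> F (v \<theta>)) (at_right \<theta>)"
        using continuous_at_imp_continuous_at_within continuous_within by blast
      then show ?thesis using False by (simp add: FA_def ereal_tendsto_simps)
    qed
    have "((\<lambda>s. F (v s)) \<longlongrightarrow> F M) (at_left pi)"
    proof (rule filterlim_compose[OF limtop])
      have "filterlim (\<lambda>s. inverse (sin s)) at_top (at_left pi)"
      proof (rule filterlim_inverse_at_top)
        show "(sin \<longlongrightarrow> (0::real)) (at_left pi)"
          by (auto intro!: tendsto_eq_intros)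
        show "\<forall>\<^sub>F s in at_left pi. sin s > 0"
          by (auto simp: eventually_at_left_field intro!: exI[of _ 0] sin_gt_zero)
      qed
      moreover have "((\<lambda>s. a - u * cos s) \<longlongrightarrow> a + u) (at_left pi)"
        by (auto intro!: tendsto_eq_intros)
      ultimately show "filterlim v at_top (at_left pi)"
        unfolding v_def divide_inverse using u a
        by (intro filterlim_tendsto_pos_mult_at_top[where c = "a + u"]) auto
    qed
    then show "(((\<lambda>s. F (v s)) \<circ> real_of_ereal) \<longlongrightarrow> F M) (at_left (ereal pi))"
      by (simp add: ereal_tendsto_simps)
  qed
  ultimately show ?thesis
    unfolding set_eq f_def by (simp add: einterval_eq)
qed

text \<open>After the substitution the order of integration is exchanged. For fixed \<open>s\<close>
  the integrand is \<open>- 1 / 2\<close> times \<open>max 0 w ^ n\<close> times the derivative of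
  \<open>w = K - u^2 - (v s)^2\<close> in \<open>u\<close>, so only the value at
  \<open>u = a\<close> survives.\<close>

lemma planar_wedge_integral:
  fixes a \<theta> K :: real and n :: nat
  assumes a: "a > 0" and th: "0 \<le> \<theta>" "\<theta> < pi" and n: "n \<ge> 1"
  shows "(\<integral>\<^sup>+u. \<integral>\<^sup>+y. ennreal (max 0 (K - u\<^sup>2 - y\<^sup>2) ^ n)
             * indicator {y. u > a \<and> u * cos \<theta> + y * sin \<theta> > a} y \<partial>lborel \<partial>lborel)
       = (\<integral>\<^sup>+s. ennreal (max 0 (K - 2 * a\<^sup>2 / (1 + cos s)) ^ Suc n / (2 * real (Suc n)))
             * indicator {\<theta><..<pi} s \<partial>lborel)"
proof -
  define G where "G = (\<lambda>u s. max 0 (K - u\<^sup>2 - ((a - u * cos s) / sin s)\<^sup>2) ^ n * ((u - a * cos s) / (sin s)\<^sup>2))"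
  have [measurable]: "(\<lambda>x. G (fst x) (snd x)) \<in> borel_measurable (borel \<Otimes>\<^sub>M borel)"
    unfolding G_def by measurable
  have "(\<integral>\<^sup>+y. ennreal (max 0 (K - u\<^sup>2 - y\<^sup>2) ^ n)
             * indicator {y. u > a \<and> u * cos \<theta> + y * sin \<theta> > a} y \<partial>lborel)
      = (\<integral>\<^sup>+s. ennreal (G u s) * indicator {a<..} u * indicator {\<theta><..<pi} s \<partial>lborel)" for u
  proof (cases "u > a")
    case True
    then show ?thesis
      using wedge_section_substitution[OF a True th n, of K] by (simp add: G_def)
  qed (simp add: indicator_def)
  then have "(\<integral>\<^sup>+u. \<integral>\<^sup>+y. ennreal (max 0 (K - u\<^sup>2 - y\<^sup>2) ^ n)
             * indicator {y. u > a \<and> u * cos \<theta> + y * sin \<theta> > a} y \<partial>lborel \<partial>lborel)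
      = (\<integral>\<^sup>+u. \<integral>\<^sup>+s. ennreal (G u s) * indicator {a<..} u * indicator {\<theta><..<pi} s \<partial>lborel \<partial>lborel)"
    by simp
  also have "\<dots> = (\<integral>\<^sup>+s. \<integral>\<^sup>+u. ennreal (G u s) * indicator {a<..} u * indicator {\<theta><..<pi} s \<partial>lborel \<partial>lborel)"
    by (rule lborel_pair.Fubini'[symmetric]) (simp add: case_prod_beta)
  also have "\<dots> = (\<integral>\<^sup>+s. ennreal (max 0 (K - 2 * a\<^sup>2 / (1 + cos s)) ^ Suc n / (2 * real (Suc n)))
             * indicator {\<theta><..<pi} s \<partial>lborel)"
  proof (intro nn_integral_cong)
    fix s :: real
    show "(\<integral>\<^sup>+u. ennreal (G u s) * indicator {a<..} u * indicator {\<theta><..<pi} s \<partial>lborel)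
       = ennreal (max 0 (K - 2 * a\<^sup>2 / (1 + cos s)) ^ Suc n / (2 * real (Suc n))) * indicator {\<theta><..<pi} s"
    proof (cases "s \<in> {\<theta><..<pi}")
      case True
      then have sp: "sin s > 0" using th by (intro sin_gt_zero) auto
      define w where "w = (\<lambda>u. K - u\<^sup>2 - ((a - u * cos s) / sin s)\<^sup>2)"
      have "AE u in lborel. ennreal (G u s) * indicator {a<..} u * indicator {\<theta><..<pi} s
          = ennreal (G u s) * indicator {a..} u"
        using AE_lborel_singleton[of a] by eventually_elim (use True in \<open>auto simp: indicator_def\<close>)
      then have "(\<integral>\<^sup>+u. ennreal (G u s) * indicator {a<..} u * indicator {\<theta><..<pi} s \<partial>lborel)
          = (\<integral>\<^sup>+u. ennreal (G u s) * indicator {a..} u \<partial>lborel)"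
        by (rule nn_integral_cong_AE)
      also have "\<dots> = ennreal (0 - (- (max 0 (w a) ^ Suc n / (2 * real (Suc n)))))"
      proof (rule nn_integral_FTC_atLeast)
        show "(\<lambda>u. G u s) \<in> borel_measurable borel" by (simp add: G_def)
        fix u assume u: "a \<le> u"
        have d: "DERIV (\<lambda>u. (a - u * cos s) / sin s) u :> - (cos s / sin s)"
          using sp by (auto intro!: derivative_eq_intros)
        have "DERIV w u :> - 2 * u + 2 * ((a - u * cos s) / sin s) * (cos s / sin s)"
          unfolding w_def by (rule derivative_eq_intros d refl | simp)+
        moreover have "- 2 * u + 2 * ((a - u * cos s) / sin s) * (cos s / sin s)
            = (- 2 * u * (sin s)\<^sup>2 + 2 * (a - u * cos s) * cos s) / (sin s)\<^sup>2"
        proof -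
          have "- 2 * u + X / (sin s)\<^sup>2 = (- 2 * u * (sin s)\<^sup>2 + X) / (sin s)\<^sup>2" for X
            using sp by (simp add: add_divide_distrib diff_divide_distrib)
          from this[of "2 * (a - u * cos s) * cos s"] show ?thesis by (simp add: power2_eq_square)
        qed
        moreover have "- 2 * u * (sin s)\<^sup>2 + 2 * (a - u * cos s) * cos s = - 2 * (u - a * cos s)"
          using sin_cos_squared_add[of s] by algebra
        ultimately have "DERIV w u :> - 2 * (u - a * cos s) / (sin s)\<^sup>2" by simp
        from DERIV_max_power_Suc[OF this n]
        have "DERIV (\<lambda>u. - (max 0 (w u) ^ Suc n / (2 * real (Suc n)))) u
            :> - (real (Suc n) * max 0 (w u) ^ n * (- 2 * (u - a * cos s) / (sin s)\<^sup>2) / (2 * real (Suc n)))"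
          by (intro DERIV_minus DERIV_cdivide)
        also have "- (real (Suc n) * max 0 (w u) ^ n * (- 2 * (u - a * cos s) / (sin s)\<^sup>2) / (2 * real (Suc n))) = G u s"
          using sp by (simp add: G_def w_def field_simps del: of_nat_Suc)
        finally show "DERIV (\<lambda>u. - (max 0 (w u) ^ Suc n / (2 * real (Suc n)))) u :> G u s" .
        have "a * cos s \<le> u" using a u cos_le_one[of s] by (smt (verit) mult_left_le)
        then show "0 \<le> G u s" by (auto simp: G_def)
      next
        have "w u \<le> 0" if "u \<ge> 1 + \<bar>K\<bar>" for u
        proof -
          have "u\<^sup>2 \<ge> (1 + \<bar>K\<bar>)\<^sup>2" using that by (simp add: abs_le_square_iff[symmetric])
          moreover have "(1 + \<bar>K\<bar>)\<^sup>2 \<ge> 1 + 2 * \<bar>K\<bar>" by (simp add: power2_eq_square algebra_simps)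
          ultimately show ?thesis
            using zero_le_power2[of "(a - u * cos s) / sin s"] unfolding w_def by linarith
        qed
        then have "max 0 (w u) = 0" if "u \<ge> 1 + \<bar>K\<bar>" for u
          using that by (simp add: max_def antisym)
        then have "- (max 0 (w u) ^ Suc n / (2 * real (Suc n))) = 0" if "u \<ge> 1 + \<bar>K\<bar>" for u
          using that by simp
        then show "((\<lambda>u. - (max 0 (w u) ^ Suc n / (2 * real (Suc n)))) \<longlongrightarrow> 0) at_top"
          by (intro tendsto_eventually eventually_mono[OF eventually_ge_at_top[of "1 + \<bar>K\<bar>"]])
      qed
      \<comment> \<open>At \<open>u = a\<close> the point \<open>(u, v s)\<close> is the vertex of
        the wedge whose normals enclose the angle \<open>s\<close>. Its distance from the origin is
        \<open>a / cos (s / 2)\<close>, and \<open>2 (cos (s / 2))^2 = 1 + cos s\<close>.\<close>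
      also have "w a = K - 2 * a\<^sup>2 / (1 + cos s)"
      proof -
        have "a\<^sup>2 + ((a - a * cos s) / sin s)\<^sup>2 = a\<^sup>2 * ((sin s)\<^sup>2 + (1 - cos s)\<^sup>2) / (sin s)\<^sup>2"
        proof -
          have e: "a - a * cos s = a * (1 - cos s)" by (simp add: algebra_simps)
          show ?thesis
            unfolding e power_divide power_mult_distrib using sp by (simp add: distrib_left add_divide_distrib)
        qed
        also have "(sin s)\<^sup>2 = (1 - cos s) * (1 + cos s)"
          using sin_cos_squared_add[of s] by algebra
        also have "a\<^sup>2 * ((1 - cos s) * (1 + cos s) + (1 - cos s)\<^sup>2) / ((1 - cos s) * (1 + cos s)) = 2 * a\<^sup>2 / (1 + cos s)"
        proof -
          have "1 - cos s \<noteq> 0"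
          proof
            assume "1 - cos s = 0"
            then have "cos s = 1" by simp
            then have "(sin s)\<^sup>2 = 0" using sin_cos_squared_add[of s] unfolding \<open>cos s = 1\<close> by simp
            with sp show False by simp
          qed
          moreover have "(1 - cos s) * (1 + cos s) + (1 - cos s)\<^sup>2 = (1 - cos s) * 2"
            by (simp add: power2_eq_square algebra_simps)
          moreover have "d \<noteq> 0 \<Longrightarrow> a\<^sup>2 * (d * 2) / (d * e) = 2 * a\<^sup>2 / e" for d e :: real
            by simp
          ultimately show ?thesis by metis
        qed
        finally show ?thesis by (simp add: w_def)
      qed
      finally show ?thesis using True by simp
    qed simp
  qed
  finally show ?thesis .
qed

section \<open>Volume of a ball cut by two half-spaces\<close>

lemma emeasure_PiM_ball:
  fixes A :: "'i set" and K :: real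
  assumes A: "finite A" "card A = 2 * n" and n: "n \<ge> 1"
  shows "emeasure (Pi\<^sub>M A (\<lambda>_. lborel)) ({f. (\<Sum>i\<in>A. (f i)\<^sup>2) \<le> K} \<inter> space (Pi\<^sub>M A (\<lambda>_. lborel)))
      = ennreal (unit_ball_vol (real (2 * n)) * max 0 K ^ n)"
proof -
  let ?M = "Pi\<^sub>M A (\<lambda>_. lborel :: real measure)"
  have pos: "emeasure ?M ({f. (\<Sum>i\<in>A. (f i)\<^sup>2) \<le> K} \<inter> space ?M)
      = ennreal (unit_ball_vol (real (2 * n)) * K ^ n)" if "K > 0" for K
  proof -
    have "emeasure ?M ({f. sqrt (\<Sum>i\<in>A. (f i)\<^sup>2) \<le> sqrt K} \<inter> space ?M)
        = ennreal (unit_ball_vol (real (2 * n)) * sqrt K ^ (2 * n))"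
      using emeasure_cball_aux[OF A(1), of "sqrt K"] that A(2) by simp
    then show ?thesis using that by (simp add: power_mult)
  qed
  show ?thesis
  proof (cases "K > 0")
    case True
    then show ?thesis using pos by simp
  next
    case False
    \<comment> \<open>The volume formula is available for positive radii. For
      \<open>K \<le> 0\<close> the set lies in every ball of positive radius, and the volumes tend
      to 0 because the dimension is positive.\<close>
    have "emeasure ?M ({f. (\<Sum>i\<in>A. (f i)\<^sup>2) \<le> K} \<inter> space ?M) \<le> 0"
    proof (rule tendsto_lowerbound)
      have "((\<lambda>e. unit_ball_vol (real (2 * n)) * e ^ n) \<longlongrightarrow> 0) (at_right 0)"
        using n by (auto intro!: tendsto_eq_intros)
      then show "((\<lambda>e. ennreal (unit_ball_vol (real (2 * n)) * e ^ n)) \<longlongrightarrow> 0) (at_right 0)"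
        using tendsto_ennrealI by fastforce
      have "emeasure ?M ({f. (\<Sum>i\<in>A. (f i)\<^sup>2) \<le> K} \<inter> space ?M) \<le> ennreal (unit_ball_vol (real (2 * n)) * e ^ n)"
        if "e > 0" for e
        unfolding pos[OF that, symmetric] using False that
        by (intro emeasure_mono) auto
      then show "\<forall>\<^sub>F e in at_right 0. emeasure ?M ({f. (\<Sum>i\<in>A. (f i)\<^sup>2) \<le> K} \<inter> space ?M)
          \<le> ennreal (unit_ball_vol (real (2 * n)) * e ^ n)"
        by (auto simp: eventually_at_right_field intro!: exI[of _ 1])
    qed simp
    then show ?thesis using False n by (simp add: max_def power_0_left)
  qed
qed

text \<open>Only the coordinates along \<open>b\<close> and \<open>c\<close> meet the half-spaces.
  The other \<open>2 n\<close> range over a ball of squared radius \<open>K - u^2 - y^2\<close>,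
  which supplies the exponent \<open>n\<close> of the planar integral.\<close>

lemma emeasure_ball_wedge_axes:
  fixes b c :: "'a::euclidean_space" and a \<theta> K :: real and n :: nat
  assumes bc: "b \<in> Basis" "c \<in> Basis" "b \<noteq> c" and dim: "DIM('a) = 2 * n + 2"
    and n: "n \<ge> 1" and a: "a > 0" and th: "0 \<le> \<theta>" "\<theta> < pi"
  shows "emeasure lborel {z. z \<bullet> z \<le> K \<and> z \<bullet> b > a \<and> z \<bullet> (cos \<theta> *\<^sub>R b + sin \<theta> *\<^sub>R c) > a}
       = ennreal (unit_ball_vol (real (2 * n))) *
          (\<integral>\<^sup>+s. ennreal (max 0 (K - 2 * a\<^sup>2 / (1 + cos s)) ^ Suc n / (2 * real (Suc n)))
             * indicator {\<theta><..<pi} s \<partial>lborel)"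
proof -
  interpret product_sigma_finite "\<lambda>_::'a. lborel :: real measure" by standard
  define A where "A = Basis - {b, c}"
  have A: "finite A" "b \<notin> insert c A" "c \<notin> A" "Basis = insert b (insert c A)" "card A = 2 * n"
    using bc dim by (auto simp: A_def card_Diff_subset)
  define W where "W = {z. z \<bullet> z \<le> K \<and> z \<bullet> b > a \<and> z \<bullet> (cos \<theta> *\<^sub>R b + sin \<theta> *\<^sub>R c) > a}"
  have [measurable]: "W \<in> sets borel"
    unfolding W_def by measurable
  define P where "P = (\<lambda>(u::real) (y::real) (q::real). q \<le> K - u\<^sup>2 - y\<^sup>2 \<and> u > a \<and> u * cos \<theta> + y * sin \<theta> > a)"
  have "emeasure lborel W = (\<integral>\<^sup>+z. indicator W z \<partial>lborel)" by simp
  also have "\<dots> = (\<integral>\<^sup>+f. indicator W (\<Sum>k\<in>Basis. f k *\<^sub>R k) \<partial>Pi\<^sub>M Basis (\<lambda>_. lborel))"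
    by (subst lborel_eq, subst nn_integral_distr) auto
  also have "\<dots> = (\<integral>\<^sup>+u. \<integral>\<^sup>+y. \<integral>\<^sup>+f. indicator W (\<Sum>k\<in>Basis. (f(c := y, b := u)) k *\<^sub>R k)
      \<partial>Pi\<^sub>M A (\<lambda>_. lborel) \<partial>lborel \<partial>lborel)"
  proof -
    have m: "(\<lambda>f. indicator W (\<Sum>k\<in>Basis. f k *\<^sub>R k) :: ennreal) \<in> borel_measurable (Pi\<^sub>M (insert b (insert c A)) (\<lambda>_. lborel))"
      unfolding A(4)[symmetric] by measurable
    have "(\<integral>\<^sup>+f. indicator W (\<Sum>k\<in>Basis. f k *\<^sub>R k) \<partial>Pi\<^sub>M Basis (\<lambda>_. lborel))
      = (\<integral>\<^sup>+u. \<integral>\<^sup>+f. indicator W (\<Sum>k\<in>Basis. (f(b := u)) k *\<^sub>R k) \<partial>Pi\<^sub>M (insert c A) (\<lambda>_. lborel) \<partial>lborel)"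
      unfolding A(4)[THEN arg_cong[where f = "\<lambda>S. Pi\<^sub>M S _"]]
      using A m by (intro product_nn_integral_insert_rev) auto
    also have "\<dots> = (\<integral>\<^sup>+u. \<integral>\<^sup>+y. \<integral>\<^sup>+f. indicator W (\<Sum>k\<in>Basis. (f(c := y, b := u)) k *\<^sub>R k)
      \<partial>Pi\<^sub>M A (\<lambda>_. lborel) \<partial>lborel \<partial>lborel)"
    proof (intro nn_integral_cong product_nn_integral_insert_rev)
      fix u :: real
      have "(\<lambda>f. f(b := u)) \<in> measurable (Pi\<^sub>M (insert c A) (\<lambda>_. lborel)) (Pi\<^sub>M (insert b (insert c A)) (\<lambda>_. lborel))"
        by (rule measurable_fun_upd[where J = "insert c A"]) auto
      from measurable_compose[OF this m]
      show "(\<lambda>f. indicator W (\<Sum>k\<in>Basis. (f(b := u)) k *\<^sub>R k) :: ennreal) \<in> borel_measurable (Pi\<^sub>M (insert c A) (\<lambda>_. lborel))" .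
    qed (use A in auto)
    finally show ?thesis .
  qed
  also have "\<dots> = (\<integral>\<^sup>+u. \<integral>\<^sup>+y. \<integral>\<^sup>+f. indicator {y. u > a \<and> u * cos \<theta> + y * sin \<theta> > a} y
      * indicator ({f. (\<Sum>k\<in>A. (f k)\<^sup>2) \<le> K - u\<^sup>2 - y\<^sup>2} \<inter> space (Pi\<^sub>M A (\<lambda>_. lborel))) f
      \<partial>Pi\<^sub>M A (\<lambda>_. lborel) \<partial>lborel \<partial>lborel)"
  proof (intro nn_integral_cong)
    fix u y :: real and f :: "'a \<Rightarrow> real"
    assume f: "f \<in> space (Pi\<^sub>M A (\<lambda>_. lborel))"
    define z where "z = (\<Sum>k\<in>Basis. (f(c := y, b := u)) k *\<^sub>R k)"
    have zk: "z \<bullet> k = (f(c := y, b := u)) k" if "k \<in> Basis" for k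
      unfolding z_def by (rule inner_sum_left_Basis[OF that])
    have "z \<bullet> z = (\<Sum>k\<in>Basis. (z \<bullet> k)\<^sup>2)"
      by (subst euclidean_inner) (simp add: power2_eq_square)
    also have "\<dots> = (\<Sum>k\<in>insert b (insert c A). ((f(c := y, b := u)) k)\<^sup>2)"
      unfolding A(4)[symmetric] by (intro sum.cong) (auto simp: zk)
    also have "\<dots> = u\<^sup>2 + (y\<^sup>2 + (\<Sum>k\<in>A. ((f(c := y, b := u)) k)\<^sup>2))"
      using A(1-3) bc(3) by simp
    also have "(\<Sum>k\<in>A. ((f(c := y, b := u)) k)\<^sup>2) = (\<Sum>k\<in>A. (f k)\<^sup>2)"
      using A(2,3) by (intro sum.cong) auto
    finally have zz: "z \<bullet> z = u\<^sup>2 + (y\<^sup>2 + (\<Sum>k\<in>A. (f k)\<^sup>2))" .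
    have "z \<bullet> b = u" "z \<bullet> c = y" using zk bc by auto
    then have "z \<bullet> (cos \<theta> *\<^sub>R b + sin \<theta> *\<^sub>R c) = u * cos \<theta> + y * sin \<theta>"
      by (simp add: inner_add_right)
    then have "z \<in> W \<longleftrightarrow> (u > a \<and> u * cos \<theta> + y * sin \<theta> > a) \<and> (\<Sum>k\<in>A. (f k)\<^sup>2) \<le> K - u\<^sup>2 - y\<^sup>2"
      unfolding W_def using zz \<open>z \<bullet> b = u\<close> by auto
    then show "indicator W (\<Sum>k\<in>Basis. (f(c := y, b := u)) k *\<^sub>R k)
       = indicator {y. u > a \<and> u * cos \<theta> + y * sin \<theta> > a} y
         * (indicator ({f. (\<Sum>k\<in>A. (f k)\<^sup>2) \<le> K - u\<^sup>2 - y\<^sup>2} \<inter> space (Pi\<^sub>M A (\<lambda>_. lborel))) f :: ennreal)"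
      unfolding z_def[symmetric] using f by (simp only: indicator_def split: if_splits) auto
  qed
  also have "\<dots> = (\<integral>\<^sup>+u. \<integral>\<^sup>+y. indicator {y. u > a \<and> u * cos \<theta> + y * sin \<theta> > a} y
      * ennreal (unit_ball_vol (real (2 * n)) * max 0 (K - u\<^sup>2 - y\<^sup>2) ^ n) \<partial>lborel \<partial>lborel)"
    using A(1) by (intro nn_integral_cong)
      (simp add: nn_integral_cmult emeasure_PiM_ball[OF A(1) A(5) n, simplified])
  also have "\<dots> = (\<integral>\<^sup>+u. ennreal (unit_ball_vol (real (2 * n))) * (\<integral>\<^sup>+y. ennreal (max 0 (K - u\<^sup>2 - y\<^sup>2) ^ n)
             * indicator {y. u > a \<and> u * cos \<theta> + y * sin \<theta> > a} y \<partial>lborel) \<partial>lborel)"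
    by (intro nn_integral_cong, subst nn_integral_cmult[symmetric])
       (auto simp: ennreal_mult' mult_ac)
  also have "\<dots> = ennreal (unit_ball_vol (real (2 * n))) * (\<integral>\<^sup>+u. (\<integral>\<^sup>+y. ennreal (max 0 (K - u\<^sup>2 - y\<^sup>2) ^ n)
             * indicator {y. u > a \<and> u * cos \<theta> + y * sin \<theta> > a} y \<partial>lborel) \<partial>lborel)"
  proof (rule nn_integral_cmult)
    \<comment> \<open>Writing the condition as membership of the pair \<open>(u, y)\<close> in a
      Borel set exhibits the joint measurability needed for the inner integral.\<close>
    have "(\<lambda>u. \<integral>\<^sup>+y. ennreal (max 0 (K - u\<^sup>2 - y\<^sup>2) ^ n)
             * indicator {p. fst p > a \<and> fst p * cos \<theta> + snd p * sin \<theta> > a} (u, y) \<partial>lborel) \<in> borel_measurable lborel"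
      by measurable
    then show "(\<lambda>u. \<integral>\<^sup>+y. ennreal (max 0 (K - u\<^sup>2 - y\<^sup>2) ^ n)
             * indicator {y. u > a \<and> u * cos \<theta> + y * sin \<theta> > a} y \<partial>lborel) \<in> borel_measurable lborel"
      by (simp add: indicator_def)
  qed
  also note planar_wedge_integral[OF a th n, of K]
  finally show ?thesis unfolding W_def .
qed

section \<open>Moving two unit vectors into a coordinate plane\<close>

text \<open>For \<open>v = 0\<close> the convention on division by zero yields the identity, so that
  \<open>reflection (p - q)\<close> takes \<open>p\<close> to \<open>q\<close> even when
  \<open>p = q\<close>.\<close>

definition reflection :: "'a::real_inner \<Rightarrow> 'a \<Rightarrow> 'a" where
  "reflection v z = z - (2 * (v \<bullet> z) / (v \<bullet> v)) *\<^sub>R v"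

lemma orthogonal_transformation_reflection: "orthogonal_transformation (reflection v)"
proof (cases "v = 0")
  case True
  then have "reflection v = (\<lambda>z. z)" by (simp add: reflection_def fun_eq_iff)
  then show ?thesis by (simp add: orthogonal_transformation_id)
next
  case False
  have lin: "linear (reflection v)"
    by (rule linearI)
       (simp_all add: reflection_def inner_add_right algebra_simps add_divide_distrib)
  have "reflection v y \<bullet> reflection v z = y \<bullet> z" for y z
    using False by (simp add: reflection_def inner_diff_left inner_diff_right inner_commute field_simps)
  then show ?thesis using lin by (simp add: orthogonal_transformation_def)
qed

lemma reflection_diff:
  assumes "norm p = norm q"
  shows "reflection (p - q) p = q"
proof (cases "p = q")
  case False
  then have nz: "(p - q) \<bullet> (p - q) \<noteq> 0" by simp
  have "p \<bullet> p = q \<bullet> q" using assms by (simp add: norm_eq)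
  then have "2 * ((p - q) \<bullet> p) = (p - q) \<bullet> (p - q)"
    by (simp add: inner_diff_left inner_diff_right inner_commute)
  then show ?thesis using nz by (simp add: reflection_def)
qed (simp add: reflection_def)

text \<open>Two reflections suffice. The first takes \<open>x\<close> to \<open>b\<close>. The
  second is along a vector orthogonal to \<open>b\<close>, hence keeps \<open>b\<close>; it takes
  the component \<open>r\<close> of the image of \<open>y\<close> orthogonal to \<open>b\<close> to
  \<open>sin \<theta> *\<^sub>R c\<close>, both having length \<open>sin \<theta>\<close>.\<close>

lemma orthogonal_transformation_to_axes:
  fixes x y b c :: "'a::euclidean_space"
  assumes "norm x = 1" "norm y = 1" and bc: "b \<in> Basis" "c \<in> Basis" "b \<noteq> c"
  defines "\<theta> \<equiv> arccos (x \<bullet> y)"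
  obtains T where "orthogonal_transformation T" "T x = b" "T y = cos \<theta> *\<^sub>R b + sin \<theta> *\<^sub>R c"
proof -
  define T1 where "T1 = reflection (x - b)"
  have T1: "orthogonal_transformation T1" "T1 x = b"
    using assms by (auto simp: T1_def orthogonal_transformation_reflection intro: reflection_diff)
  have xy: "\<bar>x \<bullet> y\<bar> \<le> 1" using Cauchy_Schwarz_ineq2[of x y] assms by simp
  then have c1: "cos \<theta> = x \<bullet> y" by (auto simp: \<theta>_def)
  have s1: "sin \<theta> \<ge> 0"
    unfolding \<theta>_def using xy by (intro sin_ge_zero arccos_lbound arccos_ubound) auto
  define r where "r = T1 y - cos \<theta> *\<^sub>R b"
  have bb: "b \<bullet> b = 1" "c \<bullet> c = 1" "b \<bullet> c = 0" "c \<bullet> b = 0" using bc by (auto simp: inner_Basis)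
  have "T1 y \<bullet> b = cos \<theta>"
    using T1 by (metis c1 inner_commute orthogonal_transformation_def)
  moreover have "T1 y \<bullet> T1 y = 1"
    using T1(1) assms(2) by (metis orthogonal_transformation_def norm_eq_1)
  ultimately have rb: "r \<bullet> b = 0" and rr: "r \<bullet> r = 1 - (cos \<theta>)\<^sup>2"
    by (simp_all add: r_def inner_diff_left inner_diff_right bb inner_commute power2_eq_square)
  have "r \<bullet> r = (sin \<theta>)\<^sup>2" using rr by (simp add: sin_squared_eq)
  then have nr: "norm r = norm (sin \<theta> *\<^sub>R c)"
    using bb s1 by (simp add: norm_eq_sqrt_inner)
  define T2 where "T2 = reflection (r - sin \<theta> *\<^sub>R c)"
  have T2: "orthogonal_transformation T2" "T2 r = sin \<theta> *\<^sub>R c"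
    using nr by (auto simp: T2_def orthogonal_transformation_reflection intro: reflection_diff)
  have "T2 b = b"
    using rb bb by (simp add: T2_def reflection_def inner_diff_left)
  moreover have "T1 y = cos \<theta> *\<^sub>R b + r" by (simp add: r_def)
  ultimately have "T2 (T1 y) = cos \<theta> *\<^sub>R b + sin \<theta> *\<^sub>R c"
    using T2 by (simp add: orthogonal_transformation_linear linear_add linear_scale)
  then show thesis
    using that[of "T2 \<circ> T1"] T1 T2 \<open>T2 b = b\<close> by (simp add: orthogonal_transformation_compose)
qed

lemma integrable_wedge_profile:
  fixes b K \<theta> \<eta> :: real
  assumes "b \<ge> 0"
  shows "integrable lborel (\<lambda>s. indicator {\<theta><..<\<eta>} s * max 0 (K - b / (1 + cos s)) ^ m)"
proof -
  have "norm (max 0 (K - b / (1 + cos s)) ^ m) \<le> max 0 K ^ m" for s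
  proof -
    have "1 + cos s \<ge> 0" using cos_ge_minus_one[of s] by linarith
    then have "b / (1 + cos s) \<ge> 0" using assms by simp
    then show ?thesis by (auto intro!: power_mono)
  qed
  moreover have "emeasure lborel {\<theta><..<\<eta>} < \<infinity>" by (cases "\<theta> \<le> \<eta>") auto
  ultimately have "integrable lborel (\<lambda>s. indicator {\<theta><..<\<eta>} s *\<^sub>R max 0 (K - b / (1 + cos s)) ^ m)"
    by (intro integrableI_bounded_set_indicator[where B = "max 0 K ^ m"]) auto
  then show ?thesis by simp
qed

lemma measure_ball_wedge:
  fixes x y :: "real^'k::{finite,wellorder}" and a K :: real and n :: nat
  assumes xy: "norm x = 1" "norm y = 1" and dim: "CARD('k) = 2 * n + 2"
    and n: "n \<ge> 1" and a: "a > 0"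
  shows "measure lborel {z. z \<bullet> z \<le> K \<and> z \<bullet> x > a \<and> z \<bullet> y > a}
       = unit_ball_vol (real (2 * n)) / (2 * real (Suc n)) *
          (LINT s|lborel. indicator {arccos (x \<bullet> y)<..<pi} s * max 0 (K - 2 * a\<^sup>2 / (1 + cos s)) ^ Suc n)"
proof -
  define \<theta> where "\<theta> = arccos (x \<bullet> y)"
  have ip: "\<bar>x \<bullet> y\<bar> \<le> 1" using Cauchy_Schwarz_ineq2[of x y] xy by simp
  then have th: "0 \<le> \<theta>" "\<theta> \<le> pi" by (auto simp: \<theta>_def intro: arccos_lbound arccos_ubound)
  have "DIM(real^'k::_) = 2 * n + 2" using dim by simp
  then have "\<not> card (Basis :: (real^'k::_) set) \<le> Suc 0" by simp
  then obtain b c :: "real^'k::_" where bc: "b \<in> Basis" "c \<in> Basis" "b \<noteq> c"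
    using card_le_Suc0_iff_eq[OF finite_Basis] by blast
  define W where "W = (\<lambda>x y::real^'k::_. {z. z \<bullet> z \<le> K \<and> z \<bullet> x > a \<and> z \<bullet> y > a})"
  have Wb [measurable]: "W x y \<in> sets borel" for x y unfolding W_def by measurable
  have "bounded (W x y)" for x y
  proof (rule bounded_subset[OF bounded_cball])
    show "W x y \<subseteq> cball 0 (sqrt K)"
      by (auto simp: W_def norm_eq_sqrt_inner)
  qed
  then have Wm: "W x y \<in> lmeasurable" for x y
    using Wb by (intro bounded_set_imp_lmeasurable) auto
  \<comment> \<open>Invariance under orthogonal maps is applied to the completed measure; on the
    Borel sets \<open>W x y\<close> the two measures agree.\<close>
  have leb: "measure lebesgue (W x y) = measure lborel (W x y)" for x y
    using Wb by (simp add: measure_completion)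
  show ?thesis
  proof (cases "\<theta> = pi")
    case True
    \<comment> \<open>The computation along the axes requires \<open>\<theta> < pi\<close>. For
      antipodal points the wedge is empty because \<open>a > 0\<close>, and the interval of
      integration is empty too.\<close>
    have "x \<bullet> y = -1" using cos_arccos_abs[OF ip] True by (simp add: \<theta>_def)
    then have "(x + y) \<bullet> (x + y) = 0"
      using xy by (simp add: inner_add_left inner_add_right inner_commute norm_eq_1)
    then have "y = - x" by (simp add: add_eq_0_iff)
    then have e: "{z. z \<bullet> z \<le> K \<and> z \<bullet> x > a \<and> z \<bullet> y > a} = {}" using a by auto
    show ?thesis unfolding \<theta>_def[symmetric] True e by simp
  next
    case False
    obtain T where T: "orthogonal_transformation T" "T x = b" "T y = cos \<theta> *\<^sub>R b + sin \<theta> *\<^sub>R c"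
      using orthogonal_transformation_to_axes[OF xy bc] unfolding \<theta>_def by blast
    have "surj T" using T(1) by (rule orthogonal_transformation_surj)
    then have "T ` W x y = W (T x) (T y)"
      unfolding W_def using T(1)
      by (auto simp: orthogonal_transformation_def image_iff) (metis surjD)
    then have "measure lborel (W x y) = measure lborel (W (T x) (T y))"
      using measure_orthogonal_image[OF T(1) Wm, of x y] by (simp add: leb)
    also have "\<dots> = enn2real (emeasure lborel (W (T x) (T y)))" by (simp add: measure_def)
    also have "emeasure lborel (W (T x) (T y)) = ennreal (unit_ball_vol (real (2 * n))) *
          (\<integral>\<^sup>+s. ennreal (max 0 (K - 2 * a\<^sup>2 / (1 + cos s)) ^ Suc n / (2 * real (Suc n)))
             * indicator {\<theta><..<pi} s \<partial>lborel)"
      unfolding W_def T using emeasure_ball_wedge_axes[OF bc, of n a \<theta> K] dim n a th False by simp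
    also have "(\<integral>\<^sup>+s. ennreal (max 0 (K - 2 * a\<^sup>2 / (1 + cos s)) ^ Suc n / (2 * real (Suc n)))
             * indicator {\<theta><..<pi} s \<partial>lborel)
       = (\<integral>\<^sup>+s. ennreal (1 / (2 * real (Suc n)) * (indicator {\<theta><..<pi} s * max 0 (K - 2 * a\<^sup>2 / (1 + cos s)) ^ Suc n)) \<partial>lborel)"
      by (intro nn_integral_cong) (auto simp: indicator_def)
    also have "\<dots> = ennreal (LINT s|lborel. 1 / (2 * real (Suc n)) * (indicator {\<theta><..<pi} s * max 0 (K - 2 * a\<^sup>2 / (1 + cos s)) ^ Suc n))"
    proof (rule nn_integral_eq_integral)
      show "integrable lborel (\<lambda>s. 1 / (2 * real (Suc n)) * (indicator {\<theta><..<pi} s * max 0 (K - 2 * a\<^sup>2 / (1 + cos s)) ^ Suc n))"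
        by (intro integrable_mult_right integrable_wedge_profile) simp
    qed (auto simp: indicator_def)
    finally show ?thesis
      by (simp add: W_def \<theta>_def enn2real_mult)
  qed
qed

section \<open>Positivity of the cap kernel\<close>

text \<open>The double sum is the integral over \<open>S\<close> of the square of
  \<open>\<Sum>i\<in>I. c i * indicator (H i) z\<close>.\<close>

lemma quadratic_form_measure_nonneg:
  fixes c :: "'i \<Rightarrow> real"
  assumes "finite I" and S [measurable]: "S \<in> sets M" "emeasure M S < \<infinity>"
    and H [measurable]: "\<And>i. i \<in> I \<Longrightarrow> H i \<in> sets M"
  shows "0 \<le> (\<Sum>i\<in>I. \<Sum>j\<in>I. c i * c j * measure M (S \<inter> (H i \<inter> H j)))"
proof -
  have int: "integrable M (\<lambda>z. c i * c j * indicator (S \<inter> (H i \<inter> H j)) z)" if "i \<in> I" "j \<in> I" for i j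
  proof -
    have "emeasure M (S \<inter> (H i \<inter> H j)) \<le> emeasure M S"
      using that S by (intro emeasure_mono) auto
    then have "emeasure M (S \<inter> (H i \<inter> H j)) < \<infinity>" using S(2) by (rule le_less_trans)
    then show ?thesis using that S H by (intro integrable_mult_right) auto
  qed
  have "(\<Sum>i\<in>I. \<Sum>j\<in>I. c i * c j * measure M (S \<inter> (H i \<inter> H j)))
      = (\<Sum>i\<in>I. \<Sum>j\<in>I. \<integral>z. c i * c j * indicator (S \<inter> (H i \<inter> H j)) z \<partial>M)"
    using S H by (intro sum.cong refl) (simp add: Int_absorb2 sets.sets_into_space)
  also have "\<dots> = (\<integral>z. (\<Sum>i\<in>I. \<Sum>j\<in>I. c i * c j * indicator (S \<inter> (H i \<inter> H j)) z) \<partial>M)"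
    using int by (simp add: Bochner_Integration.integral_sum)
  also have "\<dots> = (\<integral>z. indicator S z * (\<Sum>i\<in>I. c i * indicator (H i) z)\<^sup>2 \<partial>M)"
    by (intro Bochner_Integration.integral_cong refl)
       (simp add: power2_eq_square sum_product sum_distrib_left indicator_inter_arith mult_ac)
  also have "\<dots> \<ge> 0" by (intro integral_nonneg_AE AE_I2) simp
  finally show ?thesis .
qed

text \<open>
  Up to a factor, \<open>cap_kernel n u (\<theta>(x, y))\<close> is the surface measure of the intersection of the spherical
  caps \<open>{z. z \<bullet> x > a}\<close> and \<open>{z. z \<bullet> y > a}\<close> in dimension \<open>2 n + 1\<close>, where \<open>u = 2 a\<^sup>2 - 1\<close>.
\<close>
definition cap_kernel :: "nat \<Rightarrow> real \<Rightarrow> real \<Rightarrow> real" where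
  "cap_kernel n u t = (LINT s|lborel. indicator {t<..<pi} s * max 0 ((cos s - u) / (1 + cos s)) ^ n)"

lemma one_plus_cos_pos:
  assumes "0 < s" "s < pi" shows "1 + cos s > 0"
  using cos_monotone_0_pi[of s pi] assms by simp

text \<open>
  Balls of radius \<open>sqrt K\<close> produce the exponent \<open>n + 1\<close>; thin shells, that is, differentiation in \<open>K\<close>,
  produce the exponent \<open>n\<close>, which the dimension \<open>2 n + 1\<close> of the sphere requires.
\<close>
lemma wedge_profile_difference_quotient:
  fixes u t :: real and n :: nat
  assumes u: "u \<ge> -1" and t: "t \<ge> 0" and n: "n \<ge> 1"
  defines "L \<equiv> \<lambda>K. LINT s|lborel. indicator {t<..<pi} s * max 0 (K - (1 + u) / (1 + cos s)) ^ Suc n"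
  shows "(\<lambda>k. real (Suc k) * (L (1 + 1 / real (Suc k)) - L 1)) \<longlonglongrightarrow> real (Suc n) * cap_kernel n u t"
proof -
  define p where "p = (\<lambda>s K. max 0 (K - (1 + u) / (1 + cos s)) ^ Suc n)"
  define q where "q = (\<lambda>s K. max 0 (K - (1 + u) / (1 + cos s)) ^ n)"
  have dp: "DERIV (p s) K :> real (Suc n) * q s K" for s K
  proof -
    have "DERIV (\<lambda>K. K - (1 + u) / (1 + cos s)) K :> 1" by (auto intro!: derivative_eq_intros)
    from DERIV_max_power_Suc[OF this n] show ?thesis by (simp add: p_def q_def)
  qed
  have int: "integrable lborel (\<lambda>s. indicator {t<..<pi} s * p s K)" for K
    unfolding p_def using u by (intro integrable_wedge_profile) simp
  have "(\<lambda>k. LINT s|lborel. indicator {t<..<pi} s * (real (Suc k) * (p s (1 + 1 / real (Suc k)) - p s 1)))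
      \<longlonglongrightarrow> (LINT s|lborel. indicator {t<..<pi} s * (real (Suc n) * q s 1))"
  \<comment> \<open>By the mean value theorem the difference quotient equals
    \<open>(n + 1) * q s z\<close> for some \<open>z\<close> between 1 and 2, and
    \<open>0 \<le> q s z \<le> 2 ^ n\<close>; this gives the dominating constant.\<close>
  proof (rule integral_dominated_convergence[where w = "\<lambda>s. indicator {t<..<pi} s * (real (Suc n) * 2 ^ n)"])
    have "emeasure lborel {t<..<pi} < \<infinity>" by (cases "t \<le> pi") auto
    then have "integrable lborel (\<lambda>s. indicator {t<..<pi} s :: real)" by simp
    then show "integrable lborel (\<lambda>s. indicator {t<..<pi} s * (real (Suc n) * 2 ^ n))"
      by (intro integrable_mult_left)
    show "AE s in lborel. (\<lambda>k. indicator {t<..<pi} s * (real (Suc k) * (p s (1 + 1 / real (Suc k)) - p s 1)))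
        \<longlonglongrightarrow> indicator {t<..<pi} s * (real (Suc n) * q s 1)"
    proof (intro AE_I2 tendsto_mult_left)
      fix s
      have "((\<lambda>h. (p s (1 + h) - p s 1) / h) \<longlongrightarrow> real (Suc n) * q s 1) (at 0)"
        using dp[of s 1] by (simp add: DERIV_def)
      moreover have "filterlim (\<lambda>k. 1 / real (Suc k)) (at 0) sequentially"
        using LIMSEQ_inverse_real_of_nat by (auto simp: filterlim_at inverse_eq_divide)
      ultimately have "(\<lambda>k. (p s (1 + 1 / real (Suc k)) - p s 1) / (1 / real (Suc k))) \<longlonglongrightarrow> real (Suc n) * q s 1"
        by (rule filterlim_compose)
      then show "(\<lambda>k. real (Suc k) * (p s (1 + 1 / real (Suc k)) - p s 1)) \<longlonglongrightarrow> real (Suc n) * q s 1"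
        by (simp add: mult.commute del: of_nat_Suc)
    qed
    fix k
    show "AE s in lborel. norm (indicator {t<..<pi} s * (real (Suc k) * (p s (1 + 1 / real (Suc k)) - p s 1)))
        \<le> indicator {t<..<pi} s * (real (Suc n) * 2 ^ n)"
    proof (rule AE_I2)
      fix s
      define h where "h = 1 / real (Suc k)"
      have h: "h > 0" "h \<le> 1" by (simp_all add: h_def)
      obtain z where z: "1 < z" "z < 1 + h" "p s (1 + h) - p s 1 = h * (real (Suc n) * q s z)"
        using MVT2[of 1 "1 + h" "p s" "\<lambda>K. real (Suc n) * q s K"] dp h by auto
      have "1 + cos s \<ge> 0" using cos_ge_minus_one[of s] by linarith
      then have "(1 + u) / (1 + cos s) \<ge> 0" using u by simp
      then have "\<bar>q s z\<bar> \<le> 2 ^ n" unfolding q_def using z h by (auto intro!: power_mono)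
      moreover have "real (Suc k) * (p s (1 + h) - p s 1) = real (Suc n) * q s z"
        using z(3) by (simp add: h_def del: of_nat_Suc)
      ultimately have "\<bar>real (Suc k) * (p s (1 + h) - p s 1)\<bar> \<le> real (Suc n) * 2 ^ n"
        by (simp add: abs_mult mult_left_mono del: of_nat_Suc)
      then show "norm (indicator {t<..<pi} s * (real (Suc k) * (p s (1 + 1 / real (Suc k)) - p s 1)))
        \<le> indicator {t<..<pi} s * (real (Suc n) * 2 ^ n)"
        by (auto simp: h_def indicator_def)
    qed
  qed (simp_all add: p_def q_def)
  moreover have "(LINT s|lborel. indicator {t<..<pi} s * (real (Suc k) * (p s (1 + 1 / real (Suc k)) - p s 1)))
      = real (Suc k) * (L (1 + 1 / real (Suc k)) - L 1)" for k
  proof -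
    have "(LINT s|lborel. indicator {t<..<pi} s * (real (Suc k) * (p s (1 + 1 / real (Suc k)) - p s 1)))
       = (LINT s|lborel. real (Suc k) * (indicator {t<..<pi} s * p s (1 + 1 / real (Suc k)) - indicator {t<..<pi} s * p s 1))"
      by (intro Bochner_Integration.integral_cong refl) (simp add: algebra_simps)
    also have "\<dots> = real (Suc k) * ((LINT s|lborel. indicator {t<..<pi} s * p s (1 + 1 / real (Suc k))) - (LINT s|lborel. indicator {t<..<pi} s * p s 1))"
      using int by (simp add: Bochner_Integration.integral_diff del: of_nat_Suc)
    finally show ?thesis by (simp add: L_def p_def)
  qed
  moreover have "(LINT s|lborel. indicator {t<..<pi} s * (real (Suc n) * q s 1)) = real (Suc n) * cap_kernel n u t"
  proof -
    have "(LINT s|lborel. indicator {t<..<pi} s * (real (Suc n) * q s 1))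
        = (LINT s|lborel. real (Suc n) * (indicator {t<..<pi} s * max 0 ((cos s - u) / (1 + cos s)) ^ n))"
    proof (intro Bochner_Integration.integral_cong refl)
      fix s
      show "indicator {t<..<pi} s * (real (Suc n) * q s 1) = real (Suc n) * (indicator {t<..<pi} s * max 0 ((cos s - u) / (1 + cos s)) ^ n)"
      proof (cases "s \<in> {t<..<pi}")
        case True
        then have "1 + cos s > 0" using t by (intro one_plus_cos_pos) auto
        then have "1 - (1 + u) / (1 + cos s) = (cos s - u) / (1 + cos s)" by (simp add: field_simps)
        then show ?thesis by (simp add: q_def)
      qed simp
    qed
    then show ?thesis by (simp add: cap_kernel_def)
  qed
  ultimately show ?thesis by simp
qed

text \<open>The shell \<open>1 < z \<bullet> z \<le> K\<close> cut by half-spaces gives a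
  nonnegative quadratic form. Dividing by the thickness \<open>K - 1 = 1 / (k + 1)\<close> and
  letting it shrink leaves the cap kernel. The condition \<open>u > -1\<close> ensures
  \<open>a > 0\<close> in \<open>2 a^2 = 1 + u\<close>.\<close>

lemma cap_kernel_quadratic_form_nonneg:
  fixes x :: "'i \<Rightarrow> real^'k::{finite,wellorder}" and c :: "'i \<Rightarrow> real"
  assumes I: "finite I" and x: "\<And>i. i \<in> I \<Longrightarrow> norm (x i) = 1"
    and dim: "CARD('k) = 2 * n + 2" and n: "n \<ge> 1" and u: "u > -1"
  shows "0 \<le> (\<Sum>i\<in>I. \<Sum>j\<in>I. c i * c j * cap_kernel n u (arccos (x i \<bullet> x j)))"
proof -
  define a where "a = sqrt ((1 + u) / 2)"
  have a: "a > 0" "2 * a\<^sup>2 = 1 + u" using u by (simp_all add: a_def)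
  define L where "L = (\<lambda>t K. LINT s|lborel. indicator {t<..<pi} s * max 0 (K - (1 + u) / (1 + cos s)) ^ Suc n)"
  define \<omega> where "\<omega> = unit_ball_vol (real (2 * n)) / (2 * real (Suc n))"
  have "\<omega> > 0" by (auto simp: \<omega>_def intro!: divide_pos_pos unit_ball_vol_pos)
  have shell: "0 \<le> (\<Sum>i\<in>I. \<Sum>j\<in>I. c i * c j * (L (arccos (x i \<bullet> x j)) K - L (arccos (x i \<bullet> x j)) 1))"
    if "K \<ge> 1" for K
  proof -
    define S :: "(real^'k::_) set" where "S = {z. 1 < z \<bullet> z \<and> z \<bullet> z \<le> K}"
    define H where "H = (\<lambda>i. {z. z \<bullet> x i > a})"
    define B where "B = (\<lambda>K i j. {z. z \<bullet> z \<le> K \<and> z \<bullet> x i > a \<and> z \<bullet> x j > a})"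
    have [measurable]: "S \<in> sets borel" "H i \<in> sets borel" "B K i j \<in> sets borel" for i j K
      unfolding S_def H_def B_def by measurable
    have bnd: "emeasure lborel {z::real^'k::_. z \<bullet> z \<le> K} < \<infinity>" for K
    proof (rule emeasure_bounded_finite)
      show "bounded {z::real^'k::_. z \<bullet> z \<le> K}"
        by (rule bounded_subset[OF bounded_cball[of 0 "sqrt K"]]) (auto simp: norm_eq_sqrt_inner)
    qed
    have "measure lborel (S \<inter> (H i \<inter> H j)) = \<omega> * (L (arccos (x i \<bullet> x j)) K - L (arccos (x i \<bullet> x j)) 1)"
      if "i \<in> I" "j \<in> I" for i j
    proof -
      have "S \<inter> (H i \<inter> H j) = B K i j - B 1 i j"
        by (auto simp: S_def H_def B_def)
      moreover have "B 1 i j \<subseteq> B K i j" using \<open>K \<ge> 1\<close> by (auto simp: B_def)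
      moreover have "emeasure lborel (B K i j) \<noteq> \<infinity>"
      proof -
        have "emeasure lborel (B K i j) \<le> emeasure lborel {z::real^'k::_. z \<bullet> z \<le> K}"
          by (intro emeasure_mono) (auto simp: B_def)
        then show ?thesis using bnd[of K] by (auto simp: top_unique)
      qed
      ultimately have "measure lborel (S \<inter> (H i \<inter> H j)) = measure lborel (B K i j) - measure lborel (B 1 i j)"
        by (simp add: measure_Diff)
      moreover have "measure lborel (B K i j) = \<omega> * L (arccos (x i \<bullet> x j)) K" for K
        unfolding B_def \<omega>_def L_def a(2)[symmetric]
        using measure_ball_wedge[OF x x dim n a(1), OF that, of K] .
      ultimately show ?thesis by (simp add: algebra_simps)
    qed
    moreover have "0 \<le> (\<Sum>i\<in>I. \<Sum>j\<in>I. c i * c j * measure lborel (S \<inter> (H i \<inter> H j)))"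
    proof (rule quadratic_form_measure_nonneg[OF I])
      have "emeasure lborel S \<le> emeasure lborel {z::real^'k::_. z \<bullet> z \<le> K}"
        by (intro emeasure_mono) (auto simp: S_def)
      then show "emeasure lborel S < \<infinity>" using bnd[of K] by (rule le_less_trans)
    qed auto
    ultimately have "0 \<le> (\<Sum>i\<in>I. \<Sum>j\<in>I. c i * c j * (\<omega> * (L (arccos (x i \<bullet> x j)) K - L (arccos (x i \<bullet> x j)) 1)))"
      by simp
    also have "\<dots> = \<omega> * (\<Sum>i\<in>I. \<Sum>j\<in>I. c i * c j * (L (arccos (x i \<bullet> x j)) K - L (arccos (x i \<bullet> x j)) 1))"
      by (simp add: sum_distrib_left mult_ac)
    finally show ?thesis using \<open>\<omega> > 0\<close> by (simp add: zero_le_mult_iff)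
  qed
  have "(\<lambda>k. \<Sum>i\<in>I. \<Sum>j\<in>I. c i * c j * (real (Suc k) * (L (arccos (x i \<bullet> x j)) (1 + 1 / real (Suc k)) - L (arccos (x i \<bullet> x j)) 1)))
      \<longlonglongrightarrow> (\<Sum>i\<in>I. \<Sum>j\<in>I. c i * c j * (real (Suc n) * cap_kernel n u (arccos (x i \<bullet> x j))))"
  proof (intro tendsto_sum tendsto_mult_left)
    fix i j assume ij: "i \<in> I" "j \<in> I"
    have "\<bar>x i \<bullet> x j\<bar> \<le> 1" using Cauchy_Schwarz_ineq2[of "x i" "x j"] x ij by simp
    then have "arccos (x i \<bullet> x j) \<ge> 0" by (intro arccos_lbound) auto
    then show "(\<lambda>k. real (Suc k) * (L (arccos (x i \<bullet> x j)) (1 + 1 / real (Suc k)) - L (arccos (x i \<bullet> x j)) 1))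
      \<longlonglongrightarrow> real (Suc n) * cap_kernel n u (arccos (x i \<bullet> x j))"
      unfolding L_def using u n by (intro wedge_profile_difference_quotient) auto
  qed
  moreover have "0 \<le> (\<Sum>i\<in>I. \<Sum>j\<in>I. c i * c j * (real (Suc k) * (L (arccos (x i \<bullet> x j)) (1 + 1 / real (Suc k)) - L (arccos (x i \<bullet> x j)) 1)))" for k
  proof -
    have "(\<Sum>i\<in>I. \<Sum>j\<in>I. c i * c j * (real (Suc k) * (L (arccos (x i \<bullet> x j)) (1 + 1 / real (Suc k)) - L (arccos (x i \<bullet> x j)) 1)))
       = real (Suc k) * (\<Sum>i\<in>I. \<Sum>j\<in>I. c i * c j * (L (arccos (x i \<bullet> x j)) (1 + 1 / real (Suc k)) - L (arccos (x i \<bullet> x j)) 1))"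
      by (simp add: sum_distrib_left mult_ac del: of_nat_Suc)
    then show ?thesis using shell[of "1 + 1 / real (Suc k)"] by simp
  qed
  ultimately have "0 \<le> (\<Sum>i\<in>I. \<Sum>j\<in>I. c i * c j * (real (Suc n) * cap_kernel n u (arccos (x i \<bullet> x j))))"
    by (intro LIMSEQ_le_const) auto
  also have "\<dots> = real (Suc n) * (\<Sum>i\<in>I. \<Sum>j\<in>I. c i * c j * cap_kernel n u (arccos (x i \<bullet> x j)))"
    by (simp add: sum_distrib_left mult_ac del: of_nat_Suc)
  finally show ?thesis by (simp add: zero_le_mult_iff del: of_nat_Suc)
qed

section \<open>Truncated powers as mixtures of cap kernels\<close>

text \<open>With \<open>x\<close> fixed and the expansion point \<open>u\<close> moving, the
  derivative of the Taylor polynomial in \<open>u\<close> telescopes to the remainder integrand. At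
  \<open>x\<^sub>0\<close> only limits from the right are assumed, and none for
  \<open>G (Suc n)\<close>, which may be unbounded near \<open>x\<^sub>0\<close>.\<close>

lemma taylor_nn_integral:
  fixes G :: "nat \<Rightarrow> real \<Rightarrow> real" and x\<^sub>0 x :: real
  assumes x: "x\<^sub>0 < x" "x < 1"
    and deriv: "\<And>k u. k \<le> n \<Longrightarrow> x\<^sub>0 < u \<Longrightarrow> u < 1 \<Longrightarrow> DERIV (G k) u :> G (Suc k) u"
    and cont: "\<And>u. x\<^sub>0 < u \<Longrightarrow> u < 1 \<Longrightarrow> isCont (G (Suc n)) u"
    and nonneg: "\<And>u. x\<^sub>0 < u \<Longrightarrow> u < 1 \<Longrightarrow> 0 \<le> G (Suc n) u"
    and lim0: "\<And>k. k < n \<Longrightarrow> (G k \<longlongrightarrow> 0) (at_right x\<^sub>0)"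
    and limn: "(G n \<longlongrightarrow> fact n * J) (at_right x\<^sub>0)" and J: "J \<ge> 0"
  shows "ennreal (G 0 x) = ennreal (J * (x - x\<^sub>0) ^ n)
      + (\<integral>\<^sup>+u. ennreal (G (Suc n) u / fact n * (x - u) ^ n) * indicator {x\<^sub>0<..<x} u \<partial>lborel)"
proof -
  define T where "T = (\<lambda>m u. \<Sum>k\<le>m. G k u * (x - u) ^ k / fact k)"
  have dT: "m \<le> n \<Longrightarrow> DERIV (T m) u :> G (Suc m) u * (x - u) ^ m / fact m" if "x\<^sub>0 < u" "u < 1" for m u
  proof (induction m)
    case 0
    have "T 0 = G 0" by (simp add: T_def fun_eq_iff)
    then show ?case using deriv[of 0 u] that x by simp
  next
    case (Suc m)
    have "DERIV (\<lambda>u. (x - u) ^ Suc m / fact (Suc m)) u :> - ((x - u) ^ m / fact m)"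
    proof -
      have "DERIV (\<lambda>u. x - u) u :> - 1" by (auto intro!: derivative_eq_intros)
      from DERIV_cdivide[OF DERIV_power_Suc[OF this, of m], of "fact (Suc m)"]
      have "DERIV (\<lambda>u. (x - u) ^ Suc m / fact (Suc m)) u
          :> (1 + real m) * (- 1 * (x - u) ^ m) / fact (Suc m)" .
      moreover have "(1 + real m) * (- 1 * (x - u) ^ m) / fact (Suc m) = - ((x - u) ^ m / fact m)"
      proof -
        have f: "fact (Suc m) = (1 + real m) * (fact m :: real)" by simp
        show ?thesis unfolding f by (subst mult_divide_mult_cancel_left) simp_all
      qed
      ultimately show ?thesis by simp
    qed
    from DERIV_mult[OF deriv[of "Suc m" u] this] Suc.prems that x
    have "DERIV (\<lambda>u. G (Suc m) u * ((x - u) ^ Suc m / fact (Suc m))) u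
        :> G (Suc (Suc m)) u * ((x - u) ^ Suc m / fact (Suc m)) + - ((x - u) ^ m / fact m) * G (Suc m) u"
      by simp
    from DERIV_add[OF Suc.IH this] Suc.prems
    have "DERIV (\<lambda>u. T m u + G (Suc m) u * ((x - u) ^ Suc m / fact (Suc m))) u
       :> G (Suc (Suc m)) u * ((x - u) ^ Suc m / fact (Suc m))"
      by (simp add: mult.commute)
    moreover have "T (Suc m) = (\<lambda>u. T m u + G (Suc m) u * ((x - u) ^ Suc m / fact (Suc m)))"
      by (simp add: T_def fun_eq_iff)
    ultimately show ?case by simp
  qed
  have Tx: "T n x = G 0 x"
    unfolding T_def by (subst sum.atMost_shift) simp
  have "(T n \<longlongrightarrow> (\<Sum>k\<le>n. (if k = n then fact n * J else 0) * (x - x\<^sub>0) ^ k / fact k)) (at_right x\<^sub>0)"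
    unfolding T_def using lim0 limn by (intro tendsto_sum tendsto_intros) auto
  also have "(\<Sum>k\<le>n. (if k = n then fact n * J else 0) * (x - x\<^sub>0) ^ k / fact k) = (\<Sum>k\<le>n. if k = n then J * (x - x\<^sub>0) ^ k else 0)"
    by (intro sum.cong) auto
  also have "\<dots> = J * (x - x\<^sub>0) ^ n" by simp
  finally have limT: "(T n \<longlongrightarrow> J * (x - x\<^sub>0) ^ n) (at_right x\<^sub>0)" .
  have "(\<integral>\<^sup>+u. ennreal (G (Suc n) u / fact n * (x - u) ^ n) * indicator (einterval x\<^sub>0 x) u \<partial>lborel)
      = ennreal (T n x - J * (x - x\<^sub>0) ^ n)"
  proof (rule nn_integral_FTC_einterval)
    show "ereal x\<^sub>0 < ereal x" using x by simp
    fix u assume u: "ereal x\<^sub>0 < ereal u" "ereal u < ereal x"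
    show "DERIV (T n) u :> G (Suc n) u / fact n * (x - u) ^ n"
      using dT[of u n] u x by simp
    show "isCont (\<lambda>u. G (Suc n) u / fact n * (x - u) ^ n) u"
      using cont[of u] u x by (intro continuous_intros) auto
    show "0 \<le> G (Suc n) u / fact n * (x - u) ^ n"
      using nonneg[of u] u x by simp
  next
    show "((T n \<circ> real_of_ereal) \<longlongrightarrow> J * (x - x\<^sub>0) ^ n) (at_right (ereal x\<^sub>0))"
      using limT by (simp add: ereal_tendsto_simps)
    have "isCont (G k) x" if "k \<le> n" for k
      using deriv[OF that, of x] x DERIV_isCont by blast
    then have "isCont (T n) x"
      unfolding T_def by (intro continuous_intros) auto
    then have "(T n \<longlongrightarrow> T n x) (at_left x)"
      using continuous_at_imp_continuous_at_within continuous_within by blast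
    then show "((T n \<circ> real_of_ereal) \<longlongrightarrow> T n x) (at_left (ereal x))"
      by (simp add: ereal_tendsto_simps)
  qed
  \<comment> \<open>Since \<open>ennreal\<close> sends negative numbers to 0, the difference
    \<open>T n x - J * (x - x\<^sub>0) ^ n\<close> has to be nonnegative before the equation can be
    rearranged.\<close>
  moreover have "T n x \<ge> J * (x - x\<^sub>0) ^ n"
  proof (rule tendsto_upperbound[where F = "at_right x\<^sub>0"])
    have "T n u \<le> T n x" if u: "x\<^sub>0 < u" "u < x" for u
    proof (rule DERIV_nonneg_imp_nondecreasing[where f = "T n"])
      show "u \<le> x" using u by simp
      fix v assume v: "u \<le> v" "v \<le> x"
      show "\<exists>y. DERIV (T n) v :> y \<and> 0 \<le> y"
        using dT[of v n] nonneg[of v] u v x by (intro exI[of _ "G (Suc n) v * (x - v) ^ n / fact n"]) simp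
    qed
    then show "\<forall>\<^sub>F u in at_right x\<^sub>0. T n u \<le> T n x"
      using x by (auto simp: eventually_at_right_field)
  qed (use limT in auto)
  ultimately show ?thesis using J x Tx
    by (simp add: einterval_eq flip: ennreal_plus)
qed

section \<open>Derivatives of \<open>(1 + u) (c - arccos u)\<close>\<close>

lemma one_minus_square_pos: "-1 < u \<Longrightarrow> u < 1 \<Longrightarrow> 1 - u\<^sup>2 > (0::real)"
  by (simp add: abs_square_less_1)

lemma DERIV_inverse_sqrt:
  assumes u: "-1 < u" "u < (1::real)"
  shows "DERIV (\<lambda>u. inverse (sqrt (1 - u\<^sup>2))) u :> inverse (sqrt (1 - u\<^sup>2)) * (u / (1 - u\<^sup>2))"
proof -
  have p: "1 - u\<^sup>2 > 0" using one_minus_square_pos u by simp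
  have "DERIV (\<lambda>u. inverse (sqrt (1 - u\<^sup>2))) u
      :> - (inverse (sqrt (1 - u\<^sup>2)) * (- (2 * u) * (inverse (sqrt (1 - u\<^sup>2)) / 2)) * inverse (sqrt (1 - u\<^sup>2)))"
    using p by (auto intro!: derivative_eq_intros)
  moreover have "inverse (sqrt (1 - u\<^sup>2)) * inverse (sqrt (1 - u\<^sup>2)) = 1 / (1 - u\<^sup>2)"
    using p by (simp add: inverse_eq_divide flip: real_sqrt_mult)
  ultimately show ?thesis by (simp add: mult_ac inverse_eq_divide)
qed

text \<open>Removes the indeterminate form 0 / 0 at -1: the right-hand side visibly tends to 0
  there.\<close>

lemma sqrt_quotient_eq:
  assumes u: "-1 < u" "u < (1::real)"
  shows "(1 + u) / sqrt (1 - u\<^sup>2) = sqrt ((1 + u) / (1 - u))"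
proof -
  have "1 - u\<^sup>2 = (1 + u) * (1 - u)" by (simp add: power2_eq_square algebra_simps)
  then have "sqrt (1 - u\<^sup>2) = sqrt (1 + u) * sqrt (1 - u)" by (simp add: real_sqrt_mult)
  moreover have "1 + u = sqrt (1 + u) * sqrt (1 + u)" using u by simp
  ultimately have "(1 + u) / sqrt (1 - u\<^sup>2) = (sqrt (1 + u) * sqrt (1 + u)) / (sqrt (1 + u) * sqrt (1 - u))"
    by metis
  also have "\<dots> = sqrt (1 + u) / sqrt (1 - u)"
    using u by (intro mult_divide_mult_cancel_left) simp
  finally show ?thesis by (simp add: real_sqrt_divide)
qed

text \<open>
  \<open>\<gamma>\<^sub>1, \<dots>, \<gamma>\<^sub>4\<close> are the derivatives of \<open>\<gamma>\<close>, \<open>\<rho>\<^sub>1\<close> is the logarithmic derivative of \<open>\<gamma>\<^sub>2\<close>, and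
  \<open>\<rho>\<^sub>2\<close> is the derivative of \<open>\<rho>\<^sub>1\<close>.
\<close>
context
  fixes c :: real
begin

definition \<gamma> where "\<gamma> u = (1 + u) * (c - arccos u)"
definition \<gamma>\<^sub>1 where "\<gamma>\<^sub>1 u = c - arccos u + (1 + u) / sqrt (1 - u\<^sup>2)"
definition \<gamma>\<^sub>2 :: "real \<Rightarrow> real" where "\<gamma>\<^sub>2 u = (2 - u) / (1 - u) * inverse (sqrt (1 - u\<^sup>2))"
definition \<rho>\<^sub>1 :: "real \<Rightarrow> real" where "\<rho>\<^sub>1 u = - inverse (2 - u) + 3 / 2 * inverse (1 - u) - 1 / 2 * inverse (1 + u)"
definition \<rho>\<^sub>2 :: "real \<Rightarrow> real" where "\<rho>\<^sub>2 u = - (inverse (2 - u))\<^sup>2 + 3 / 2 * (inverse (1 - u))\<^sup>2 + 1 / 2 * (inverse (1 + u))\<^sup>2"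
definition \<gamma>\<^sub>3 where "\<gamma>\<^sub>3 u = \<gamma>\<^sub>2 u * \<rho>\<^sub>1 u"
definition \<gamma>\<^sub>4 where "\<gamma>\<^sub>4 u = \<gamma>\<^sub>2 u * ((\<rho>\<^sub>1 u)\<^sup>2 + \<rho>\<^sub>2 u)"

lemma DERIV_gamma: "-1 < u \<Longrightarrow> u < 1 \<Longrightarrow> DERIV \<gamma> u :> \<gamma>\<^sub>1 u"
  unfolding \<gamma>_def[abs_def] \<gamma>\<^sub>1_def
  by (auto intro!: derivative_eq_intros simp: inverse_eq_divide)

text \<open>The parameter \<open>c\<close> enters \<open>\<gamma>\<close> only through the linear
  term \<open>c (1 + u)\<close>; from the second derivative on it is gone.\<close>

lemma DERIV_gamma1:
  assumes u: "-1 < u" "u < 1"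
  shows "DERIV \<gamma>\<^sub>1 u :> \<gamma>\<^sub>2 u"
proof -
  have p: "1 - u\<^sup>2 > 0" using one_minus_square_pos u by simp
  have d1: "DERIV (\<lambda>u. c - arccos u) u :> inverse (sqrt (1 - u\<^sup>2))"
    using u by (auto intro!: derivative_eq_intros simp: inverse_eq_divide)
  have d2: "DERIV (\<lambda>u. 1 + u) u :> 1" by (auto intro!: derivative_eq_intros)
  from DERIV_add[OF d1 DERIV_mult[OF d2 DERIV_inverse_sqrt[OF u]]]
  have "DERIV (\<lambda>u. c - arccos u + (1 + u) * inverse (sqrt (1 - u\<^sup>2))) u :>
      inverse (sqrt (1 - u\<^sup>2)) + (inverse (sqrt (1 - u\<^sup>2)) + (1 + u) * (inverse (sqrt (1 - u\<^sup>2)) * (u / (1 - u\<^sup>2))))"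
    by (simp add: algebra_simps)
  also have "inverse (sqrt (1 - u\<^sup>2)) + (inverse (sqrt (1 - u\<^sup>2)) + (1 + u) * (inverse (sqrt (1 - u\<^sup>2)) * (u / (1 - u\<^sup>2))))
      = (2 + (1 + u) * u / (1 - u\<^sup>2)) * inverse (sqrt (1 - u\<^sup>2))"
    by (simp add: algebra_simps)
  also have "2 + (1 + u) * u / (1 - u\<^sup>2) = (2 - u) / (1 - u)"
  proof -
    have "1 - u\<^sup>2 = (1 + u) * (1 - u)" by (simp add: power2_eq_square algebra_simps)
    then have "(1 + u) * u / (1 - u\<^sup>2) = u / (1 - u)" using u by simp
    then show ?thesis using u by (simp add: field_simps)
  qed
  finally show ?thesis
    unfolding \<gamma>\<^sub>1_def[abs_def] \<gamma>\<^sub>2_def divide_inverse[of "1 + _" "sqrt _"] .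
qed

text \<open>Since \<open>\<gamma>\<^sub>2\<close> is
  \<open>(2 - u) (1 - u)^(-3/2) (1 + u)^(-1/2)\<close>, its logarithmic derivative is a sum of
  partial fractions. This form isolates the one pole at -1, whose residue \<open>- 1 / 2\<close>
  decides the later estimates.\<close>

lemma DERIV_gamma2:
  assumes u: "-1 < u" "u < 1"
  shows "DERIV \<gamma>\<^sub>2 u :> \<gamma>\<^sub>3 u"
proof -
  have "DERIV (\<lambda>u. (2 - u) / (1 - u)) u :> ((- 1) * (1 - u) - (2 - u) * (- 1)) / ((1 - u) * (1 - u))"
    using u by (auto intro!: derivative_eq_intros)
  also have "((- 1) * (1 - u) - (2 - u) * (- 1)) / ((1 - u) * (1 - u))
      = (2 - u) / (1 - u) * (- inverse (2 - u) + inverse (1 - u))"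
  proof -
    have "((- 1) * A - (1 + A) * (- 1)) / (A * A) = (1 + A) / A * (- inverse (1 + A) + inverse A)"
      if "A > 0" for A :: real
    proof -
      have "A * A + A * (A * A) > 0" using that by (intro add_pos_pos) auto
      then show ?thesis using that by (simp add: field_simps)
    qed
    from this[of "1 - u"] u show ?thesis by simp
  qed
  finally have "DERIV (\<lambda>u. (2 - u) / (1 - u)) u :> (2 - u) / (1 - u) * (- inverse (2 - u) + inverse (1 - u))" .
  from DERIV_mult[OF this DERIV_inverse_sqrt[OF u]]
  have "DERIV \<gamma>\<^sub>2 u :> (2 - u) / (1 - u) * (- inverse (2 - u) + inverse (1 - u)) * inverse (sqrt (1 - u\<^sup>2))
      + inverse (sqrt (1 - u\<^sup>2)) * (u / (1 - u\<^sup>2)) * ((2 - u) / (1 - u))"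
    unfolding \<gamma>\<^sub>2_def[abs_def] .
  moreover have "p * x * i + i * w * p = p * i * (x + w)" for p x i w :: real
    by (simp add: algebra_simps)
  ultimately have "DERIV \<gamma>\<^sub>2 u :> \<gamma>\<^sub>2 u * (- inverse (2 - u) + inverse (1 - u) + u / (1 - u\<^sup>2))"
    unfolding \<gamma>\<^sub>2_def by metis
  moreover have "inverse (1 - u) + u / (1 - u\<^sup>2) = 3 / 2 * inverse (1 - u) - 1 / 2 * inverse (1 + u)"
  proof -
    have A: "1 - u\<^sup>2 = (1 + u) * (1 - u)" by (simp add: power2_eq_square algebra_simps)
    have "inverse (1 + u) * (1 + u) = 1" "inverse (1 - u) * (1 - u) = 1" using u by auto
    then have "2 * (u * (inverse (1 + u) * inverse (1 - u))) = inverse (1 - u) - inverse (1 + u)"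
      by algebra
    then show ?thesis
      unfolding A divide_inverse inverse_mult_distrib by (simp add: algebra_simps)
  qed
  then have "- inverse (2 - u) + inverse (1 - u) + u / (1 - u\<^sup>2) = \<rho>\<^sub>1 u" by (simp add: \<rho>\<^sub>1_def)
  ultimately show ?thesis by (simp add: \<gamma>\<^sub>3_def)
qed

lemma DERIV_gamma3:
  assumes u: "-1 < u" "u < 1"
  shows "DERIV \<gamma>\<^sub>3 u :> \<gamma>\<^sub>4 u"
proof -
  have "DERIV \<rho>\<^sub>1 u :> \<rho>\<^sub>2 u"
    unfolding \<rho>\<^sub>1_def[abs_def] \<rho>\<^sub>2_def using u
    by (auto intro!: derivative_eq_intros simp: power2_eq_square)
  from DERIV_mult[OF DERIV_gamma2[OF u] this]
  show ?thesis unfolding \<gamma>\<^sub>3_def[abs_def] \<gamma>\<^sub>4_def by (simp add: power2_eq_square algebra_simps)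
qed

lemma isCont_gamma4:
  assumes u: "-1 < u" "u < 1"
  shows "isCont \<gamma>\<^sub>4 u"
  unfolding \<gamma>\<^sub>4_def[abs_def] \<gamma>\<^sub>2_def \<rho>\<^sub>1_def \<rho>\<^sub>2_def
  using u one_minus_square_pos[OF u] by (intro continuous_intros) auto

text \<open>For \<open>c < pi\<close> the point \<open>cos c\<close> is interior and all limits are
  values at a zero of \<open>\<gamma>\<close>. For \<open>c \<ge> pi\<close> the point is -1, where
  \<open>\<gamma>\<^sub>2\<close> and \<open>\<rho>\<^sub>1\<close> blow up like the powers -1/2 and
  -1 of \<open>1 + u\<close>; each is then paired with a factor \<open>1 + u\<close> taken from
  \<open>\<gamma>\<close>.\<close>

lemma gamma_limits:
  assumes c: "c > 0"
  defines "x\<^sub>0 \<equiv> cos (min c pi)"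
  obtains J where "J \<ge> 0" "(\<gamma> \<longlongrightarrow> 0) (at_right x\<^sub>0)" "(\<gamma>\<^sub>1 \<longlongrightarrow> J) (at_right x\<^sub>0)"
    "((\<lambda>u. \<gamma> u * \<gamma>\<^sub>2 u) \<longlongrightarrow> 0) (at_right x\<^sub>0)" "((\<lambda>u. (\<gamma> u)\<^sup>2 * \<gamma>\<^sub>3 u) \<longlongrightarrow> 0) (at_right x\<^sub>0)"
proof (cases "c < pi")
  case True
  then have x0: "x\<^sub>0 = cos c" by (simp add: x\<^sub>0_def)
  have u: "-1 < x\<^sub>0" "x\<^sub>0 < 1"
    unfolding x0 using cos_monotone_0_pi[of c pi] cos_monotone_0_pi[of 0 c] c True by auto
  have g0: "\<gamma> x\<^sub>0 = 0" using c True by (simp add: \<gamma>_def x0 arccos_cos)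
  have cont: "isCont \<gamma> x\<^sub>0" "isCont \<gamma>\<^sub>1 x\<^sub>0" "isCont \<gamma>\<^sub>2 x\<^sub>0" "isCont \<gamma>\<^sub>3 x\<^sub>0"
    using DERIV_gamma[OF u] DERIV_gamma1[OF u] DERIV_gamma2[OF u] DERIV_gamma3[OF u] DERIV_isCont by auto
  have lim: "(f \<longlongrightarrow> f x\<^sub>0) (at_right x\<^sub>0)" if "isCont f x\<^sub>0" for f :: "real \<Rightarrow> real"
    using that continuous_at_imp_continuous_at_within continuous_within by blast
  show thesis
  proof (rule that)
    show "\<gamma>\<^sub>1 x\<^sub>0 \<ge> 0" using u c True by (simp add: \<gamma>\<^sub>1_def x0 arccos_cos abs_square_le_1)
    show "(\<gamma> \<longlongrightarrow> 0) (at_right x\<^sub>0)" using lim[OF cont(1)] g0 by simp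
    show "(\<gamma>\<^sub>1 \<longlongrightarrow> \<gamma>\<^sub>1 x\<^sub>0) (at_right x\<^sub>0)" by (rule lim[OF cont(2)])
    show "((\<lambda>u. \<gamma> u * \<gamma>\<^sub>2 u) \<longlongrightarrow> 0) (at_right x\<^sub>0)"
      using tendsto_mult[OF lim[OF cont(1)] lim[OF cont(3)]] g0 by simp
    show "((\<lambda>u. (\<gamma> u)\<^sup>2 * \<gamma>\<^sub>3 u) \<longlongrightarrow> 0) (at_right x\<^sub>0)"
      using tendsto_mult[OF tendsto_power[OF lim[OF cont(1)], of 2] lim[OF cont(4)]] g0 by simp
  qed
next
  case False
  then have x0: "x\<^sub>0 = -1" by (simp add: x\<^sub>0_def)
  define m where "m u = sqrt ((1 + u) / (1 - u))" for u :: real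
  have ev: "\<forall>\<^sub>F u in at_right (-1). -1 < u \<and> u < (1::real)"
    by (auto simp: eventually_at_right_field intro!: exI[of _ 1])
  have m_lim: "(m \<longlongrightarrow> 0) (at_right (-1))"
    unfolding m_def[abs_def] by (auto intro!: tendsto_eq_intros)
  have "continuous_on {-1..1} arccos" by (intro continuous_intros) auto
  then have "(arccos \<longlongrightarrow> arccos (-1)) (at (-1) within {-1..1})"
    unfolding continuous_on_def by (rule bspec) simp
  then have "(arccos \<longlongrightarrow> arccos (-1)) (at_right (-1))"
    by (simp add: at_within_Icc_at_right)
  then have h_lim: "((\<lambda>u. c - arccos u) \<longlongrightarrow> c - pi) (at_right (-1))"
    by (auto intro!: tendsto_eq_intros)
  have q_lim: "((\<lambda>u. (1 + u) * \<gamma>\<^sub>2 u) \<longlongrightarrow> 0) (at_right (-1))"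
  proof (rule Lim_transform_eventually)
    show "((\<lambda>u. (2 - u) / (1 - u) * m u) \<longlongrightarrow> 0) (at_right (-1))"
      by (rule tendsto_eq_intros m_lim refl | simp)+
    show "\<forall>\<^sub>F u in at_right (-1). (2 - u) / (1 - u) * m u = (1 + u) * \<gamma>\<^sub>2 u"
      using ev by eventually_elim (simp add: m_def \<gamma>\<^sub>2_def flip: sqrt_quotient_eq, simp add: divide_inverse mult_ac)
  qed
  have r_lim: "((\<lambda>u. (1 + u) * \<rho>\<^sub>1 u) \<longlongrightarrow> - 1 / 2) (at_right (-1))"
  proof (rule Lim_transform_eventually)
    show "((\<lambda>u. (1 + u) * (- inverse (2 - u) + 3 / 2 * inverse (1 - u)) - 1 / 2) \<longlongrightarrow> - 1 / 2) (at_right (-1::real))"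
      by (rule tendsto_eq_intros refl | simp)+
    show "\<forall>\<^sub>F u in at_right (-1). (1 + u) * (- inverse (2 - u) + 3 / 2 * inverse (1 - u)) - 1 / 2 = (1 + u) * \<rho>\<^sub>1 u"
      using ev by eventually_elim (simp add: \<rho>\<^sub>1_def distrib_left right_diff_distrib)
  qed
  show thesis
  proof (rule that)
    show "c - pi \<ge> 0" using False by simp
    show "(\<gamma> \<longlongrightarrow> 0) (at_right x\<^sub>0)"
      unfolding x0 \<gamma>_def[abs_def] by (rule tendsto_eq_intros h_lim refl | simp)+
    show "(\<gamma>\<^sub>1 \<longlongrightarrow> c - pi) (at_right x\<^sub>0)"
      unfolding x0
    proof (rule Lim_transform_eventually)
      show "((\<lambda>u. c - arccos u + m u) \<longlongrightarrow> c - pi) (at_right (-1))"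
        using tendsto_add[OF h_lim m_lim] by simp
      show "\<forall>\<^sub>F u in at_right (-1). c - arccos u + m u = \<gamma>\<^sub>1 u"
        using ev by eventually_elim (simp add: m_def \<gamma>\<^sub>1_def sqrt_quotient_eq)
    qed
    have "((\<lambda>u. (c - arccos u) * ((1 + u) * \<gamma>\<^sub>2 u)) \<longlongrightarrow> 0) (at_right (-1))"
      using tendsto_mult[OF h_lim q_lim] by simp
    then show "((\<lambda>u. \<gamma> u * \<gamma>\<^sub>2 u) \<longlongrightarrow> 0) (at_right x\<^sub>0)"
      unfolding x0 \<gamma>_def by (simp add: mult_ac)
    have "((\<lambda>u. (c - arccos u)\<^sup>2 * (((1 + u) * \<gamma>\<^sub>2 u) * ((1 + u) * \<rho>\<^sub>1 u))) \<longlongrightarrow> 0) (at_right (-1))"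
      using tendsto_mult[OF tendsto_power[OF h_lim, of 2] tendsto_mult[OF q_lim r_lim]] by simp
    then show "((\<lambda>u. (\<gamma> u)\<^sup>2 * \<gamma>\<^sub>3 u) \<longlongrightarrow> 0) (at_right x\<^sub>0)"
      unfolding x0 \<gamma>_def \<gamma>\<^sub>3_def by (simp add: power2_eq_square mult_ac)
  qed
qed

text \<open>Among the derivatives only \<open>\<gamma>\<^sub>3\<close> can be negative, through the
  pole of \<open>\<rho>\<^sub>1\<close> at -1. The factor \<open>1 + u\<close> of
  \<open>\<gamma>\<close> turns that pole into the constant \<open>- 1 / 2\<close>, whence the fifth
  bound. The last bound holds because \<open>\<rho>\<^sub>2 \<ge> 0\<close>, where
  \<open>inverse (1 - u)\<close> dominates \<open>inverse (2 - u)\<close>.\<close>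

lemma gamma_derivative_bounds:
  assumes u: "cos (min c pi) < u" "u < 1" and c: "c > 0"
  shows "\<gamma> u > 0" "\<gamma>\<^sub>1 u > c - arccos u" "c - arccos u > 0" "\<gamma>\<^sub>2 u > 0"
    "\<gamma> u * \<gamma>\<^sub>3 u \<ge> - (1 / 2) * ((c - arccos u) * \<gamma>\<^sub>2 u)" "\<gamma>\<^sub>4 u \<ge> 0"
proof -
  have u1: "-1 < u" using u cos_ge_minus_one[of "min c pi"] by linarith
  have "arccos u < arccos (cos (min c pi))"
    using u u1 by (intro arccos_less_arccos) auto
  also have "\<dots> = min c pi" using c by (intro arccos_cos) auto
  finally show h: "c - arccos u > 0" by simp
  have p: "sqrt (1 - u\<^sup>2) > 0" using one_minus_square_pos[of u] u u1 by simp
  show "\<gamma> u > 0" using h u1 by (simp add: \<gamma>_def)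
  show "\<gamma>\<^sub>1 u > c - arccos u" using p u1 by (simp add: \<gamma>\<^sub>1_def)
  show g2: "\<gamma>\<^sub>2 u > 0" unfolding \<gamma>\<^sub>2_def using p u by simp
  have A: "inverse (2 - u) \<le> inverse (1 - u)" "inverse (1 - u) > 0" "inverse (2 - u) > 0"
    using u by (auto intro!: le_imp_inverse_le)
  have "(1 + u) * \<rho>\<^sub>1 u = (1 + u) * (- inverse (2 - u) + 3 / 2 * inverse (1 - u)) - 1 / 2"
    using u1 by (simp add: \<rho>\<^sub>1_def distrib_left right_diff_distrib)
  moreover have "(1 + u) * (- inverse (2 - u) + 3 / 2 * inverse (1 - u)) \<ge> 0"
    using A u1 by (intro mult_nonneg_nonneg) linarith+
  ultimately have "(1 + u) * \<rho>\<^sub>1 u \<ge> - (1 / 2)" by linarith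
  then have "((c - arccos u) * \<gamma>\<^sub>2 u) * (- (1 / 2)) \<le> ((c - arccos u) * \<gamma>\<^sub>2 u) * ((1 + u) * \<rho>\<^sub>1 u)"
    using h g2 by (intro mult_left_mono) auto
  then show "\<gamma> u * \<gamma>\<^sub>3 u \<ge> - (1 / 2) * ((c - arccos u) * \<gamma>\<^sub>2 u)"
    by (simp add: \<gamma>_def \<gamma>\<^sub>3_def mult_ac)
  have "(inverse (2 - u))\<^sup>2 \<le> (inverse (1 - u))\<^sup>2" using A by (intro power_mono) auto
  moreover have "(inverse (1 - u))\<^sup>2 \<ge> 0" "(inverse (1 + u))\<^sup>2 \<ge> 0" by auto
  ultimately have "\<rho>\<^sub>2 u \<ge> 0" unfolding \<rho>\<^sub>2_def by linarith
  then show "\<gamma>\<^sub>4 u \<ge> 0" using g2 by (simp add: \<gamma>\<^sub>4_def)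
qed

end

text \<open>
  The function \<open>x \<mapsto> ((1 + x) (c - arccos x)) ^ n\<close> has positive derivative of order \<open>n + 1\<close> on
  \<open>(x\<^sub>0, 1)\<close>, and \<open>D\<close> is this derivative divided by \<open>n!\<close>.
\<close>
lemma truncated_power_taylor:
  assumes c: "c > 0" and n: "n \<in> {1, 2, 3}"
  defines "x\<^sub>0 \<equiv> cos (min c pi)"
  obtains J :: real and D :: "real \<Rightarrow> real" where
    "J \<ge> 0" "D \<in> borel_measurable borel" "\<And>u. x\<^sub>0 < u \<Longrightarrow> u < 1 \<Longrightarrow> D u > 0" "\<And>u. D u \<ge> 0"
    "\<And>u. u \<notin> {x\<^sub>0<..<1} \<Longrightarrow> D u = 0"
    "\<And>x. x\<^sub>0 < x \<Longrightarrow> x < 1 \<Longrightarrow> ennreal (((1 + x) * (c - arccos x)) ^ n) = ennreal (J * (x - x\<^sub>0) ^ n)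
      + (\<integral>\<^sup>+u. ennreal (D u * max 0 (x - u) ^ n) \<partial>lborel)"
proof -
  obtain j where j: "j \<ge> 0" and l0: "(\<gamma> c \<longlongrightarrow> 0) (at_right x\<^sub>0)" and l1: "(\<gamma>\<^sub>1 c \<longlongrightarrow> j) (at_right x\<^sub>0)"
    and l2: "((\<lambda>u. \<gamma> c u * \<gamma>\<^sub>2 u) \<longlongrightarrow> 0) (at_right x\<^sub>0)" and l3: "((\<lambda>u. (\<gamma> c u)\<^sup>2 * \<gamma>\<^sub>3 u) \<longlongrightarrow> 0) (at_right x\<^sub>0)"
    using gamma_limits[OF c] unfolding x\<^sub>0_def by blast
  note bounds = gamma_derivative_bounds[OF _ _ c, folded x\<^sub>0_def]
  have x01: "-1 \<le> x\<^sub>0" by (simp add: x\<^sub>0_def)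
  \<comment> \<open>\<open>G k\<close> is the \<open>k\<close>-th derivative of the
    \<open>n\<close>-th power, written out by the product rule for each \<open>n\<close>. As
    \<open>\<gamma>\<close> tends to 0 at \<open>x\<^sub>0\<close>, the orders below
    \<open>n\<close> vanish in the limit, and of order \<open>n\<close> only \<open>n!\<close> times
    the \<open>n\<close>-th power of \<open>\<gamma>\<^sub>1\<close> survives.\<close>
  have "\<exists>G::nat \<Rightarrow> real \<Rightarrow> real. (\<forall>u. G 0 u = \<gamma> c u ^ n) \<and>
      (\<forall>k u. k \<le> n \<longrightarrow> x\<^sub>0 < u \<longrightarrow> u < 1 \<longrightarrow> DERIV (G k) u :> G (Suc k) u) \<and>
      (\<forall>u. x\<^sub>0 < u \<longrightarrow> u < 1 \<longrightarrow> isCont (G (Suc n)) u \<and> 0 < G (Suc n) u) \<and>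
      (\<forall>k<n. (G k \<longlongrightarrow> 0) (at_right x\<^sub>0)) \<and> (G n \<longlongrightarrow> fact n * j ^ n) (at_right x\<^sub>0)"
  proof -
    have d: "DERIV (\<gamma> c) u :> \<gamma>\<^sub>1 c u" "DERIV (\<gamma>\<^sub>1 c) u :> \<gamma>\<^sub>2 u" "DERIV \<gamma>\<^sub>2 u :> \<gamma>\<^sub>3 u" "DERIV \<gamma>\<^sub>3 u :> \<gamma>\<^sub>4 u"
      "isCont \<gamma>\<^sub>4 u" if "x\<^sub>0 < u" "u < 1" for u
      using DERIV_gamma DERIV_gamma1 DERIV_gamma2 DERIV_gamma3 isCont_gamma4 that x01 by auto
    have ct: "isCont (\<gamma> c) u" "isCont (\<gamma>\<^sub>1 c) u" "isCont \<gamma>\<^sub>2 u" "isCont \<gamma>\<^sub>3 u" if "x\<^sub>0 < u" "u < 1" for u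
      using d[OF that] DERIV_isCont by auto
    consider "n = 1" | "n = 2" | "n = 3" using n by auto
    then show ?thesis
    proof cases
      case 1
      define G where "G = (\<lambda>k. [\<gamma> c, \<gamma>\<^sub>1 c, \<gamma>\<^sub>2] ! k)"
      show ?thesis
      proof (intro exI[of _ G] conjI allI impI)
        fix k u assume "k \<le> n" "x\<^sub>0 < u" "u < 1"
        then show "DERIV (G k) u :> G (Suc k) u"
          using d[of u] 1 by (cases k) (auto simp: G_def)
      next
        fix k assume "k < n"
        then show "(G k \<longlongrightarrow> 0) (at_right x\<^sub>0)" using 1 l0 by (simp add: G_def)
      qed (use 1 ct bounds(4) l1 in \<open>auto simp: G_def\<close>)
    next
      case 2
      define G where "G = (\<lambda>k. [\<lambda>u. \<gamma> c u ^ 2, \<lambda>u. 2 * \<gamma> c u * \<gamma>\<^sub>1 c u, \<lambda>u. 2 * \<gamma>\<^sub>1 c u ^ 2 + 2 * (\<gamma> c u * \<gamma>\<^sub>2 u),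
         \<lambda>u. 6 * \<gamma>\<^sub>1 c u * \<gamma>\<^sub>2 u + 2 * (\<gamma> c u * \<gamma>\<^sub>3 u)] ! k)"
      show ?thesis
      proof (intro exI[of _ G] conjI allI impI)
        fix k u assume k: "k \<le> n" and u: "x\<^sub>0 < u" "u < 1"
        note [derivative_intros] = d(1-4)[OF u]
        consider "k = 0" | "k = 1" | "k = 2" using k 2 by linarith
        then show "DERIV (G k) u :> G (Suc k) u"
          by cases (auto simp: G_def algebra_simps power2_eq_square intro!: derivative_eq_intros d(1-4)[OF u])
      next
        fix u assume u: "x\<^sub>0 < u" "u < 1"
        show "isCont (G (Suc n)) u"
          unfolding G_def 2 by (simp add: eval_nat_numeral) (intro continuous_intros ct[OF u])
        \<comment> \<open>The term \<open>2 \<gamma> \<gamma>\<^sub>3\<close> costs at most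
          \<open>(c - arccos u) \<gamma>\<^sub>2\<close>, and
          \<open>6 \<gamma>\<^sub>1 \<gamma>\<^sub>2\<close> is at least six times that.\<close>
        have "6 * ((c - arccos u) * \<gamma>\<^sub>2 u) \<le> 6 * (\<gamma>\<^sub>1 c u * \<gamma>\<^sub>2 u)"
          using bounds[OF u] by (intro mult_left_mono mult_right_mono) auto
        moreover have "(c - arccos u) * \<gamma>\<^sub>2 u > 0" using bounds[OF u] by simp
        ultimately have "6 * \<gamma>\<^sub>1 c u * \<gamma>\<^sub>2 u + 2 * (\<gamma> c u * \<gamma>\<^sub>3 u) > 0"
          using bounds(5)[OF u] unfolding mult.assoc by linarith
        then show "0 < G (Suc n) u" by (simp add: G_def 2 eval_nat_numeral)
      next
        fix k assume "k < n"
        then consider "k = 0" | "k = 1" using 2 by linarith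
        then show "(G k \<longlongrightarrow> 0) (at_right x\<^sub>0)"
          by cases (auto simp: G_def intro!: tendsto_eq_intros l0 l1)
      next
        have "((\<lambda>u. 2 * \<gamma>\<^sub>1 c u ^ 2 + 2 * (\<gamma> c u * \<gamma>\<^sub>2 u)) \<longlongrightarrow> 2 * j ^ 2 + 2 * 0) (at_right x\<^sub>0)"
          by (intro tendsto_intros l1 l2)
        then show "(G n \<longlongrightarrow> fact n * j ^ n) (at_right x\<^sub>0)"
          by (simp add: G_def 2 eval_nat_numeral)
      qed (simp add: G_def 2)
    next
      case 3
      \<comment> \<open>Up to order 3 the products are grouped so that the possibly singular
        \<open>\<gamma>\<^sub>2\<close> and \<open>\<gamma>\<^sub>3\<close> stand next to the powers
        of \<open>\<gamma>\<close> with which they tend to 0.\<close>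
      define G where "G = (\<lambda>k. [\<lambda>u. \<gamma> c u ^ 3, \<lambda>u. 3 * \<gamma> c u ^ 2 * \<gamma>\<^sub>1 c u,
         \<lambda>u. 6 * \<gamma> c u * \<gamma>\<^sub>1 c u ^ 2 + 3 * \<gamma> c u * (\<gamma> c u * \<gamma>\<^sub>2 u),
         \<lambda>u. 6 * \<gamma>\<^sub>1 c u ^ 3 + 18 * \<gamma>\<^sub>1 c u * (\<gamma> c u * \<gamma>\<^sub>2 u) + 3 * ((\<gamma> c u)\<^sup>2 * \<gamma>\<^sub>3 u),
         \<lambda>u. 36 * (\<gamma>\<^sub>1 c u ^ 2 * \<gamma>\<^sub>2 u) + 18 * \<gamma> c u * \<gamma>\<^sub>2 u ^ 2 + 24 * (\<gamma>\<^sub>1 c u * (\<gamma> c u * \<gamma>\<^sub>3 u)) + 3 * \<gamma> c u ^ 2 * \<gamma>\<^sub>4 u] ! k)"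
      show ?thesis
      proof (intro exI[of _ G] conjI allI impI)
        fix k u assume k: "k \<le> n" and u: "x\<^sub>0 < u" "u < 1"
        consider "k = 0" | "k = 1" | "k = 2" | "k = 3" using k 3 by linarith
        then show "DERIV (G k) u :> G (Suc k) u"
          by cases (auto simp: G_def algebra_simps eval_nat_numeral intro!: derivative_eq_intros d(1-4)[OF u])
      next
        fix u assume u: "x\<^sub>0 < u" "u < 1"
        show "isCont (G (Suc n)) u"
          unfolding G_def 3 by (simp add: eval_nat_numeral) (intro continuous_intros ct[OF u] d(5)[OF u])
        have pos: "\<gamma>\<^sub>1 c u > 0" using bounds[OF u] by linarith
        have "(c - arccos u) * \<gamma>\<^sub>2 u \<le> \<gamma>\<^sub>1 c u * \<gamma>\<^sub>2 u"
          using bounds[OF u] by (intro mult_right_mono) auto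
        then have "\<gamma> c u * \<gamma>\<^sub>3 u \<ge> - (1 / 2) * (\<gamma>\<^sub>1 c u * \<gamma>\<^sub>2 u)" using bounds(5)[OF u] by linarith
        then have "\<gamma>\<^sub>1 c u * (\<gamma> c u * \<gamma>\<^sub>3 u) \<ge> \<gamma>\<^sub>1 c u * (- (1 / 2) * (\<gamma>\<^sub>1 c u * \<gamma>\<^sub>2 u))"
          using pos by (intro mult_left_mono) auto
        moreover have "\<gamma>\<^sub>1 c u * (- (1 / 2) * (\<gamma>\<^sub>1 c u * \<gamma>\<^sub>2 u)) = - (1 / 2) * (\<gamma>\<^sub>1 c u ^ 2 * \<gamma>\<^sub>2 u)"
          by (simp add: power2_eq_square)
        moreover have "\<gamma>\<^sub>1 c u ^ 2 * \<gamma>\<^sub>2 u > 0" "18 * \<gamma> c u * \<gamma>\<^sub>2 u ^ 2 \<ge> 0" "3 * \<gamma> c u ^ 2 * \<gamma>\<^sub>4 u \<ge> 0"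
          using pos bounds[OF u] by auto
        \<comment> \<open>The negative part is at most \<open>24 / 2 = 12\<close> times
          \<open>\<gamma>\<^sub>1\<^sup>2 \<gamma>\<^sub>2\<close>, against the coefficient 36; the
          other two terms are nonnegative.\<close>
        ultimately have "36 * (\<gamma>\<^sub>1 c u ^ 2 * \<gamma>\<^sub>2 u) + 18 * \<gamma> c u * \<gamma>\<^sub>2 u ^ 2 + 24 * (\<gamma>\<^sub>1 c u * (\<gamma> c u * \<gamma>\<^sub>3 u)) + 3 * \<gamma> c u ^ 2 * \<gamma>\<^sub>4 u > 0"
          by linarith
        then show "0 < G (Suc n) u" by (simp add: G_def 3 eval_nat_numeral)
      next
        fix k assume "k < n"
        then consider "k = 0" | "k = 1" | "k = 2" using 3 by linarith
        then show "(G k \<longlongrightarrow> 0) (at_right x\<^sub>0)"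
        proof cases
          case 3
          have "((\<lambda>u. 6 * \<gamma> c u * \<gamma>\<^sub>1 c u ^ 2 + 3 * \<gamma> c u * (\<gamma> c u * \<gamma>\<^sub>2 u)) \<longlongrightarrow> 6 * 0 * j ^ 2 + 3 * 0 * 0) (at_right x\<^sub>0)"
            by (intro tendsto_intros l0 l1 l2)
          then show ?thesis by (simp add: G_def 3 eval_nat_numeral)
        qed (auto simp: G_def intro!: tendsto_eq_intros l0 l1)
      next
        have "((\<lambda>u. 6 * \<gamma>\<^sub>1 c u ^ 3 + 18 * \<gamma>\<^sub>1 c u * (\<gamma> c u * \<gamma>\<^sub>2 u) + 3 * ((\<gamma> c u)\<^sup>2 * \<gamma>\<^sub>3 u)) \<longlongrightarrow> 6 * j ^ 3 + 18 * j * 0 + 3 * 0) (at_right x\<^sub>0)"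
          by (intro tendsto_intros l1 l2 l3)
        then show "(G n \<longlongrightarrow> fact n * j ^ n) (at_right x\<^sub>0)"
          by (simp add: G_def 3 eval_nat_numeral)
      qed (simp add: G_def 3)
    qed
  qed
  then obtain G :: "nat \<Rightarrow> real \<Rightarrow> real" where G0: "\<And>u. G 0 u = \<gamma> c u ^ n"
    and dG: "\<And>k u. k \<le> n \<Longrightarrow> x\<^sub>0 < u \<Longrightarrow> u < 1 \<Longrightarrow> DERIV (G k) u :> G (Suc k) u"
    and cG: "\<And>u. x\<^sub>0 < u \<Longrightarrow> u < 1 \<Longrightarrow> isCont (G (Suc n)) u" and pG: "\<And>u. x\<^sub>0 < u \<Longrightarrow> u < 1 \<Longrightarrow> 0 < G (Suc n) u"
    and l: "\<And>k. k < n \<Longrightarrow> (G k \<longlongrightarrow> 0) (at_right x\<^sub>0)" "(G n \<longlongrightarrow> fact n * j ^ n) (at_right x\<^sub>0)"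
    by blast
  define D where "D = (\<lambda>u. indicator {x\<^sub>0<..<1} u *\<^sub>R (G (Suc n) u / fact n))"
  show thesis
  proof (rule that[of "j ^ n" D])
    show "j ^ n \<ge> 0" using j by simp
    show "D \<in> borel_measurable borel"
      unfolding D_def using cG
      by (intro borel_measurable_continuous_on_indicator) (auto intro!: continuous_at_imp_continuous_on continuous_intros)
    show "D u > 0" if "x\<^sub>0 < u" "u < 1" for u using pG[OF that] that by (simp add: D_def)
    show "D u \<ge> 0" for u using pG[of u] by (auto simp: D_def indicator_def intro: less_imp_le)
    show "D u = 0" if "u \<notin> {x\<^sub>0<..<1}" for u using that by (simp add: D_def)
    fix x assume x: "x\<^sub>0 < x" "x < 1"
    have "ennreal (G 0 x) = ennreal (j ^ n * (x - x\<^sub>0) ^ n)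
      + (\<integral>\<^sup>+u. ennreal (G (Suc n) u / fact n * (x - u) ^ n) * indicator {x\<^sub>0<..<x} u \<partial>lborel)"
      using dG cG pG l j by (intro taylor_nn_integral[OF x]) (auto intro: less_imp_le)
    also have "(\<integral>\<^sup>+u. ennreal (G (Suc n) u / fact n * (x - u) ^ n) * indicator {x\<^sub>0<..<x} u \<partial>lborel)
        = (\<integral>\<^sup>+u. ennreal (D u * max 0 (x - u) ^ n) \<partial>lborel)"
      using x n by (intro nn_integral_cong) (auto simp: D_def indicator_def max_def power_0_left)
    finally show "ennreal (((1 + x) * (c - arccos x)) ^ n) = ennreal (j ^ n * (x - x\<^sub>0) ^ n)
      + (\<integral>\<^sup>+u. ennreal (D u * max 0 (x - u) ^ n) \<partial>lborel)"
      by (simp add: G0 \<gamma>_def)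
  qed
qed

section \<open>The integrand of the cap kernel and boundary cases\<close>

text \<open>On \<open>(0, pi)\<close> this is minus the derivative of the cap kernel with respect to
  the distance; it carries the comparison with powers of \<open>c - s\<close>.\<close>

definition cap_profile :: "nat \<Rightarrow> real \<Rightarrow> real \<Rightarrow> real" where
  "cap_profile n u s = max 0 ((cos s - u) / (1 + cos s)) ^ n"

lemma cap_profile_measurable [measurable (raw)]:
  assumes [measurable]: "f \<in> borel_measurable M" "g \<in> borel_measurable M"
  shows "(\<lambda>x. cap_profile n (f x) (g x)) \<in> borel_measurable M"
  unfolding cap_profile_def by measurable

lemma cap_profile_nonneg [simp]: "cap_profile n u s \<ge> 0"
  by (simp add: cap_profile_def)

lemma cap_profile_le_1:
  assumes "u \<ge> -1" shows "cap_profile n u s \<le> 1"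
proof -
  have "1 + cos s \<ge> 0" using cos_ge_minus_one[of s] by linarith
  moreover have "cos s - u \<le> 1 + cos s" using assms by simp
  ultimately have "(cos s - u) / (1 + cos s) \<le> 1"
    by (cases "1 + cos s = 0") (auto simp: divide_le_eq)
  then show ?thesis unfolding cap_profile_def by (intro power_le_one) auto
qed

lemma cap_kernel_altdef: "cap_kernel n u t = (LINT s|lborel. indicator {t<..<pi} s * cap_profile n u s)"
  by (simp add: cap_kernel_def cap_profile_def)

lemma integrable_cap_profile:
  assumes "u \<ge> -1"
  shows "integrable lborel (\<lambda>s. indicator {t<..<pi} s * cap_profile n u s)"
proof -
  have "emeasure lborel {t<..<pi} < \<infinity>" by (cases "t \<le> pi") auto
  then have "integrable lborel (\<lambda>s. indicator {t<..<pi} s *\<^sub>R cap_profile n u s)"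
    using cap_profile_le_1[OF assms, of n]
    by (intro integrableI_bounded_set_indicator[where B = 1]) auto
  then show ?thesis by simp
qed

lemma cap_kernel_nonneg [simp]: "cap_kernel n u t \<ge> 0"
  unfolding cap_kernel_altdef by (intro integral_nonneg_AE AE_I2) simp

lemma ennreal_cap_kernel:
  assumes "u \<ge> -1"
  shows "ennreal (cap_kernel n u t) = (\<integral>\<^sup>+s. ennreal (cap_profile n u s) * indicator {t<..<pi} s \<partial>lborel)"
proof -
  have "(\<integral>\<^sup>+s. ennreal (cap_profile n u s) * indicator {t<..<pi} s \<partial>lborel)
      = (\<integral>\<^sup>+s. ennreal (indicator {t<..<pi} s * cap_profile n u s) \<partial>lborel)"
    by (intro nn_integral_cong) (auto simp: indicator_def)
  also have "\<dots> = ennreal (cap_kernel n u t)"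
    unfolding cap_kernel_altdef using integrable_cap_profile[OF assms]
    by (intro nn_integral_eq_integral) auto
  finally show ?thesis by simp
qed

lemma cap_kernel_measurable [measurable]: "(\<lambda>u. cap_kernel n u t) \<in> borel_measurable borel"
proof -
  have "(\<lambda>u. LINT s|lborel. indicator {t<..<pi} s * cap_profile n u s) \<in> borel_measurable borel"
    by measurable
  then show ?thesis by (simp add: cap_kernel_altdef)
qed

text \<open>For \<open>-1 < u < 1\<close> and caps of angular radius \<open>r\<close>, so that
  \<open>a = cos r\<close>, one has \<open>u = 2 a^2 - 1 = cos (2 r)\<close>. For
  \<open>t \<le> pi\<close> the hypothesis then reads \<open>t \<ge> 2 r\<close>: the open caps are
  disjoint.\<close>

lemma cap_kernel_eq_0:
  assumes "cos t \<le> u" "0 \<le> t" "n \<ge> 1"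
  shows "cap_kernel n u t = 0"
proof -
  have "indicator {t<..<pi} s * cap_profile n u s = (0::real)" for s
  proof (cases "s \<in> {t<..<pi}")
    case True
    then have "cos s < cos t" using assms by (intro cos_monotone_0_pi) auto
    moreover have "1 + cos s > 0" using True assms by (intro one_plus_cos_pos) auto
    ultimately have "(cos s - u) / (1 + cos s) \<le> 0" using assms by (intro divide_nonpos_pos) auto
    then show ?thesis using \<open>n \<ge> 1\<close> by (simp add: cap_profile_def)
  qed simp
  then show ?thesis unfolding cap_kernel_altdef by (simp only: Bochner_Integration.integral_zero)
qed

lemma cap_kernel_0_pos:
  assumes "-1 < u" "u < 1"
  shows "cap_kernel n u 0 > 0"
proof -
  have a: "0 < arccos u" "arccos u < pi"
    using arccos_less_arccos[of u 1] arccos_less_arccos[of "-1" u] assms by auto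
  have pos: "cap_profile n u s > 0" if "0 < s" "s < arccos u" for s
  proof -
    have "cos (arccos u) < cos s" using that a by (intro cos_monotone_0_pi) auto
    then have "cos s > u" using assms by simp
    moreover have "1 + cos s > 0" using that a by (intro one_plus_cos_pos) auto
    ultimately show ?thesis by (simp add: cap_profile_def)
  qed
  have "cap_kernel n u 0 \<noteq> 0"
  proof
    assume "cap_kernel n u 0 = 0"
    then have "AE s in lborel. indicator {0<..<pi} s * cap_profile n u s = 0"
      using assms integrable_cap_profile[of u 0 n] unfolding cap_kernel_altdef
      by (subst (asm) integral_nonneg_eq_0_iff_AE) auto
    then have "AE s in lborel. s \<notin> {0<..<arccos u}"
      by eventually_elim (use pos a in \<open>force simp: indicator_def split: if_splits\<close>)
    then have "emeasure lborel {0<..<arccos u} = 0"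
      by (subst (asm) AE_iff_measurable[of "{0<..<arccos u}"]) auto
    then show False using a by simp
  qed
  then show ?thesis using cap_kernel_nonneg[of n u 0] by linarith
qed

text \<open>Nonnegativity of the quadratic form comes from caps with \<open>u > -1\<close>, yet the
  mixture contains the kernel for \<open>x\<^sub>0\<close>, which is -1 whenever
  \<open>c \<ge> pi\<close>. This limit closes the gap.\<close>

lemma cap_kernel_tendsto_minus_1:
  assumes "0 \<le> t"
  shows "(\<lambda>k. cap_kernel n (- 1 + 1 / real (Suc k)) t) \<longlonglongrightarrow> cap_kernel n (-1) t"
  unfolding cap_kernel_altdef
proof (rule integral_dominated_convergence[where w = "indicator {t<..<pi}"])
  have "emeasure lborel {t<..<pi} < \<infinity>" by (cases "t \<le> pi") auto
  then show "integrable lborel (indicator {t<..<pi} :: real \<Rightarrow> real)" by simp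
  show "AE s in lborel. (\<lambda>k. indicator {t<..<pi} s * cap_profile n (- 1 + 1 / real (Suc k)) s)
      \<longlonglongrightarrow> indicator {t<..<pi} s * cap_profile n (- 1) s"
  proof (intro AE_I2 tendsto_mult_left)
    fix s
    show "(\<lambda>k. cap_profile n (- 1 + 1 / real (Suc k)) s) \<longlonglongrightarrow> cap_profile n (- 1) s"
    proof (cases "1 + cos s = 0")
      case False
      have "(\<lambda>k. 1 / real (Suc k)) \<longlonglongrightarrow> 0" using LIMSEQ_inverse_real_of_nat by (simp add: inverse_eq_divide)
      then have "(\<lambda>k. max 0 ((cos s - (- 1 + 1 / real (Suc k))) / (1 + cos s)) ^ n)
         \<longlonglongrightarrow> max 0 ((cos s - (- 1 + 0)) / (1 + cos s)) ^ n"
        using False by (intro tendsto_intros) auto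
      then show ?thesis by (simp add: cap_profile_def)
    qed (simp add: cap_profile_def)
  qed
  show "AE s in lborel. norm (indicator {t<..<pi} s * cap_profile n (- 1 + 1 / real (Suc k)) s) \<le> indicator {t<..<pi} s" for k
    using cap_profile_le_1[of "- 1 + 1 / real (Suc k)" n] by (intro AE_I2) (auto simp: indicator_def)
qed auto

text \<open>Dividing Taylor's formula at \<open>x = cos s\<close> by \<open>(1 + cos s) ^ n\<close>
  expresses \<open>(c - s) ^ n\<close> through cap profiles. Integration over \<open>s\<close> from
  \<open>t\<close> to \<open>pi\<close> turns profiles into kernels and leaves the constant
  \<open>max 0 (c - pi) ^ Suc n\<close>, itself a positive semidefinite kernel.\<close>

lemma truncated_power_mixture:
  assumes c: "c > 0" and n: "n \<in> {1, 2, 3}"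
  defines "x\<^sub>0 \<equiv> cos (min c pi)"
  obtains J :: real and D :: "real \<Rightarrow> real" where
    "J \<ge> 0" "D \<in> borel_measurable borel" "\<And>u. x\<^sub>0 < u \<Longrightarrow> u < 1 \<Longrightarrow> D u > 0" "\<And>u. D u \<ge> 0"
    "\<And>u. u \<notin> {x\<^sub>0<..<1} \<Longrightarrow> D u = 0"
    "\<And>t. 0 \<le> t \<Longrightarrow> t \<le> pi \<Longrightarrow> ennreal (max 0 (c - t) ^ Suc n) = ennreal (max 0 (c - pi) ^ Suc n + J * cap_kernel n x\<^sub>0 t)
      + (\<integral>\<^sup>+u. ennreal (D u * cap_kernel n u t) \<partial>lborel)"
proof -
  obtain J D where J: "J \<ge> 0" and D [measurable]: "D \<in> borel_measurable borel"
    and Dpos: "\<And>u. x\<^sub>0 < u \<Longrightarrow> u < 1 \<Longrightarrow> D u > 0" and Dnn: "\<And>u. D u \<ge> 0" and D0: "\<And>u. u \<notin> {x\<^sub>0<..<1} \<Longrightarrow> D u = 0"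
    and taylor: "\<And>x. x\<^sub>0 < x \<Longrightarrow> x < 1 \<Longrightarrow> ennreal (((1 + x) * (c - arccos x)) ^ n) = ennreal (J * (x - x\<^sub>0) ^ n)
      + (\<integral>\<^sup>+u. ennreal (D u * max 0 (x - u) ^ n) \<partial>lborel)"
    by (rule truncated_power_taylor[OF c n, folded x\<^sub>0_def], rule that)
  have n1: "n \<ge> 1" using n by auto
  have x01: "x\<^sub>0 \<ge> -1" by (simp add: x\<^sub>0_def)
  have profile: "ennreal (max 0 (c - s) ^ n) = ennreal (J * cap_profile n x\<^sub>0 s)
      + (\<integral>\<^sup>+u. ennreal (D u * cap_profile n u s) \<partial>lborel)" if s: "0 < s" "s < pi" for s
  proof (cases "s < c")
    case True
    define q where "q = 1 / (1 + cos s) ^ n"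
    have p: "1 + cos s > 0" using s by (intro one_plus_cos_pos) auto
    have q: "q > 0" using p by (simp add: q_def)
    have eq: "cap_profile n u s = q * max 0 (cos s - u) ^ n" for u
    proof -
      have "max 0 ((cos s - u) / (1 + cos s)) = max 0 (cos s - u) / (1 + cos s)"
        using p by (auto simp: max_def divide_le_0_iff zero_le_divide_iff)
      then show ?thesis by (simp add: cap_profile_def q_def power_divide)
    qed
    have x: "x\<^sub>0 < cos s" "cos s < 1"
      unfolding x\<^sub>0_def using cos_monotone_0_pi[of s "min c pi"] cos_monotone_0_pi[of 0 s] True s by auto
    have "max 0 (c - s) ^ n = q * ((1 + cos s) * (c - arccos (cos s))) ^ n"
      using True s p by (simp add: arccos_cos q_def power_mult_distrib)
    then have "ennreal (max 0 (c - s) ^ n) = ennreal q * ennreal (((1 + cos s) * (c - arccos (cos s))) ^ n)"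
      using q by (simp add: ennreal_mult')
    also have "\<dots> = ennreal q * ennreal (J * (cos s - x\<^sub>0) ^ n) + ennreal q * (\<integral>\<^sup>+u. ennreal (D u * max 0 (cos s - u) ^ n) \<partial>lborel)"
      unfolding taylor[OF x] by (rule distrib_left)
    also have "ennreal q * ennreal (J * (cos s - x\<^sub>0) ^ n) = ennreal (J * cap_profile n x\<^sub>0 s)"
      using q x by (simp add: eq mult_ac flip: ennreal_mult')
    also have "ennreal q * (\<integral>\<^sup>+u. ennreal (D u * max 0 (cos s - u) ^ n) \<partial>lborel) = (\<integral>\<^sup>+u. ennreal (D u * cap_profile n u s) \<partial>lborel)"
      using q by (simp add: eq mult_ac nn_integral_cmult[symmetric] flip: ennreal_mult')
    finally show ?thesis .
  next
    case False
    \<comment> \<open>Beyond \<open>c\<close> both sides vanish: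
      \<open>cos s \<le> x\<^sub>0\<close>, while \<open>D\<close> is concentrated above
      \<open>x\<^sub>0\<close>.\<close>
    then have "cos s \<le> x\<^sub>0"
      unfolding x\<^sub>0_def using c s by (intro cos_monotone_0_pi_le) auto
    then have "cap_profile n u s = 0" if "u \<ge> x\<^sub>0" for u
    proof -
      have "1 + cos s > 0" using s by (intro one_plus_cos_pos) auto
      then have "(cos s - u) / (1 + cos s) \<le> 0" using \<open>cos s \<le> x\<^sub>0\<close> that by (intro divide_nonpos_pos) auto
      then show ?thesis using n1 by (simp add: cap_profile_def)
    qed
    then have z: "D u * cap_profile n u s = 0" "cap_profile n x\<^sub>0 s = 0" for u
      using D0[of u] by (cases "u \<ge> x\<^sub>0"; auto)+
    have "(\<integral>\<^sup>+u. ennreal (D u * cap_profile n u s) \<partial>lborel) = (\<integral>\<^sup>+(u::real). 0 \<partial>lborel)"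
      by (rule nn_integral_cong) (simp only: z ennreal_0)
    moreover have "max 0 (c - s) = 0" using False by simp
    ultimately show ?thesis using z(2) n1 by (simp add: power_0_left)
  qed
  have mix: "ennreal (max 0 (c - t) ^ Suc n) = ennreal (max 0 (c - pi) ^ Suc n + (real (Suc n) * J) * cap_kernel n x\<^sub>0 t)
      + (\<integral>\<^sup>+u. ennreal ((real (Suc n) * D u) * cap_kernel n u t) \<partial>lborel)" if t: "0 \<le> t" "t \<le> pi" for t
  proof -
    define N where "N = real (Suc n)"
    have N: "N > 0" by (simp add: N_def)
    have "(\<integral>\<^sup>+s. ennreal (N * max 0 (c - s) ^ n) * indicator {t..pi} s \<partial>lborel)
        = ennreal (- (max 0 (c - pi) ^ Suc n) - - (max 0 (c - t) ^ Suc n))"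
    proof (rule nn_integral_FTC_Icc)
      fix s
      have "DERIV (\<lambda>s. c - s) s :> -1" by (auto intro!: derivative_eq_intros)
      from DERIV_minus[OF DERIV_max_power_Suc[OF this n1]]
      show "DERIV (\<lambda>s. - (max 0 (c - s) ^ Suc n)) s :> N * max 0 (c - s) ^ n" by (simp add: N_def)
    qed (use t N in auto)
    then have "ennreal (max 0 (c - t) ^ Suc n - max 0 (c - pi) ^ Suc n) = (\<integral>\<^sup>+s. ennreal (N * max 0 (c - s) ^ n) * indicator {t..pi} s \<partial>lborel)"
      by simp
    also have "\<dots> = (\<integral>\<^sup>+s. ennreal N * (ennreal (J * cap_profile n x\<^sub>0 s) * indicator {t<..<pi} s
      + (\<integral>\<^sup>+u. ennreal (D u * cap_profile n u s) * indicator {t<..<pi} s \<partial>lborel)) \<partial>lborel)"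
    proof (rule nn_integral_cong_AE)
      have "AE s in lborel. s \<noteq> t" "AE s in lborel. s \<noteq> pi" by (rule AE_lborel_singleton)+
      then show "AE s in lborel. ennreal (N * max 0 (c - s) ^ n) * indicator {t..pi} s
        = ennreal N * (ennreal (J * cap_profile n x\<^sub>0 s) * indicator {t<..<pi} s
      + (\<integral>\<^sup>+u. ennreal (D u * cap_profile n u s) * indicator {t<..<pi} s \<partial>lborel))"
      proof eventually_elim
        case (elim s)
        show ?case
        proof (cases "s \<in> {t<..<pi}")
          case True
          then show ?thesis using N t profile[of s] by (simp add: ennreal_mult')
        next
          case False
          then show ?thesis using elim by (auto simp: indicator_def)
        qed
      qed
    qed
    also have "\<dots> = ennreal N * ((\<integral>\<^sup>+s. ennreal (J * cap_profile n x\<^sub>0 s) * indicator {t<..<pi} s \<partial>lborel)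
      + (\<integral>\<^sup>+s. \<integral>\<^sup>+u. ennreal (D u * cap_profile n u s) * indicator {t<..<pi} s \<partial>lborel \<partial>lborel))"
      by (subst nn_integral_cmult, measurable, subst nn_integral_add, measurable)
    also have "(\<integral>\<^sup>+s. \<integral>\<^sup>+u. ennreal (D u * cap_profile n u s) * indicator {t<..<pi} s \<partial>lborel \<partial>lborel)
       = (\<integral>\<^sup>+u. \<integral>\<^sup>+s. ennreal (D u * cap_profile n u s) * indicator {t<..<pi} s \<partial>lborel \<partial>lborel)"
      by (rule lborel_pair.Fubini') simp
    also have "\<dots> = (\<integral>\<^sup>+u. ennreal (D u * cap_kernel n u t) \<partial>lborel)"
    proof (rule nn_integral_cong)
      fix u
      show "(\<integral>\<^sup>+s. ennreal (D u * cap_profile n u s) * indicator {t<..<pi} s \<partial>lborel) = ennreal (D u * cap_kernel n u t)"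
      proof (cases "u \<in> {x\<^sub>0<..<1}")
        case True
        then have "u \<ge> -1" using x01 by simp
        then show ?thesis using Dnn[of u]
          by (simp add: ennreal_mult' mult.assoc nn_integral_cmult ennreal_cap_kernel)
      qed (simp add: D0)
    qed
    also have "(\<integral>\<^sup>+s. ennreal (J * cap_profile n x\<^sub>0 s) * indicator {t<..<pi} s \<partial>lborel) = ennreal (J * cap_kernel n x\<^sub>0 t)"
      using J x01 by (simp add: ennreal_mult' mult.assoc nn_integral_cmult ennreal_cap_kernel)
    also have "ennreal N * (ennreal (J * cap_kernel n x\<^sub>0 t) + (\<integral>\<^sup>+u. ennreal (D u * cap_kernel n u t) \<partial>lborel))
        = ennreal (N * J * cap_kernel n x\<^sub>0 t) + (\<integral>\<^sup>+u. ennreal (N * D u * cap_kernel n u t) \<partial>lborel)"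
      using N J by (simp add: distrib_left mult.assoc ennreal_mult' nn_integral_cmult Dnn)
    finally have e: "ennreal (max 0 (c - t) ^ Suc n - max 0 (c - pi) ^ Suc n) = \<dots>" .
    have "max 0 (c - pi) ^ Suc n \<le> max 0 (c - t) ^ Suc n" using t by (intro power_mono) auto
    then have "ennreal (max 0 (c - t) ^ Suc n) = ennreal (max 0 (c - pi) ^ Suc n) + ennreal (max 0 (c - t) ^ Suc n - max 0 (c - pi) ^ Suc n)"
      by (subst ennreal_plus[symmetric]) auto
    then show ?thesis
      unfolding e using J by (simp add: N_def add.assoc)
  qed
  show thesis
  \<comment> \<open>The factor \<open>n + 1\<close> from differentiating the truncated power is
    absorbed into the weights.\<close>
  proof (rule that[of "real (Suc n) * J" "\<lambda>u. real (Suc n) * D u"])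
    show "0 \<le> real (Suc n) * J" using J by (intro mult_nonneg_nonneg) auto
    show "(\<lambda>u. real (Suc n) * D u) \<in> borel_measurable borel" by measurable
    show "real (Suc n) * D u > 0" if "x\<^sub>0 < u" "u < 1" for u
      using Dpos[OF that] by (intro mult_pos_pos) auto
    show "real (Suc n) * D u \<ge> 0" for u using Dnn[of u] by (intro mult_nonneg_nonneg) auto
    show "real (Suc n) * D u = 0" if "u \<notin> {x\<^sub>0<..<1}" for u using D0[OF that] by simp
  qed (rule mix)
qed

section \<open>Quadratic forms of mixtures\<close>

text \<open>The products \<open>c i * c j\<close> may be negative and cannot enter a nonnegative
  integral. The finite value \<open>A i j\<close> makes each entry integrable, and then the double
  sum passes under the Bochner integral.\<close>

lemma nn_mixture_quadratic_form:
  fixes c :: "'i \<Rightarrow> real" and A :: "'i \<Rightarrow> 'i \<Rightarrow> real" and K :: "'y \<Rightarrow> 'i \<Rightarrow> 'i \<Rightarrow> real"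
  assumes mix: "\<And>i j. i \<in> I \<Longrightarrow> j \<in> I \<Longrightarrow> ennreal (A i j) = (\<integral>\<^sup>+y. ennreal (K y i j) \<partial>M)"
    and meas: "\<And>i j. i \<in> I \<Longrightarrow> j \<in> I \<Longrightarrow> (\<lambda>y. K y i j) \<in> borel_measurable M"
    and nonneg: "\<And>y i j. i \<in> I \<Longrightarrow> j \<in> I \<Longrightarrow> 0 \<le> K y i j" "\<And>i j. i \<in> I \<Longrightarrow> j \<in> I \<Longrightarrow> 0 \<le> A i j"
  shows "integrable M (\<lambda>y. \<Sum>i\<in>I. \<Sum>j\<in>I. c i * c j * K y i j)"
    and "(\<Sum>i\<in>I. \<Sum>j\<in>I. c i * c j * A i j) = (\<integral>y. (\<Sum>i\<in>I. \<Sum>j\<in>I. c i * c j * K y i j) \<partial>M)"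
proof -
  have int: "integrable M (\<lambda>y. K y i j)" if "i \<in> I" "j \<in> I" for i j
    using that nonneg meas mix[OF that, symmetric] by (intro integrableI_nonneg) auto
  have eq: "A i j = (\<integral>y. K y i j \<partial>M)" if "i \<in> I" "j \<in> I" for i j
  proof -
    have "ennreal (A i j) = ennreal (\<integral>y. K y i j \<partial>M)"
      unfolding mix[OF that] using int that nonneg by (intro nn_integral_eq_integral) auto
    moreover have "0 \<le> (\<integral>y. K y i j \<partial>M)" using nonneg(1)[OF that] by (intro integral_nonneg_AE) auto
    ultimately show ?thesis using nonneg(2)[OF that] by simp
  qed
  show "integrable M (\<lambda>y. \<Sum>i\<in>I. \<Sum>j\<in>I. c i * c j * K y i j)"
    using int by (intro Bochner_Integration.integrable_sum integrable_mult_right)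
  have "(\<Sum>i\<in>I. \<Sum>j\<in>I. c i * c j * A i j) = (\<Sum>i\<in>I. \<Sum>j\<in>I. (\<integral>y. c i * c j * K y i j \<partial>M))"
    using int by (intro sum.cong refl) (simp add: eq)
  also have "\<dots> = (\<integral>y. (\<Sum>i\<in>I. \<Sum>j\<in>I. c i * c j * K y i j) \<partial>M)"
    using int by (subst Bochner_Integration.integral_sum) (auto intro!: sum.cong simp: Bochner_Integration.integral_sum)
  finally show "(\<Sum>i\<in>I. \<Sum>j\<in>I. c i * c j * A i j) = (\<integral>y. (\<Sum>i\<in>I. \<Sum>j\<in>I. c i * c j * K y i j) \<partial>M)" .
qed

lemma integral_pos_on_interval:
  fixes f :: "real \<Rightarrow> real"
  assumes int: "integrable lborel f" and nonneg: "\<And>u. f u \<ge> 0"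
    and pos: "\<And>u. a < u \<Longrightarrow> u < b \<Longrightarrow> f u > 0" and ab: "a < b"
  shows "(LINT u|lborel. f u) > 0"
proof -
  have "(LINT u|lborel. f u) \<noteq> 0"
  proof
    assume "(LINT u|lborel. f u) = 0"
    then have "AE u in lborel. f u = 0"
      using int nonneg by (subst (asm) integral_nonneg_eq_0_iff_AE) auto
    then have "AE u in lborel. u \<notin> {a<..<b}"
      by eventually_elim (use pos in force)
    then have "emeasure lborel {a<..<b} = 0"
      by (subst (asm) AE_iff_measurable[of "{a<..<b}"]) auto
    then show False using ab by simp
  qed
  moreover have "(LINT u|lborel. f u) \<ge> 0" using nonneg by (intro integral_nonneg_AE) auto
  ultimately show ?thesis by linarith
qed

lemma truncated_power_quadratic_form_pos:
  fixes \<theta> :: "'i \<Rightarrow> 'i \<Rightarrow> real" and c :: "'i \<Rightarrow> real"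
  assumes I: "finite I"
    and th: "\<And>i j. i \<in> I \<Longrightarrow> j \<in> I \<Longrightarrow> 0 \<le> \<theta> i j \<and> \<theta> i j \<le> pi"
      "\<And>i. i \<in> I \<Longrightarrow> \<theta> i i = 0" "\<And>i j. i \<in> I \<Longrightarrow> j \<in> I \<Longrightarrow> i \<noteq> j \<Longrightarrow> \<theta> i j > 0"
    and psd: "\<And>u. -1 < u \<Longrightarrow> 0 \<le> (\<Sum>i\<in>I. \<Sum>j\<in>I. c i * c j * cap_kernel n u (\<theta> i j))"
    and c: "i\<^sub>0 \<in> I" "c i\<^sub>0 \<noteq> 0" and n: "n \<in> {1, 2, 3}" and \<tau>: "\<tau> > 0"
  shows "0 < (\<Sum>i\<in>I. \<Sum>j\<in>I. c i * c j * max 0 (\<tau> - \<theta> i j) ^ Suc n)"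
proof -
  define Q where "Q u = (\<Sum>i\<in>I. \<Sum>j\<in>I. c i * c j * cap_kernel n u (\<theta> i j))" for u
  define x\<^sub>0 where "x\<^sub>0 = cos (min \<tau> pi)"
  obtain J D where J: "J \<ge> 0" and D [measurable]: "D \<in> borel_measurable borel"
    and Dpos: "\<And>u. x\<^sub>0 < u \<Longrightarrow> u < 1 \<Longrightarrow> D u > 0" and Dnn: "\<And>u. D u \<ge> 0" and D0: "\<And>u. u \<notin> {x\<^sub>0<..<1} \<Longrightarrow> D u = 0"
    and mix: "\<And>t. 0 \<le> t \<Longrightarrow> t \<le> pi \<Longrightarrow> ennreal (max 0 (\<tau> - t) ^ Suc n) = ennreal (max 0 (\<tau> - pi) ^ Suc n + J * cap_kernel n x\<^sub>0 t)
      + (\<integral>\<^sup>+u. ennreal (D u * cap_kernel n u t) \<partial>lborel)"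
    by (rule truncated_power_mixture[OF \<tau> n, folded x\<^sub>0_def], rule that)
  have n1: "n \<ge> 1" using n by auto
  have Qnn: "Q u \<ge> 0" if "u \<ge> -1" for u
  proof (cases "u = -1")
    case True
    have "(\<lambda>k. Q (- 1 + 1 / real (Suc k))) \<longlonglongrightarrow> Q (-1)"
      unfolding Q_def using th(1) by (intro tendsto_sum tendsto_mult_left cap_kernel_tendsto_minus_1) auto
    moreover have "0 \<le> Q (- 1 + 1 / real (Suc k))" for k
      unfolding Q_def by (rule psd) simp
    ultimately show ?thesis unfolding True by (intro LIMSEQ_le_const) auto
  qed (use that psd[of u] in \<open>auto simp: Q_def\<close>)
  have x0: "-1 \<le> x\<^sub>0" "x\<^sub>0 < 1"
    unfolding x\<^sub>0_def using cos_monotone_0_pi[of 0 "min \<tau> pi"] \<tau> by auto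
  \<comment> \<open>The mixture integral is finite, being a summand of a real number, so it can be
    treated as a real and multiplied by signed coefficients.\<close>
  define W where "W i j = enn2real (\<integral>\<^sup>+u. ennreal (D u * cap_kernel n u (\<theta> i j)) \<partial>lborel)" for i j
  have W: "ennreal (W i j) = (\<integral>\<^sup>+u. ennreal (D u * cap_kernel n u (\<theta> i j)) \<partial>lborel)"
    and BW: "max 0 (\<tau> - \<theta> i j) ^ Suc n = max 0 (\<tau> - pi) ^ Suc n + J * cap_kernel n x\<^sub>0 (\<theta> i j) + W i j"
    if ij: "i \<in> I" "j \<in> I" for i j
  proof -
    note m = mix[of "\<theta> i j"]
    have "(\<integral>\<^sup>+u. ennreal (D u * cap_kernel n u (\<theta> i j)) \<partial>lborel) \<noteq> top"
      using m th(1)[OF ij] by (metis ennreal_add_eq_top ennreal_neq_top)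
    then show W: "ennreal (W i j) = (\<integral>\<^sup>+u. ennreal (D u * cap_kernel n u (\<theta> i j)) \<partial>lborel)"
      unfolding W_def by (simp add: less_top)
    have nn: "W i j \<ge> 0" "max 0 (\<tau> - pi) ^ Suc n + J * cap_kernel n x\<^sub>0 (\<theta> i j) \<ge> 0" "max 0 (\<tau> - \<theta> i j) ^ Suc n \<ge> 0"
      using J by (auto simp: W_def)
    have "ennreal (max 0 (\<tau> - \<theta> i j) ^ Suc n) = ennreal (max 0 (\<tau> - pi) ^ Suc n + J * cap_kernel n x\<^sub>0 (\<theta> i j) + W i j)"
      using m th(1)[OF ij] nn unfolding W[symmetric] by (simp only: ennreal_plus[OF nn(2,1)])
    then show "max 0 (\<tau> - \<theta> i j) ^ Suc n = max 0 (\<tau> - pi) ^ Suc n + J * cap_kernel n x\<^sub>0 (\<theta> i j) + W i j"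
      using nn by (subst (asm) ennreal_inj) auto
  qed
  have QD: "(\<Sum>i\<in>I. \<Sum>j\<in>I. c i * c j * (D u * cap_kernel n u (\<theta> i j))) = D u * Q u" for u
    by (simp add: Q_def sum_distrib_left mult_ac)
  have int: "integrable lborel (\<lambda>u. D u * Q u)"
    and Wint: "(\<Sum>i\<in>I. \<Sum>j\<in>I. c i * c j * W i j) = (LINT u|lborel. D u * Q u)"
    using nn_mixture_quadratic_form[where I = I and A = W and M = lborel and c = c and K = "\<lambda>u i j. D u * cap_kernel n u (\<theta> i j)"] W Dnn
    by (auto simp: QD W_def)
  have "(\<Sum>i\<in>I. \<Sum>j\<in>I. c i * c j * max 0 (\<tau> - \<theta> i j) ^ Suc n)
      = (\<Sum>i\<in>I. \<Sum>j\<in>I. c i * c j * max 0 (\<tau> - pi) ^ Suc n + J * (c i * c j * cap_kernel n x\<^sub>0 (\<theta> i j)) + c i * c j * W i j)"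
    using BW by (intro sum.cong refl) (simp add: algebra_simps)
  also have "\<dots> = (\<Sum>i\<in>I. c i)\<^sup>2 * max 0 (\<tau> - pi) ^ Suc n + J * Q x\<^sub>0 + (\<Sum>i\<in>I. \<Sum>j\<in>I. c i * c j * W i j)"
  proof -
    have "(\<Sum>i\<in>I. \<Sum>j\<in>I. c i * c j * k) = (\<Sum>i\<in>I. c i)\<^sup>2 * k" for k
      unfolding power2_eq_square sum_product by (simp only: sum_distrib_right)
    then show ?thesis by (simp add: sum.distrib Q_def sum_distrib_left del: power_Suc)
  qed
  finally have eq: "(\<Sum>i\<in>I. \<Sum>j\<in>I. c i * c j * max 0 (\<tau> - \<theta> i j) ^ Suc n)
      = (\<Sum>i\<in>I. c i)\<^sup>2 * max 0 (\<tau> - pi) ^ Suc n + J * Q x\<^sub>0 + (LINT u|lborel. D u * Q u)"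
    unfolding Wint .
  \<comment> \<open>Above \<mu> all off-diagonal kernels vanish, and \<open>Q u\<close> is the sum
    of the squares \<open>(c i)^2\<close> times a positive number. Inserting
    \<open>x\<^sub>0\<close> keeps the set nonempty when \<open>I\<close> has one element and puts
    \<open>(\<mu>, 1)\<close> where \<open>D\<close> is positive.\<close>
  define \<mu> where "\<mu> = Max (insert x\<^sub>0 ((\<lambda>(i, j). cos (\<theta> i j)) ` {(i, j). i \<in> I \<and> j \<in> I \<and> i \<noteq> j}))"
  have finS: "finite {(i, j). i \<in> I \<and> j \<in> I \<and> i \<noteq> j}"
    by (rule finite_subset[of _ "I \<times> I"]) (use I in auto)
  have mu: "x\<^sub>0 \<le> \<mu>" "\<mu> < 1" "\<And>i j. i \<in> I \<Longrightarrow> j \<in> I \<Longrightarrow> i \<noteq> j \<Longrightarrow> cos (\<theta> i j) \<le> \<mu>"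
  proof -
    show "x\<^sub>0 \<le> \<mu>" unfolding \<mu>_def using finS by (intro Max_ge) auto
    have "cos (\<theta> i j) < 1" if "i \<in> I" "j \<in> I" "i \<noteq> j" for i j
      using cos_monotone_0_pi[of 0 "\<theta> i j"] th(1)[of i j] th(3)[of i j] that by auto
    then show "\<mu> < 1" unfolding \<mu>_def using finS x0 by (subst Max_less_iff) auto
    show "cos (\<theta> i j) \<le> \<mu>" if "i \<in> I" "j \<in> I" "i \<noteq> j" for i j
      unfolding \<mu>_def using finS that by (intro Max_ge) auto
  qed
  have "(LINT u|lborel. D u * Q u) > 0"
  proof (rule integral_pos_on_interval[OF int])
    show "0 \<le> D u * Q u" for u
    proof (cases "u \<in> {x\<^sub>0<..<1}")
      case True
      then show ?thesis using Dnn Qnn[of u] x0 by simp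
    qed (simp add: D0)
    show "\<mu> < 1" by (rule mu)
    fix u assume u: "\<mu> < u" "u < 1"
    have "cap_kernel n u (\<theta> i j) = (if i = j then cap_kernel n u 0 else 0)" if "i \<in> I" "j \<in> I" for i j
      using that th mu(3)[OF that] u n1 by (auto intro!: cap_kernel_eq_0)
    then have "Q u = (\<Sum>i\<in>I. \<Sum>j\<in>I. if j = i then c i * c i * cap_kernel n u 0 else 0)"
      unfolding Q_def by (intro sum.cong refl) auto
    also have "\<dots> = (\<Sum>i\<in>I. (c i)\<^sup>2) * cap_kernel n u 0"
      using I by (simp add: sum_distrib_right power2_eq_square)
    also have "\<dots> > 0"
    proof (rule mult_pos_pos)
      show "(\<Sum>i\<in>I. (c i)\<^sup>2) > 0" using I c by (intro sum_pos2[of _ i\<^sub>0]) auto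
      show "cap_kernel n u 0 > 0" using u mu x0 by (intro cap_kernel_0_pos) auto
    qed
    finally show "0 < D u * Q u" using Dpos[of u] u mu by simp
  qed
  moreover have "(\<Sum>i\<in>I. c i)\<^sup>2 * max 0 (\<tau> - pi) ^ Suc n \<ge> 0" "J * Q x\<^sub>0 \<ge> 0"
    using J Qnn[of x\<^sub>0] x0 by auto
  ultimately show ?thesis unfolding eq by linarith
qed

section \<open>Mixtures of truncated powers\<close>

text \<open>If the derivative of some order eventually stays above \<epsilon>, the one of the next
  lower order grows at least linearly and eventually exceeds \<epsilon> as well. Descending to order
  0 contradicts the limit 0. The factor \<sigma> covers bounds of either sign.\<close>

lemma higher_deriv_not_bounded_below:
  fixes \<phi> :: "real \<Rightarrow> real"
  assumes lim: "(\<phi> \<longlongrightarrow> 0) at_top" and \<epsilon>: "\<epsilon> > 0"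
    and diff: "\<And>i t. i < k \<Longrightarrow> t > 0 \<Longrightarrow> (deriv ^^ i) \<phi> field_differentiable at t"
    and bound: "\<forall>\<^sub>F t in at_top. \<sigma> * (deriv ^^ k) \<phi> t \<ge> \<epsilon>"
  shows False
  using diff bound
proof (induction k)
  case 0
  have "((\<lambda>t. \<sigma> * \<phi> t) \<longlongrightarrow> \<sigma> * 0) at_top" by (intro tendsto_intros lim)
  then have "\<forall>\<^sub>F t in at_top. \<sigma> * \<phi> t < \<epsilon>" using \<epsilon> by (intro order_tendstoD) auto
  then have "\<forall>\<^sub>F t in at_top :: real filter. False"
    using 0(2) by eventually_elim simp
  then show False by simp
next
  case (Suc k)
  define f where "f = (deriv ^^ k) \<phi>"
  have df: "DERIV f t :> deriv f t" if "t > 0" for t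
    using Suc.prems(1)[of k t] that by (simp add: f_def DERIV_deriv_iff_field_differentiable)
  obtain T where T: "\<And>t. t \<ge> T \<Longrightarrow> \<sigma> * deriv f t \<ge> \<epsilon>"
    using Suc.prems(2) by (auto simp: eventually_at_top_linorder f_def)
  define T' where "T' = max T 1"
  have grow: "\<sigma> * f t \<ge> \<sigma> * f T' + \<epsilon> * (t - T')" if t: "t > T'" for t
  proof -
    have "\<exists>z>T'. z < t \<and> \<sigma> * f t - \<sigma> * f T' = (t - T') * (\<sigma> * deriv f z)"
      using t df by (intro MVT2[of T' t "\<lambda>t. \<sigma> * f t" "\<lambda>z. \<sigma> * deriv f z"]) (auto intro!: DERIV_cmult simp: T'_def)
    then obtain z where z: "z > T'" "\<sigma> * f t - \<sigma> * f T' = (t - T') * (\<sigma> * deriv f z)" by blast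
    have "(t - T') * \<epsilon> \<le> (t - T') * (\<sigma> * deriv f z)"
      using t z T[of z] by (intro mult_left_mono) (auto simp: T'_def)
    then show ?thesis using z(2) by (simp add: mult.commute)
  qed
  have "\<forall>\<^sub>F t in at_top. \<epsilon> \<le> \<sigma> * f T' + \<epsilon> * (t - T')"
    using eventually_ge_at_top[of "T' + (\<epsilon> + \<bar>\<sigma> * f T'\<bar>) / \<epsilon>"]
  proof eventually_elim
    case (elim t)
    have "\<epsilon> + \<bar>\<sigma> * f T'\<bar> = \<epsilon> * ((\<epsilon> + \<bar>\<sigma> * f T'\<bar>) / \<epsilon>)" using \<epsilon> by simp
    also have "\<dots> \<le> \<epsilon> * (t - T')" using elim \<epsilon> by (intro mult_left_mono) auto
    finally show ?case by linarith
  qed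
  then have "\<forall>\<^sub>F t in at_top. \<epsilon> \<le> \<sigma> * f t"
    using eventually_gt_at_top[of T'] by eventually_elim (use grow in force)
  then show False
    using Suc.IH Suc.prems(1) unfolding f_def by simp
qed

text \<open>A nonincreasing function that takes a negative value stays below it, and a nonnegative
  one that fails to tend to 0 stays above a positive constant. Both are excluded by the preceding
  lemma, the first with \<open>- \<sigma>\<close>.\<close>

lemma antimono_imp_nonneg_tendsto_0:
  fixes \<phi> :: "real \<Rightarrow> real"
  assumes lim: "(\<phi> \<longlongrightarrow> 0) at_top"
    and diff: "\<And>i t. i < k \<Longrightarrow> t > 0 \<Longrightarrow> (deriv ^^ i) \<phi> field_differentiable at t"
    and anti: "\<And>s t. 0 < s \<Longrightarrow> s \<le> t \<Longrightarrow> \<sigma> * (deriv ^^ k) \<phi> t \<le> \<sigma> * (deriv ^^ k) \<phi> s"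
  shows "\<And>t. t > 0 \<Longrightarrow> \<sigma> * (deriv ^^ k) \<phi> t \<ge> 0"
    and "((\<lambda>t. \<sigma> * (deriv ^^ k) \<phi> t) \<longlongrightarrow> 0) at_top"
proof -
  show nonneg: "\<sigma> * (deriv ^^ k) \<phi> t \<ge> 0" if t: "t > 0" for t
  proof (rule ccontr)
    assume neg: "\<not> ?thesis"
    have "\<forall>\<^sub>F s in at_top. (- \<sigma>) * (deriv ^^ k) \<phi> s \<ge> - (\<sigma> * (deriv ^^ k) \<phi> t)"
      using eventually_ge_at_top[of t] by eventually_elim (use anti[OF t] in auto)
    then show False
      using neg by (intro higher_deriv_not_bounded_below[OF lim _ diff, of "- (\<sigma> * (deriv ^^ k) \<phi> t)" k "- \<sigma>"]) auto
  qed
  show "((\<lambda>t. \<sigma> * (deriv ^^ k) \<phi> t) \<longlongrightarrow> 0) at_top"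
  proof (rule tendstoI)
    fix e :: real assume e: "e > 0"
    have "\<exists>t>0. \<sigma> * (deriv ^^ k) \<phi> t < e"
    proof (rule ccontr)
      assume "\<not> ?thesis"
      then have ge: "\<sigma> * (deriv ^^ k) \<phi> s \<ge> e" if "s > 0" for s using that by force
      have "\<forall>\<^sub>F s in at_top. \<sigma> * (deriv ^^ k) \<phi> s \<ge> e"
        using eventually_gt_at_top[of 0] by eventually_elim (rule ge)
      then show False using higher_deriv_not_bounded_below[OF lim e diff] by blast
    qed
    then obtain t where t: "t > 0" "\<sigma> * (deriv ^^ k) \<phi> t < e" by blast
    show "\<forall>\<^sub>F s in at_top. dist (\<sigma> * (deriv ^^ k) \<phi> s) 0 < e"
      using eventually_ge_at_top[of t]
    proof eventually_elim
      case (elim s)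
      then show ?case using anti[OF t(1) elim] t nonneg[of s] by simp
    qed
  qed
qed

text \<open>A convex function that increases from \<open>s\<close> to \<open>t\<close> lies above
  the prolonged chord beyond \<open>t\<close>, so it grows linearly, which the limit of \<phi>
  forbids.\<close>

lemma convex_imp_antimono:
  fixes \<phi> :: "real \<Rightarrow> real"
  assumes lim: "(\<phi> \<longlongrightarrow> 0) at_top"
    and diff: "\<And>i t. i < k \<Longrightarrow> t > 0 \<Longrightarrow> (deriv ^^ i) \<phi> field_differentiable at t"
    and conv: "convex_on {0<..} (\<lambda>t. \<sigma> * (deriv ^^ k) \<phi> t)"
    and st: "0 < s" "s \<le> t"
  shows "\<sigma> * (deriv ^^ k) \<phi> t \<le> \<sigma> * (deriv ^^ k) \<phi> s"
proof (rule ccontr)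
  define f where "f t = \<sigma> * (deriv ^^ k) \<phi> t" for t
  assume "\<not> ?thesis"
  then have less: "f s < f t" and "s < t" using st by (auto simp: f_def intro: le_neq_trans)
  define m where "m = (f t - f s) / (t - s)"
  have m: "m > 0" using less \<open>s < t\<close> by (simp add: m_def)
  have grow: "f t + m * (r - t) \<le> f r" if "r > t" for r
  proof -
    have "(f s - f t) / (s - t) \<le> (f t - f r) / (t - r)"
      using convex_on_slope_le[of "{0<..}" f s r t] conv[folded f_def] st \<open>s < t\<close> that by auto
    then have "m \<le> (f r - f t) / (r - t)"
      unfolding m_def by (metis minus_diff_eq minus_divide_divide)
    then show ?thesis using that by (simp add: pos_le_divide_eq)
  qed
  have "\<forall>\<^sub>F r in at_top. f r \<ge> 1"
    using eventually_gt_at_top[of t] eventually_ge_at_top[of "t + (1 + \<bar>f t\<bar>) / m"]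
  proof eventually_elim
    case (elim r)
    have "1 + \<bar>f t\<bar> = m * ((1 + \<bar>f t\<bar>) / m)" using m by simp
    also have "\<dots> \<le> m * (r - t)" using elim m by (intro mult_left_mono) auto
    finally show ?case using grow[of r] elim by linarith
  qed
  then show False
    unfolding f_def using higher_deriv_not_bounded_below[OF lim _ diff, of 1 k \<sigma>] by auto
qed


section \<open>Convex decreasing functions as mixtures of truncated lines\<close>

text \<open>For \<open>y \<ge> 0\<close> the set where \<open>f\<close> exceeds \<open>y\<close>
  lies in the positive half-line, where monotonicity makes it an interval; for \<open>y < 0\<close>
  it is everything.\<close>

lemma borel_measurable_antimono:
  fixes f :: "real \<Rightarrow> real"
  assumes anti: "\<And>s t. 0 < s \<Longrightarrow> s \<le> t \<Longrightarrow> f t \<le> f s"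
    and nonneg: "\<And>s. 0 \<le> f s" and zero: "\<And>s. s \<le> 0 \<Longrightarrow> f s = 0"
  shows "f \<in> borel_measurable borel"
proof (rule borel_measurableI_greater)
  fix y
  have "{s. y < f s} \<in> sets borel"
  proof (cases "y < 0")
    case True
    then have "{s. y < f s} = UNIV" using nonneg by (auto intro: less_le_trans)
    then show ?thesis by simp
  next
    case False
    have "is_interval {s. y < f s}"
      unfolding is_interval_1
    proof (intro ballI allI impI)
      fix a b x assume ab: "a \<in> {s. y < f s}" "b \<in> {s. y < f s}" and x: "a \<le> x \<and> x \<le> b"
      have "a > 0" using ab False zero[of a] by force
      then show "x \<in> {s. y < f s}" using anti[of x b] ab x by auto
    qed
    then show ?thesis by (rule real_interval_borel_measurable)
  qed
  then show "{s \<in> space borel. y < f s} \<in> sets borel" by simp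
qed

text \<open>The density \<open>m\<close> is the negative of the right derivative of \<open>f\<close>.\<close>
lemma convex_antimono_density:
  fixes f :: "real \<Rightarrow> real"
  assumes conv: "convex_on {0<..} f"
    and anti: "\<And>s t. 0 < s \<Longrightarrow> s \<le> t \<Longrightarrow> f t \<le> f s"
    and nonneg: "\<And>t. t > 0 \<Longrightarrow> 0 \<le> f t" and lim: "(f \<longlongrightarrow> 0) at_top"
  obtains m :: "real \<Rightarrow> real" where
    "m \<in> borel_measurable borel" "\<And>s. 0 \<le> m s" "\<And>s. s \<le> 0 \<Longrightarrow> m s = 0"
    "\<And>s t. 0 < s \<Longrightarrow> s \<le> t \<Longrightarrow> m t \<le> m s" "(m \<longlongrightarrow> 0) at_top"
    "\<And>t. t > 0 \<Longrightarrow> ennreal (f t) = (\<integral>\<^sup>+s. ennreal (m s) * indicator {t..} s \<partial>lborel)"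
proof -
  \<comment> \<open>By convexity these slopes decrease in \<open>b\<close>, so their supremum is the
    one-sided limit at \<open>s\<close>. It exists at every \<open>s > 0\<close>, also where
    \<open>f\<close> has a kink.\<close>
  define S where "S s = (\<lambda>b. (f s - f b) / (b - s)) ` {s<..}" for s
  define m where "m s = (if s > 0 then Sup (S s) else 0)" for s
  have slopes: "(f s - f b) / (b - s) \<le> (f a - f s) / (s - a)" if "0 < a" "a < s" "s < b" for a s b
  proof -
    have "(f a - f s) / (a - s) \<le> (f s - f b) / (s - b)"
      using convex_on_slope_le[OF conv, of a b s] that by auto
    then show ?thesis
      using minus_divide_left[of "f a - f s" "s - a"] minus_divide_left[of "f s - f b" "b - s"]
      by (metis minus_diff_eq minus_divide_right neg_le_iff_le)
  qed
  have S_ne: "S s \<noteq> {}" for s by (auto simp: S_def)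
  have upper: "m s \<le> (f a - f s) / (s - a)" if "0 < a" "a < s" for a s
    using slopes[OF that] that S_ne by (auto simp: m_def S_def intro!: cSup_least)
  have S_bdd: "bdd_above (S s)" if "0 < s" for s
    using slopes[of "s / 2" s] that by (auto simp: S_def intro!: bdd_aboveI[of _ "(f (s / 2) - f s) / (s - s / 2)"])
  have lower: "(f s - f b) / (b - s) \<le> m s" if "0 < s" "s < b" for s b
    using that S_bdd[of s] by (auto simp: m_def S_def intro!: cSup_upper)
  have m_nonneg: "0 \<le> m s" for s
  proof (cases "s > 0")
    case True
    have "0 \<le> (f s - f (s + 1)) / (s + 1 - s)" using anti[of s "s + 1"] True by simp
    also have "\<dots> \<le> m s" using lower[of s "s + 1"] True by simp
    finally show ?thesis .
  qed (simp add: m_def)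
  have m_anti: "m t \<le> m s" if "0 < s" "s \<le> t" for s t
  proof (cases "s = t")
    case False
    then show ?thesis using upper[of s t] lower[of s t] that by linarith
  qed simp
  have m_zero: "m s = 0" if "s \<le> 0" for s using that by (simp add: m_def)
  have m_meas [measurable]: "m \<in> borel_measurable borel"
    by (rule borel_measurable_antimono[OF m_anti m_nonneg m_zero])
  have m_lim: "(m \<longlongrightarrow> 0) at_top"
  proof (rule tendsto_sandwich)
    show "\<forall>\<^sub>F s in at_top. 0 \<le> m s" by (simp add: m_nonneg)
    show "\<forall>\<^sub>F s in at_top. m s \<le> f (s - 1)"
      using eventually_gt_at_top[of 1]
    proof eventually_elim
      case (elim s)
      then show ?case using upper[of "s - 1" s] nonneg[of s] by simp
    qed
    have "filterlim (\<lambda>s::real. s - 1) at_top at_top"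
      unfolding filterlim_at_top
    proof
      fix Z :: real
      show "\<forall>\<^sub>F s in at_top. Z \<le> s - 1"
        using eventually_ge_at_top[of "Z + 1"] by eventually_elim simp
    qed
    then show "((\<lambda>s. f (s - 1)) \<longlongrightarrow> 0) at_top"
      by (rule filterlim_compose[OF lim])
  qed auto
  have int: "integrable lborel (\<lambda>s. indicator {a..b} s * m s)" if "0 < a" for a b
  proof -
    have "emeasure lborel {a..b} < \<infinity>" by (cases "a \<le> b") auto
    then have "integrable lborel (\<lambda>s. indicator {a..b} s *\<^sub>R m s)"
      using m_anti[OF that] m_nonneg by (intro integrableI_bounded_set_indicator[where B = "m a"]) auto
    then show ?thesis by simp
  qed
  define I where "I a b = integral {a..b} m" for a b
  have intm: "m integrable_on {a..b}" if "0 < a" for a b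
    using int[OF that, of b] set_borel_integral_eq_integral(1)[of "{a..b}" m]
    by (simp add: set_integrable_def)
  txt \<open>The defect \<open>E\<close> of the fundamental theorem is additive, and quadratically small on short intervals.\<close>
  define E where "E a b = f a - f b - I a b" for a b
  have Ebound: "\<bar>E a b\<bar> \<le> (m a - m b) * (b - a)" if ab: "0 < a" "a < b" for a b
  proof -
    have "m b * (b - a) \<le> f a - f b" "f a - f b \<le> m a * (b - a)"
      using upper[OF ab] lower[OF ab] ab by (auto simp: field_simps)
    moreover have "m b * (b - a) \<le> I a b"
    proof -
      have "integral {a..b} (\<lambda>_. m b) \<le> I a b"
        unfolding I_def using ab m_anti by (intro integral_le intm) auto
      then show ?thesis using ab by (simp add: mult.commute)
    qed
    moreover have "I a b \<le> m a * (b - a)"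
    proof -
      have "I a b \<le> integral {a..b} (\<lambda>_. m a)"
        unfolding I_def using ab m_anti by (intro integral_le intm) auto
      then show ?thesis using ab by (simp add: mult.commute)
    qed
    ultimately show ?thesis by (simp add: E_def abs_le_iff left_diff_distrib)
  qed
  have E0: "E a b = 0" if ab: "0 < a" "a < b" for a b
  proof -
    have bound: "\<bar>E a b\<bar> \<le> (m a - m b) * (b - a) * (1 / real (Suc N))" for N
    proof -
      define h where "h = (b - a) / real (Suc N)"
      define p where "p i = a + real i * h" for i
      have h: "h > 0" using ab by (simp add: h_def)
      have p0: "p 0 = a" and pN: "p (Suc N) = b"
        by (simp_all add: p_def h_def del: of_nat_Suc)
      have p: "0 < p i" "p i < p (Suc i)" "p (Suc i) - p i = h" for i
        using h ab by (auto simp: p_def algebra_simps intro!: add_pos_nonneg)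
      have split: "E a (p (Suc k)) = (\<Sum>i\<le>k. E (p i) (p (Suc i)))" for k
      proof (induction k)
        case 0
        then show ?case by (simp add: p0)
      next
        case (Suc k)
        have "a \<le> p (Suc k)" using h by (simp add: p_def)
        then have "I a (p (Suc (Suc k))) = I a (p (Suc k)) + I (p (Suc k)) (p (Suc (Suc k)))"
          unfolding I_def using p(2)[of "Suc k"] ab
          by (intro Henstock_Kurzweil_Integration.integral_combine[symmetric] intm) auto
        then have "E a (p (Suc (Suc k))) = E a (p (Suc k)) + E (p (Suc k)) (p (Suc (Suc k)))"
          by (simp add: E_def)
        then show ?case using Suc by simp
      qed
      have "\<bar>E a b\<bar> \<le> (\<Sum>i\<le>N. \<bar>E (p i) (p (Suc i))\<bar>)"
        unfolding pN[symmetric] split by (rule sum_abs)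
      also have "\<dots> \<le> (\<Sum>i\<le>N. (m (p i) - m (p (Suc i))) * h)"
        using Ebound[OF p(1,2)] unfolding p(3) by (intro sum_mono)
      \<comment> \<open>For \<open>N + 1\<close> equal pieces the bounds telescope to
        \<open>(m a - m b) * (b - a) / (N + 1)\<close>, which is arbitrarily small.\<close>
      also have "\<dots> = (m (p 0) - m (p (Suc N))) * h"
        using sum_telescope[of "\<lambda>i. m (p i)" N] by (simp add: sum_distrib_right[symmetric])
      finally show ?thesis unfolding p0 pN by (simp add: h_def)
    qed
    have "(\<lambda>N. (m a - m b) * (b - a) * (1 / real (Suc N))) \<longlonglongrightarrow> (m a - m b) * (b - a) * 0"
      using LIMSEQ_inverse_real_of_nat by (intro tendsto_mult_left) (simp add: inverse_eq_divide)
    then have "\<bar>E a b\<bar> \<le> (m a - m b) * (b - a) * 0"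
      by (rule LIMSEQ_le_const) (use bound in auto)
    then show ?thesis by simp
  qed
  have fin: "(\<integral>\<^sup>+s. ennreal (m s) * indicator {a..b} s \<partial>lborel) = ennreal (f a - f b)" if ab: "0 < a" "a < b" for a b
  proof -
    have "(\<integral>\<^sup>+s. ennreal (m s) * indicator {a..b} s \<partial>lborel) = (\<integral>\<^sup>+s. ennreal (indicator {a..b} s * m s) \<partial>lborel)"
      by (intro nn_integral_cong) (auto simp: indicator_def)
    also have "\<dots> = ennreal (LINT s|lborel. indicator {a..b} s * m s)"
      using int[OF ab(1)] m_nonneg by (intro nn_integral_eq_integral) auto
    also have "(LINT s|lborel. indicator {a..b} s * m s) = I a b"
      using set_borel_integral_eq_integral(2)[of "{a..b}" m] int[OF ab(1)]
      by (simp add: I_def set_integrable_def set_lebesgue_integral_def)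
    finally show ?thesis using E0[OF ab] by (simp add: E_def)
  qed
  have dens: "ennreal (f t) = (\<integral>\<^sup>+s. ennreal (m s) * indicator {t..} s \<partial>lborel)" if t: "t > 0" for t
  proof -
    have "(\<lambda>k. \<integral>\<^sup>+s. ennreal (m s) * indicator {t..t + real (Suc k)} s \<partial>lborel)
        \<longlonglongrightarrow> (\<integral>\<^sup>+s. ennreal (m s) * indicator {t..} s \<partial>lborel)"
    proof (rule nn_integral_LIMSEQ)
      show "incseq (\<lambda>k s. ennreal (m s) * indicator {t..t + real (Suc k)} s)"
        by (auto simp: incseq_def le_fun_def indicator_def)
      fix s
      have "\<forall>\<^sub>F k in sequentially. ennreal (m s) * indicator {t..t + real (Suc k)} s = ennreal (m s) * indicator {t..} s"
        using eventually_ge_at_top[of "nat \<lceil>s - t\<rceil>"]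
      proof eventually_elim
        case (elim k)
        then have "s - t \<le> real k" by linarith
        then show ?case by (auto simp: indicator_def)
      qed
      then show "(\<lambda>k. ennreal (m s) * indicator {t..t + real (Suc k)} s) \<longlonglongrightarrow> ennreal (m s) * indicator {t..} s"
        by (rule tendsto_eventually)
    qed auto
    moreover have "(\<integral>\<^sup>+s. ennreal (m s) * indicator {t..t + real (Suc k)} s \<partial>lborel) = ennreal (f t - f (t + real (Suc k)))" for k
      using t by (intro fin) auto
    moreover have "(\<lambda>k. ennreal (f t - f (t + real (Suc k)))) \<longlonglongrightarrow> ennreal (f t - 0)"
    proof (intro tendsto_intros tendsto_ennrealI filterlim_compose[OF lim])
      have "filterlim (\<lambda>k. t + real k) at_top sequentially"
        by (intro filterlim_tendsto_add_at_top[OF tendsto_const] filterlim_real_sequentially)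
      then show "filterlim (\<lambda>k. t + real (Suc k)) at_top sequentially"
        by (subst filterlim_sequentially_Suc)
    qed
    ultimately show ?thesis using LIMSEQ_unique by fastforce
  qed
  show thesis
    by (rule that[OF m_meas m_nonneg m_zero m_anti m_lim dens])
qed


text \<open>The natural mixing measure is the Stieltjes measure of \<open>- m\<close>. The
  generalized inverse \<tau> of \<open>m\<close> presents it on \<open>(0, \<infinity>)\<close> as
  an image of Lebesgue measure, so all mixtures remain integrals over \<open>lborel\<close>; points
  with \<open>\<tau> y = 0\<close> contribute nothing.\<close>

lemma convex_layer_cake:
  fixes f :: "real \<Rightarrow> real"
  assumes conv: "convex_on {0<..} f"
    and anti: "\<And>s t. 0 < s \<Longrightarrow> s \<le> t \<Longrightarrow> f t \<le> f s"
    and nonneg: "\<And>t. t > 0 \<Longrightarrow> 0 \<le> f t" and lim: "(f \<longlongrightarrow> 0) at_top"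
  obtains \<tau> :: "real \<Rightarrow> real" where "\<tau> \<in> borel_measurable borel" "\<And>y. 0 \<le> \<tau> y"
    "\<And>t. t > 0 \<Longrightarrow> ennreal (f t) = (\<integral>\<^sup>+y. ennreal (max 0 (\<tau> y - t)) \<partial>lborel)"
proof -
  obtain m where [measurable]: "m \<in> borel_measurable borel" and m_nonneg: "\<And>s. 0 \<le> m s"
    and m_zero: "\<And>s. s \<le> 0 \<Longrightarrow> m s = 0"
    and m_anti: "\<And>s t. 0 < s \<Longrightarrow> s \<le> t \<Longrightarrow> m t \<le> m s" and m_lim: "(m \<longlongrightarrow> 0) at_top"
    and dens: "\<And>t. t > 0 \<Longrightarrow> ennreal (f t) = (\<integral>\<^sup>+s. ennreal (m s) * indicator {t..} s \<partial>lborel)"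
    by (rule convex_antimono_density[OF conv _ _ lim], erule (1) anti, erule nonneg, rule that)
  txt \<open>Layer cake: \<open>m s\<close> is the length of \<open>{y. 0 < y < m s}\<close>, and \<open>y < m s\<close> means \<open>s < \<tau> y\<close> up to null sets.\<close>
  define S where "S y = insert 0 {s. s > 0 \<and> y < m s}" for y
  define \<tau> where "\<tau> y = (if y > 0 then Sup (S y) else 0)" for y
  have bdd: "bdd_above (S y)" if y: "y > 0" for y
  proof -
    obtain T where "\<And>s. s \<ge> T \<Longrightarrow> m s < y"
      using order_tendstoD(2)[OF m_lim y] by (auto simp: eventually_at_top_linorder)
    then have "x \<le> max 0 T" if "x \<in> S y" for x
      using that by (cases "x \<ge> T") (auto simp: S_def dest: less_asym)
    then show ?thesis by (rule bdd_aboveI)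
  qed
  have in_S: "s \<le> \<tau> y" if "y > 0" "s > 0" "y < m s" for s y
    using that bdd[of y] by (auto simp: \<tau>_def S_def intro!: cSup_upper)
  have S_in: "y < m s" if y: "y > 0" and "s > 0" "s < \<tau> y" for s y
  proof -
    have "s < Sup (S y)" using that by (simp add: \<tau>_def)
    moreover have "S y \<noteq> {}" by (simp add: S_def)
    ultimately obtain r where "r \<in> S y" "s < r"
      using less_cSup_iff[OF _ bdd[OF y]] by blast
    then show ?thesis using that m_anti[of s r] by (auto simp: S_def)
  qed
  have tau_nonneg: "0 \<le> \<tau> y" for y
    using bdd[of y] by (auto simp: \<tau>_def S_def intro!: cSup_upper)
  have [measurable]: "\<tau> \<in> borel_measurable borel"
  proof (rule borel_measurable_antimono)
    fix s t :: real assume st: "0 < s" "s \<le> t"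
    then show "\<tau> t \<le> \<tau> s"
      using bdd[of s] by (auto simp: \<tau>_def S_def intro!: cSup_subset_mono)
  qed (auto simp: tau_nonneg, simp add: \<tau>_def)
  have "ennreal (f t) = (\<integral>\<^sup>+y. ennreal (max 0 (\<tau> y - t)) \<partial>lborel)" if t: "t > 0" for t
  proof -
    have "ennreal (m s) = (\<integral>\<^sup>+y. indicator {0<..<m s} y \<partial>lborel)" for s
      using m_nonneg[of s] by simp
    then have "ennreal (f t) = (\<integral>\<^sup>+s. (\<integral>\<^sup>+y. indicator {0<..<m s} y \<partial>lborel) * indicator {t..} s \<partial>lborel)"
      unfolding dens[OF t] by simp
    also have "\<dots> = (\<integral>\<^sup>+s. \<integral>\<^sup>+y. indicator {p. 0 < snd p \<and> snd p < m (fst p) \<and> t \<le> fst p} (s, y) \<partial>lborel \<partial>lborel)"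
    proof (rule nn_integral_cong)
      fix s
      show "(\<integral>\<^sup>+y. indicator {0<..<m s} y \<partial>lborel) * indicator {t..} s
         = (\<integral>\<^sup>+y. indicator {p. 0 < snd p \<and> snd p < m (fst p) \<and> t \<le> fst p} (s, y) \<partial>lborel)"
        by (subst nn_integral_multc[symmetric]) (auto intro!: nn_integral_cong simp: indicator_def)
    qed
    also have "\<dots> = (\<integral>\<^sup>+y. \<integral>\<^sup>+s. indicator {p. 0 < snd p \<and> snd p < m (fst p) \<and> t \<le> fst p} (s, y) \<partial>lborel \<partial>lborel)"
      by (rule lborel_pair.Fubini'[symmetric]) measurable
    also have "\<dots> = (\<integral>\<^sup>+y. ennreal (max 0 (\<tau> y - t)) \<partial>lborel)"
    proof (rule nn_integral_cong)
      fix y :: real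
      show "(\<integral>\<^sup>+s. indicator {p. 0 < snd p \<and> snd p < m (fst p) \<and> t \<le> fst p} (s, y) \<partial>lborel) = ennreal (max 0 (\<tau> y - t))"
      proof (cases "y > 0")
        case True
        have "(\<integral>\<^sup>+s. indicator {p. 0 < snd p \<and> snd p < m (fst p) \<and> t \<le> fst p} (s, y) \<partial>lborel)
            = (\<integral>\<^sup>+s. indicator {t..\<tau> y} s \<partial>lborel)"
        proof (rule nn_integral_cong_AE)
          show "AE s in lborel. (indicator {p. 0 < snd p \<and> snd p < m (fst p) \<and> t \<le> fst p} (s, y) :: ennreal) = indicator {t..\<tau> y} s"
            using AE_lborel_singleton[of "\<tau> y"]
          proof eventually_elim
            case (elim s)
            show ?case using True elim in_S[of y s] S_in[of y s] t by (auto simp: indicator_def)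
          qed
        qed
        also have "\<dots> = ennreal (max 0 (\<tau> y - t))"
          by (cases "t \<le> \<tau> y") auto
        finally show ?thesis .
      next
        case False
        then show ?thesis using t by (simp add: \<tau>_def)
      qed
    qed
    finally show ?thesis .
  qed
  then show thesis using that[of \<tau>] tau_nonneg by auto
qed

section \<open>Multiply monotone functions\<close>

text \<open>The signs propagate downwards: convexity makes \<open>F n\<close> nonincreasing, hence
  nonnegative with limit 0. As \<open>F k\<close> has derivative \<open>- F (Suc k)\<close>, the
  same follows for every lower order, and \<open>F k t\<close> is the integral of
  \<open>F (Suc k)\<close> over \<open>[t, \<infinity>)\<close>.\<close>

lemma williamson_representation:
  fixes \<phi> :: "real \<Rightarrow> real"
  assumes cont: "continuous_on {0..} \<phi>" and lim: "(\<phi> \<longlongrightarrow> 0) at_top"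
    and diff: "\<And>k t. k < n \<Longrightarrow> t > 0 \<Longrightarrow> (deriv ^^ k) \<phi> field_differentiable at t"
    and conv: "convex_on {0<..} (\<lambda>t. (-1) ^ n * (deriv ^^ n) \<phi> t)"
  obtains \<tau> :: "real \<Rightarrow> real" where "\<tau> \<in> borel_measurable borel" "\<And>y. 0 \<le> \<tau> y"
    "\<And>t. t \<ge> 0 \<Longrightarrow> 0 \<le> \<phi> t"
    "\<And>t. t \<ge> 0 \<Longrightarrow> ennreal (\<phi> t) = (\<integral>\<^sup>+y. ennreal (max 0 (\<tau> y - t) ^ Suc n / fact (Suc n)) \<partial>lborel)"
proof -
  define F where "F k t = (-1) ^ k * (deriv ^^ k) \<phi> t" for k t
  have DF: "DERIV (F k) t :> - F (Suc k) t" if "k < n" "t > 0" for k t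
  proof -
    have "DERIV ((deriv ^^ k) \<phi>) t :> (deriv ^^ Suc k) \<phi> t"
      using diff[OF that] by (simp add: DERIV_deriv_iff_field_differentiable)
    from DERIV_cmult[OF this, of "(-1) ^ k"] show ?thesis by (simp add: F_def[abs_def])
  qed
  have Fn_anti: "F n t \<le> F n s" if "0 < s" "s \<le> t" for s t
    unfolding F_def by (rule convex_imp_antimono[OF lim diff conv that])
  have "(\<forall>s t. 0 < s \<longrightarrow> s \<le> t \<longrightarrow> F (n - k) t \<le> F (n - k) s) \<and> (\<forall>t>0. 0 \<le> F (n - k) t) \<and> (F (n - k) \<longlongrightarrow> 0) at_top"
    if "k \<le> n" for k
    using that
  proof (induction k)
    case 0
    have "\<And>t. t > 0 \<Longrightarrow> F n t \<ge> 0" "(F n \<longlongrightarrow> 0) at_top"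
      using antimono_imp_nonneg_tendsto_0[OF lim diff, of n "(-1) ^ n"] Fn_anti unfolding F_def[abs_def] by auto
    then show ?case using Fn_anti by simp
  next
    case (Suc k)
    define j where "j = n - Suc k"
    have j: "j < n" "Suc j = n - k" using Suc.prems by (auto simp: j_def)
    have anti: "F j t \<le> F j s" if "0 < s" "s \<le> t" for s t
    proof (rule DERIV_nonpos_imp_nonincreasing[where f = "F j"])
      show "s \<le> t" by fact
      fix x assume "s \<le> x" "x \<le> t"
      then have "x > 0" using that by simp
      then show "\<exists>y. DERIV (F j) x :> y \<and> y \<le> 0"
        using DF[OF j(1) \<open>x > 0\<close>] Suc by (intro exI[of _ "- F (Suc j) x"]) (auto simp: j)
    qed
    have "\<And>t. t > 0 \<Longrightarrow> F j t \<ge> 0" "(F j \<longlongrightarrow> 0) at_top"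
      using antimono_imp_nonneg_tendsto_0[OF lim diff, of j "(-1) ^ j"] anti j unfolding F_def[abs_def] by auto
    then show ?case using anti unfolding j_def[symmetric] by simp
  qed
  then have F_anti: "0 < s \<Longrightarrow> s \<le> t \<Longrightarrow> F k t \<le> F k s" and F_nonneg: "t > 0 \<Longrightarrow> 0 \<le> F k t"
    and F_lim: "(F k \<longlongrightarrow> 0) at_top" if "k \<le> n" for k s t
    using that diff_diff_cancel[OF that] diff_le_self[of n k] by metis+
  have "\<exists>\<tau>::real \<Rightarrow> real. \<tau> \<in> borel_measurable borel \<and> (\<forall>y. 0 \<le> \<tau> y) \<and>
      (\<forall>t>0. ennreal (F n t) = (\<integral>\<^sup>+y. ennreal (max 0 (\<tau> y - t)) \<partial>lborel))"
  proof (rule convex_layer_cake[of "F n"])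
    show "convex_on {0<..} (F n)" using conv by (simp add: F_def[abs_def])
    show "F n t \<le> F n s" if "0 < s" "s \<le> t" for s t using F_anti that by blast
    show "0 \<le> F n t" if "t > 0" for t using F_nonneg that by blast
    show "(F n \<longlongrightarrow> 0) at_top" using F_lim by blast
    fix \<tau> :: "real \<Rightarrow> real"
    assume h: "\<tau> \<in> borel_measurable borel" "\<And>y. 0 \<le> \<tau> y"
      "\<And>t. t > 0 \<Longrightarrow> ennreal (F n t) = (\<integral>\<^sup>+y. ennreal (max 0 (\<tau> y - t)) \<partial>lborel)"
    show ?thesis by (rule exI[of _ \<tau>]) (simp add: h)
  qed
  then obtain \<tau> :: "real \<Rightarrow> real" where [measurable]: "\<tau> \<in> borel_measurable borel" and tau: "\<And>y. 0 \<le> \<tau> y"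
    and layer: "\<And>t. t > 0 \<Longrightarrow> ennreal (F n t) = (\<integral>\<^sup>+y. ennreal (max 0 (\<tau> y - t)) \<partial>lborel)"
    by blast
  have rep: "\<forall>t>0. ennreal (F (n - k) t) = (\<integral>\<^sup>+y. ennreal (max 0 (\<tau> y - t) ^ Suc k / fact (Suc k)) \<partial>lborel)"
    if "k \<le> n" for k
    using that
  proof (induction k)
    case 0
    then show ?case using layer by simp
  next
    case (Suc k)
    define j where "j = n - Suc k"
    have j: "j < n" "Suc j = n - k" "Suc j \<le> n" "j \<le> n" using Suc.prems by (auto simp: j_def)
    show ?case
    proof (intro allI impI)
      fix t :: real assume t: "t > 0"
      \<comment> \<open>The cutoff gives a Borel function on the whole line; for
        \<open>s \<le> 0\<close> nothing is known about the derivatives.\<close>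
      define f where "f s = (if s > 0 then F (Suc j) s else 0)" for s
      have [measurable]: "f \<in> borel_measurable borel"
        by (rule borel_measurable_antimono) (use F_anti[OF j(3)] F_nonneg[OF j(3)] in \<open>auto simp: f_def\<close>)
      have "(\<integral>\<^sup>+s. ennreal (f s) * indicator {t..} s \<partial>lborel) = ennreal (0 - (- F j t))"
      proof (rule nn_integral_FTC_atLeast)
        show "DERIV (\<lambda>s. - F j s) s :> f s" if "t \<le> s" for s
          using DERIV_minus[OF DF[OF j(1), of s]] that t by (simp add: f_def)
        show "0 \<le> f s" for s using F_nonneg[OF j(3)] by (simp add: f_def)
        show "((\<lambda>s. - F j s) \<longlongrightarrow> 0) at_top" using tendsto_minus[OF F_lim[OF j(4)]] by simp
      qed measurable
      then have "ennreal (F j t) = (\<integral>\<^sup>+s. ennreal (f s) * indicator {t..} s \<partial>lborel)" by simp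
      also have "\<dots> = (\<integral>\<^sup>+s. \<integral>\<^sup>+y. ennreal (max 0 (\<tau> y - s) ^ Suc k / fact (Suc k)) * indicator {t..} s \<partial>lborel \<partial>lborel)"
      proof (rule nn_integral_cong)
        fix s :: real
        show "ennreal (f s) * indicator {t..} s = (\<integral>\<^sup>+y. ennreal (max 0 (\<tau> y - s) ^ Suc k / fact (Suc k)) * indicator {t..} s \<partial>lborel)"
        proof (cases "t \<le> s")
          case True
          then show ?thesis using Suc t by (simp add: f_def j)
        qed simp
      qed
      also have "\<dots> = (\<integral>\<^sup>+y. \<integral>\<^sup>+s. ennreal (max 0 (\<tau> y - s) ^ Suc k / fact (Suc k)) * indicator {t..} s \<partial>lborel \<partial>lborel)"
        by (rule lborel_pair.Fubini'[symmetric]) measurable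
      also have "\<dots> = (\<integral>\<^sup>+y. ennreal (max 0 (\<tau> y - t) ^ Suc (Suc k) / fact (Suc (Suc k))) \<partial>lborel)"
      proof (rule nn_integral_cong)
        fix y :: real
        have "(\<integral>\<^sup>+s. ennreal (max 0 (\<tau> y - s) ^ Suc k / fact (Suc k)) * indicator {t..} s \<partial>lborel)
          = ennreal (0 - (- (max 0 (\<tau> y - t) ^ Suc (Suc k) / fact (Suc (Suc k)))))"
        proof (rule nn_integral_FTC_atLeast)
          fix s
          have "DERIV (\<lambda>s. \<tau> y - s) s :> - 1" by (auto intro!: derivative_eq_intros)
          from DERIV_minus[OF DERIV_cdivide[OF DERIV_max_power_Suc[OF this, of "Suc k"], of "fact (Suc (Suc k))"]]
          have "DERIV (\<lambda>s. - (max 0 (\<tau> y - s) ^ Suc (Suc k) / fact (Suc (Suc k)))) s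
             :> - (real (Suc (Suc k)) * max 0 (\<tau> y - s) ^ Suc k * - 1 / fact (Suc (Suc k)))" by simp
          also have "- (real (Suc (Suc k)) * max 0 (\<tau> y - s) ^ Suc k * - 1 / fact (Suc (Suc k))) = max 0 (\<tau> y - s) ^ Suc k / fact (Suc k)"
          proof -
            have "N \<noteq> 0 \<Longrightarrow> - (N * P * - 1 / (N * Q)) = P / Q" for N P Q :: real by simp
            from this[of "real (Suc (Suc k))" "max 0 (\<tau> y - s) ^ Suc k" "fact (Suc k)"]
            show ?thesis unfolding fact_Suc[of "Suc k"] by (simp del: of_nat_Suc power_Suc fact_Suc)
          qed
          finally show "DERIV (\<lambda>s. - (max 0 (\<tau> y - s) ^ Suc (Suc k) / fact (Suc (Suc k)))) s
             :> max 0 (\<tau> y - s) ^ Suc k / fact (Suc k)" .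
        next
          have "- (max 0 (\<tau> y - s) ^ Suc (Suc k) / fact (Suc (Suc k))) = 0" if "\<tau> y \<le> s" for s
            using that by simp
          then show "((\<lambda>s. - (max 0 (\<tau> y - s) ^ Suc (Suc k) / fact (Suc (Suc k)))) \<longlongrightarrow> 0) at_top"
            by (intro tendsto_eventually eventually_mono[OF eventually_ge_at_top[of "\<tau> y"]])
        qed auto
        then show "(\<integral>\<^sup>+s. ennreal (max 0 (\<tau> y - s) ^ Suc k / fact (Suc k)) * indicator {t..} s \<partial>lborel)
          = ennreal (max 0 (\<tau> y - t) ^ Suc (Suc k) / fact (Suc (Suc k)))" by simp
      qed
      finally show "ennreal (F (n - Suc k) t) = (\<integral>\<^sup>+y. ennreal (max 0 (\<tau> y - t) ^ Suc (Suc k) / fact (Suc (Suc k))) \<partial>lborel)"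
        by (simp add: j_def)
    qed
  qed
  have F0: "F 0 = \<phi>" by (simp add: F_def fun_eq_iff)
  define K where "K t y = max 0 (\<tau> y - t) ^ Suc n / fact (Suc n)" for t y
  have pos: "ennreal (\<phi> t) = (\<integral>\<^sup>+y. ennreal (K t y) \<partial>lborel)" "\<phi> t \<ge> 0" if "t > 0" for t
    using rep[of n] that F_nonneg[of 0 t] unfolding K_def by (auto simp: F0 simp del: power_Suc fact_Suc)
  \<comment> \<open>The derivatives live on the open half-line, so \<open>t = 0\<close> needs a
    separate argument: along \<open>r i\<close> the kernels increase to \<open>K 0 y\<close>, and
    monotone convergence meets the continuity of \<phi> at 0.\<close>
  define r where "r i = 1 / real (Suc i)" for i
  have r: "r i > 0" "r \<longlonglongrightarrow> 0" for i
    using LIMSEQ_inverse_real_of_nat by (auto simp: r_def[abs_def] inverse_eq_divide)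
  have "(\<phi> \<longlongrightarrow> \<phi> 0) (at 0 within {0..})"
    using cont by (simp add: continuous_on_def)
  moreover have "filterlim r (at 0 within {0..}) sequentially"
    using r by (auto simp: filterlim_at intro!: always_eventually less_imp_le) (metis less_irrefl)
  ultimately have phi0: "(\<lambda>i. \<phi> (r i)) \<longlonglongrightarrow> \<phi> 0" by (rule filterlim_compose)
  have "\<phi> 0 \<ge> 0" by (rule LIMSEQ_le_const[OF phi0]) (use pos(2) r in auto)
  have "(\<lambda>i. \<integral>\<^sup>+y. ennreal (K (r i) y) \<partial>lborel) \<longlonglongrightarrow> (\<integral>\<^sup>+y. ennreal (K 0 y) \<partial>lborel)"
  proof (rule nn_integral_LIMSEQ)
    show "incseq (\<lambda>i y. ennreal (K (r i) y))"
    proof (intro incseq_SucI le_funI ennreal_leI)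
      fix i y
      have "r (Suc i) \<le> r i" by (simp add: r_def field_simps)
      then show "K (r i) y \<le> K (r (Suc i)) y"
        unfolding K_def by (intro divide_right_mono power_mono) auto
    qed
    show "(\<lambda>y. ennreal (K (r i) y)) \<in> borel_measurable lborel" for i unfolding K_def by measurable
    show "(\<lambda>i. ennreal (K (r i) y)) \<longlonglongrightarrow> ennreal (K 0 y)" for y
      unfolding K_def by (intro tendsto_ennrealI tendsto_intros r) auto
  qed
  moreover have "(\<lambda>i. \<integral>\<^sup>+y. ennreal (K (r i) y) \<partial>lborel) = (\<lambda>i. ennreal (\<phi> (r i)))"
    using pos(1) r(1) by simp
  ultimately have "ennreal (\<phi> 0) = (\<integral>\<^sup>+y. ennreal (K 0 y) \<partial>lborel)"
    using LIMSEQ_unique tendsto_ennrealI[OF phi0] by metis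
  then have all: "ennreal (\<phi> t) = (\<integral>\<^sup>+y. ennreal (K t y) \<partial>lborel)" "\<phi> t \<ge> 0" if "t \<ge> 0" for t
    using that pos[of t] \<open>\<phi> 0 \<ge> 0\<close> by (cases "t = 0"; simp)+
  show thesis
    by (rule that[of \<tau>]) (use tau all in \<open>auto simp: K_def\<close>)
qed

section \<open>The criterion on spheres\<close>

lemma mem_nsphere_iff:
  "x \<in> topspace (nsphere d) \<longleftrightarrow> (\<Sum>i\<le>d. (x i)\<^sup>2) = 1 \<and> (\<forall>i>d. x i = 0)"
  by (auto simp: nsphere)

text \<open>The sums of squares of \<open>x - y\<close> and \<open>x + y\<close> are
  \<open>2 - 2 p\<close> and \<open>2 + 2 p\<close>, so \<open>p\<close> lies in
  \<open>[-1, 1]\<close>, and \<open>p = 1\<close> forces equality of the points.\<close>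

lemma great_circle_dist_properties:
  assumes x: "x \<in> topspace (nsphere d)" and y: "y \<in> topspace (nsphere d)"
  shows "0 \<le> great_circle_dist d x y" "great_circle_dist d x y \<le> pi"
    "great_circle_dist d x x = 0" "x \<noteq> y \<Longrightarrow> great_circle_dist d x y > 0"
proof -
  define p where "p = (\<Sum>i\<le>d. x i * y i)"
  have xx: "(\<Sum>i\<le>d. (x i)\<^sup>2) = 1" and yy: "(\<Sum>i\<le>d. (y i)\<^sup>2) = 1" using x y by (auto simp: mem_nsphere_iff)
  have "(\<Sum>i\<le>d. (x i - y i)\<^sup>2) = (\<Sum>i\<le>d. (x i)\<^sup>2 + (y i)\<^sup>2 - 2 * (x i * y i))"
    by (simp add: power2_diff mult.assoc)
  also have "\<dots> = 2 - 2 * p"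
    using xx yy by (simp add: p_def sum.distrib sum_subtractf sum_distrib_left)
  finally have minus: "(\<Sum>i\<le>d. (x i - y i)\<^sup>2) = 2 - 2 * p" .
  have "(\<Sum>i\<le>d. (x i + y i)\<^sup>2) = (\<Sum>i\<le>d. (x i)\<^sup>2 + (y i)\<^sup>2 + 2 * (x i * y i))"
    by (simp add: power2_sum mult.assoc)
  also have "\<dots> = 2 + 2 * p"
    using xx yy by (simp add: p_def sum.distrib sum_distrib_left)
  finally have plus: "(\<Sum>i\<le>d. (x i + y i)\<^sup>2) = 2 + 2 * p" .
  have "0 \<le> (\<Sum>i\<le>d. (x i - y i)\<^sup>2)" "0 \<le> (\<Sum>i\<le>d. (x i + y i)\<^sup>2)" by (auto intro: sum_nonneg)
  then have p: "-1 \<le> p" "p \<le> 1" unfolding minus plus by auto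
  show "0 \<le> great_circle_dist d x y" "great_circle_dist d x y \<le> pi"
    using p by (auto simp: great_circle_dist_def p_def intro: arccos_lbound arccos_ubound)
  show "great_circle_dist d x x = 0"
    using xx by (simp add: great_circle_dist_def power2_eq_square)
  show "great_circle_dist d x y > 0" if "x \<noteq> y"
  proof -
    have "p \<noteq> 1"
    proof
      assume "p = 1"
      then have "(\<Sum>i\<le>d. (x i - y i)\<^sup>2) = 0" using minus by simp
      then have "\<forall>i\<in>{..d}. (x i - y i)\<^sup>2 = 0" by (subst (asm) sum_nonneg_eq_0_iff) auto
      then have "x i = y i" for i using x y by (cases "i \<le> d") (auto simp: mem_nsphere_iff)
      with \<open>x \<noteq> y\<close> show False by auto
    qed
    then have "arccos 1 < arccos p" using p by (intro arccos_less_arccos) auto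
    then show ?thesis by (simp add: great_circle_dist_def p_def)
  qed
qed

text \<open>A bijection of \<open>'k\<close> with the indices up to \<open>2 n + 1\<close> preserves
  inner products. The type \<open>'k\<close> occurs only in \<open>dim\<close>, so it is chosen by
  the fact supplied for that assumption.\<close>

lemma cap_kernel_nsphere_nonneg:
  fixes x :: "'i \<Rightarrow> nat \<Rightarrow> real" and c :: "'i \<Rightarrow> real"
  assumes dim: "CARD('k::{finite,wellorder}) = 2 * n + 2" and I: "finite I"
    and x: "\<And>i. i \<in> I \<Longrightarrow> x i \<in> topspace (nsphere (2 * n + 1))" and n: "n \<ge> 1" and u: "u > -1"
  shows "0 \<le> (\<Sum>i\<in>I. \<Sum>j\<in>I. c i * c j * cap_kernel n u (great_circle_dist (2 * n + 1) (x i) (x j)))"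
proof -
  have "card (UNIV :: 'k set) = card {..2 * n + 1}" using dim by simp
  then obtain h :: "'k \<Rightarrow> nat" where h: "bij_betw h UNIV {..2 * n + 1}"
    using finite_same_card_bij[of "UNIV :: 'k set" "{..2 * n + 1}"] by auto
  define X :: "'i \<Rightarrow> real^'k::_" where "X i = (\<chi> k. x i (h k))" for i
  have inner: "X i \<bullet> X j = (\<Sum>k\<le>2 * n + 1. x i k * x j k)" for i j
    using sum.reindex_bij_betw[OF h, of "\<lambda>k. x i k * x j k"] by (simp add: X_def inner_vec_def)
  have "norm (X i) = 1" if "i \<in> I" for i
    using x[OF that] by (simp add: norm_eq_1 inner mem_nsphere_iff power2_eq_square del: sum.atMost_Suc)
  from cap_kernel_quadratic_form_nonneg[of I X n u c, OF I this dim n u]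
  show ?thesis unfolding great_circle_dist_def inner .
qed

theorem theorem6:
  fixes n :: nat and \<phi> :: "real \<Rightarrow> real"
  assumes "n \<ge> 1" and "n \<le> 3"
    and "continuous_on {0..} \<phi>"
    and "\<phi> 0 = 1"
    and "(\<phi> \<longlongrightarrow> 0) at_top"
    and "\<And>k t. k < n \<Longrightarrow> t > 0 \<Longrightarrow> (deriv ^^ k) \<phi> field_differentiable at t"
    and "convex_on {0<..} (\<lambda>t. (-1) ^ n * (deriv ^^ n) \<phi> t)"
  shows "restrict \<phi> {0..pi} \<in> Psi_plus (2 * n + 1)"
proof -
  obtain \<tau> :: "real \<Rightarrow> real" where [measurable]: "\<tau> \<in> borel_measurable borel" and tau: "\<And>y. 0 \<le> \<tau> y"
    and phi: "\<And>t. t \<ge> 0 \<Longrightarrow> 0 \<le> \<phi> t"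
      "\<And>t. t \<ge> 0 \<Longrightarrow> ennreal (\<phi> t) = (\<integral>\<^sup>+y. ennreal (max 0 (\<tau> y - t) ^ Suc n / fact (Suc n)) \<partial>lborel)"
    using williamson_representation[OF assms(3,5,6,7)] by blast
  have n: "n \<in> {1, 2, 3}" using assms(1,2) by auto
  define d where "d = 2 * n + 1"
  have pos: "0 < (\<Sum>i\<in>I. \<Sum>j\<in>I. c i * c j * \<phi> (great_circle_dist d (x i) (x j)))"
    if I: "finite I" and x: "\<And>i. i \<in> I \<Longrightarrow> x i \<in> topspace (nsphere d)" and inj: "inj_on x I"
      and c: "i\<^sub>0 \<in> I" "c i\<^sub>0 \<noteq> 0" for I :: "nat set" and x c i\<^sub>0
  proof -
    define \<theta> where "\<theta> i j = great_circle_dist d (x i) (x j)" for i j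
    have th: "0 \<le> \<theta> i j \<and> \<theta> i j \<le> pi" "\<theta> i i = 0" "i \<noteq> j \<Longrightarrow> \<theta> i j > 0" if "i \<in> I" "j \<in> I" for i j
    proof -
      show "0 \<le> \<theta> i j \<and> \<theta> i j \<le> pi" "\<theta> i i = 0"
        using great_circle_dist_properties(1-3)[OF x[OF that(1)] x[OF that(2)]] by (simp_all add: \<theta>_def)
      show "\<theta> i j > 0" if "i \<noteq> j"
      proof -
        have "x i \<noteq> x j" using inj_onD[OF inj _ \<open>i \<in> I\<close> \<open>j \<in> I\<close>] \<open>i \<noteq> j\<close> by blast
        then show ?thesis
          using great_circle_dist_properties(4)[OF x[OF \<open>i \<in> I\<close>] x[OF \<open>j \<in> I\<close>]] by (simp add: \<theta>_def)
      qed
    qed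
    have psd: "0 \<le> (\<Sum>i\<in>I. \<Sum>j\<in>I. c i * c j * cap_kernel n u (\<theta> i j))" if "u > -1" for u
    proof -
      txt \<open>The dimension of the ambient space is a type, namely \<open>4\<close>, \<open>6\<close> or \<open>8\<close>.\<close>
      consider "CARD(4) = 2 * n + 2" | "CARD(6) = 2 * n + 2" | "CARD(8) = 2 * n + 2" using n by auto
      then show ?thesis
        unfolding \<theta>_def d_def
        by cases (rule cap_kernel_nsphere_nonneg[OF _ I x[unfolded d_def] assms(1) that], assumption+)+
    qed
    define q where "q y = (\<Sum>i\<in>I. \<Sum>j\<in>I. c i * c j * (max 0 (\<tau> y - \<theta> i j) ^ Suc n / fact (Suc n)))" for y
    have q_pos: "q y > 0" if "\<tau> y > 0" for y
    proof -
      have "0 < (\<Sum>i\<in>I. \<Sum>j\<in>I. c i * c j * max 0 (\<tau> y - \<theta> i j) ^ Suc n) / fact (Suc n)"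
        using truncated_power_quadratic_form_pos[OF I th(1) th(2) th(3) psd c n that]
        by (intro divide_pos_pos) auto
      then show ?thesis by (simp add: q_def sum_divide_distrib del: power_Suc fact_Suc)
    qed
    \<comment> \<open>Here \<tau> is only known to be nonnegative; where it vanishes the form is 0
      whatever the coefficients, so strictness must come from the remaining
      \<open>y\<close>.\<close>
    have q_zero: "q y = 0" if "\<tau> y = 0" for y
      unfolding q_def
    proof (intro sum.neutral ballI)
      fix i j assume "i \<in> I" "j \<in> I"
      then have "max 0 (\<tau> y - \<theta> i j) = 0" using that th(1) by simp
      then show "c i * c j * (max 0 (\<tau> y - \<theta> i j) ^ Suc n / fact (Suc n)) = 0" by simp
    qed
    have q_nonneg: "q y \<ge> 0" for y using q_pos[of y] q_zero[of y] tau[of y] by (cases "\<tau> y = 0") auto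
    have int: "integrable lborel q" and Q: "(\<Sum>i\<in>I. \<Sum>j\<in>I. c i * c j * \<phi> (\<theta> i j)) = (LINT y|lborel. q y)"
      using nn_mixture_quadratic_form[where I = I and A = "\<lambda>i j. \<phi> (\<theta> i j)" and M = lborel and c = c
          and K = "\<lambda>y i j. max 0 (\<tau> y - \<theta> i j) ^ Suc n / fact (Suc n)"] phi th(1)
      unfolding q_def[abs_def] by auto
    \<comment> \<open>If the integral vanished, \<tau> would be 0 almost everywhere, and the
      representation at \<open>t = 0\<close> would give \<open>\<phi> 0 = 0\<close> instead of
      1.\<close>
    have "(LINT y|lborel. q y) \<noteq> 0"
    proof
      assume "(LINT y|lborel. q y) = 0"
      then have "AE y in lborel. q y = 0"
        using int q_nonneg by (subst (asm) integral_nonneg_eq_0_iff_AE) auto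
      then have "AE y in lborel. ennreal (max 0 (\<tau> y - 0) ^ Suc n / fact (Suc n)) = 0"
      proof eventually_elim
        case (elim y)
        then have "\<tau> y = 0" using q_pos[of y] tau[of y] by force
        then show ?case by simp
      qed
      then have "ennreal (\<phi> 0) = 0"
        unfolding phi(2)[OF order_refl] by (subst nn_integral_0_iff_AE) auto
      then show False using assms(4) by simp
    qed
    moreover have "(LINT y|lborel. q y) \<ge> 0" using q_nonneg by (intro integral_nonneg_AE) auto
    ultimately show ?thesis unfolding Q[unfolded \<theta>_def] by linarith
  qed
  have "strictly_positive_definite_on (topspace (nsphere d)) (\<lambda>x y. restrict \<phi> {0..pi} (great_circle_dist d x y))"
    unfolding strictly_positive_definite_on_def
  proof (intro allI impI)
    fix m and x :: "nat \<Rightarrow> nat \<Rightarrow> real" and c :: "nat \<Rightarrow> real"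
    assume "x ` {1..m} \<subseteq> topspace (nsphere d) \<and> inj_on x {1..m}"
    then have x: "\<And>i. i \<in> {1..m} \<Longrightarrow> x i \<in> topspace (nsphere d)" "inj_on x {1..m}" by auto
    \<comment> \<open>All distances lie in \<open>[0, pi]\<close>, so the restriction never returns
      its default value.\<close>
    have eq: "(\<Sum>i=1..m. \<Sum>j=1..m. c i * c j * restrict \<phi> {0..pi} (great_circle_dist d (x i) (x j)))
        = (\<Sum>i=1..m. \<Sum>j=1..m. c i * c j * \<phi> (great_circle_dist d (x i) (x j)))"
      using great_circle_dist_properties(1,2)[OF x(1) x(1)] by (intro sum.cong refl) auto
    show "0 \<le> (\<Sum>i=1..m. \<Sum>j=1..m. c i * c j * restrict \<phi> {0..pi} (great_circle_dist d (x i) (x j))) \<and>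
         (\<not> (\<forall>i\<in>{1..m}. c i = 0) \<longrightarrow>
            0 < (\<Sum>i=1..m. \<Sum>j=1..m. c i * c j * restrict \<phi> {0..pi} (great_circle_dist d (x i) (x j))))"
    proof (cases "\<forall>i\<in>{1..m}. c i = 0")
      case False
      then obtain i\<^sub>0 where "i\<^sub>0 \<in> {1..m}" "c i\<^sub>0 \<noteq> 0" by blast
      then have "0 < (\<Sum>i=1..m. \<Sum>j=1..m. c i * c j * \<phi> (great_circle_dist d (x i) (x j)))"
        using x by (intro pos[where x = x and c = c and i\<^sub>0 = i\<^sub>0]) auto
      then show ?thesis unfolding eq by simp
    qed simp
  qed
  moreover have "continuous_on {0..pi} (restrict \<phi> {0..pi})"
    by (rule continuous_on_eq[OF continuous_on_subset[OF assms(3)]]) auto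
  ultimately show ?thesis
    using assms(4) by (simp add: Psi_plus_def d_def)
qed

end
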